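(* Let $n,m\geqslant 1$. For every $j=1,\dots,m$, every $\kappa\geqslant1$ and every choice of $\kappa$ indices $i_1,\dots,i_\kappa\in\{1,\dots,n\}$, the coefficient ${\bf Y}^j_{i_1,\dots,i_\kappa}$ of the $\kappa$-th prolongation of the vector field $\mathcal{L}=\sum_{i=1}^n\mathcal{X}^i(x,y)\frac{\partial}{\partial x^i}+\sum_{j=1}^m\mathcal{Y}^j(x,y)\frac{\partial}{\partial y^j}$ is $$ \begin{aligned} {\bf Y}_{i_1,\dots,i_\kappa}^j &=\frac{\partial^\kappa\mathcal{Y}^j}{\partial x^{i_1}\cdots\partial x^{i_\kappa}} +\sum_{d=1}^{\kappa+1}\ \sum_{1\leqslant\lambda_1<\cdots<\lambda_d\leqslant\kappa}\ \sum_{\substack{\mu_1\geqslant1,\dots,\mu_d\geqslant1\\ s\leqslant\kappa+1}}\ \sum_{(l_{e:\nu})}\ \sum_{(k_{e:\nu:\gamma})}\\ &\Bigg[\ \sum_{\sigma\in\mathfrak{F}}\ \sum_{\tau\in\mathfrak{S}_\kappa^{s}}\Big(\prod_{t=1}^{s}\delta_{i_{\tau(t)}}^{k_{\sigma(t)}}\Big)\, \frac{\partial^{\kappa-s+\mu_1+\cdots+\mu_d}\,\mathcal{Y}^j}{\partial x^{i_{\tau(s+1)}}\cdots\partial x^{i_{\tau(\kappa)}}\,\partial y^{l_{1:1}}\cdots\partial y^{l_{d:\mu_d}}}\\ &\ -\sum_{\sigma\in\mathfrak{F}}\ \sum_{\tau\in\mathfrak{S}_\kappa^{s-1}}\Big(\prod_{t=1}^{s-1}\delta_{i_{\tau(t)}}^{k_{\sigma(t)}}\Big)\,\delta^{j}_{l_{\pi\sigma(s)}}\,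 \frac{\partial^{\kappa-s+\mu_1+\cdots+\mu_d}\,\mathcal{X}^{k_{\sigma(s)}}}{\partial x^{i_{\tau(s)}}\cdots\partial x^{i_{\tau(\kappa)}}\,\partial y^{l_{1:1}}\cdots\widehat{\partial y^{l_{\pi\sigma(s)}}}\cdots\partial y^{l_{d:\mu_d}}}\Bigg]\\ &\times\prod_{e=1}^d\ \prod_{\nu=1}^{\mu_e} y^{l_{e:\nu}}_{k_{e:\nu:1},\dots,k_{e:\nu:\lambda_e}}, \end{aligned} $$ where $s:=\mu_1\lambda_1+\cdots+\mu_d\lambda_d$, the sum over $(l_{e:\nu})$ runs over all families of indices $l_{e:\nu}\in\{1,\dots,m\}$ ($1\leqslant e\leqslant d$, $1\leqslant\nu\leqslant\mu_e$), the sum over $(k_{e:\nu:\gamma})$ runs over all families $k_{e:\nu:\gamma}\in\{1,\dots,n\}$ ($1\leqslant e\leqslant d$, $1\leqslant\nu\leqslant\mu_e$, $1\leqslant\gamma\leqslant\lambda_e$), $\mathfrak{F}=\mathfrak{F}_{\mu_1\lambda_1+\cdots+\mu_d\lambda_d}^{(\mu_1,\lambda_1),\dots,(\mu_d,\lambda_d)}$, and the hat means that the corresponding derivative is omitted.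
   Context: Let $\mathbb{K}=\mathbb{R}$ or $\mathbb{C}$, $x\in\mathbb{K}^n$, $y\in\mathbb{K}^m$, and let $\mathcal{X}^i,\mathcal{Y}^j$ be smooth functions of $(x,y)$. Jet variables $y^j_{i_1,\dots,i_\lambda}$ ($1\leqslant j\leqslant m$, $1\leqslant i_1,\dots,i_\lambda\leqslant n$) are symmetric in their lower indices. $D_i$ denotes the $i$-th total derivative: the derivation with $D_i f=\frac{\partial f}{\partial x^i}+\sum_{j}y_i^j\frac{\partial f}{\partial y^j}$ for $f=f(x,y)$ and $D_i\,y^j_{i_1,\dots,i_\lambda}=y^j_{i,i_1,\dots,i_\lambda}$. The coefficients of the prolongation are defined by ${\bf Y}^j_{i_1}:=D_{i_1}(\mathcal{Y}^j)-\sum_{k=1}^nD_{i_1}(\mathcal{X}^k)\,y^j_k$ and, inductively, $${\bf Y}^j_{i_1,\dots,i_\kappa}:=D_{i_\kappa}\big({\bf Y}^j_{i_1,\dots,i_{\kappa-1}}\big)-\sum_{k=1}^nD_{i_\kappa}(\mathcal{X}^k)\,y^j_{i_1,\dots,i_{\kappa-1},k}.$$ Permutations. The set of triples $e\!:\!\nu\!:\!\gamma$ ($1\leqslant e\leqslant d$, $1\leqslant\nu\leqslant\mu_e$, $1\leqslant\gamma\leqslant\lambda_e$), ordered lexicographically, is identified with $\{1,\dots,s\}$; thus $\sigma(t)$ denotes a triple and $s$ corresponds to the last triple $d\!:\!\mu_d\!:\!\lambda_d$. The map $\pi$ is $\pi(e\!:\!\nu\!:\!\gamma)=e\!:\!\nu$.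 Let $\mathfrak{H}\subset\mathfrak{S}_s$ be the subgroup of permutations of the triples that leave unchanged the monomial $\prod_e\prod_\nu y_{k_{e:\nu:1},\dots,k_{e:\nu:\lambda_e}}$ (jet variables with symmetric lower indices) for indeterminate $k$'s when each $k_t$ is replaced by $k_{h(t)}$; equivalently, those $h$ which, for each $e$, permute the $\mu_e$ blocks $\{e\!:\!\nu\!:\!1,\dots,e\!:\!\nu\!:\!\lambda_e\}$ among themselves and permute arbitrarily inside blocks. Its cardinality is $\mu_1!(\lambda_1!)^{\mu_1}\cdots\mu_d!(\lambda_d!)^{\mu_d}$. $\mathfrak{F}$ denotes a set of representatives in $\mathfrak{S}_s$ of the cosets $\mathfrak{H}\sigma=\{h\circ\sigma:\ h\in\mathfrak{H}\}$ (the total sum does not depend on the choice). For $0\leqslant q\leqslant\kappa$, $\mathfrak{S}_\kappa^q$ is the set of permutations $\tau$ of $\{1,\dots,\kappa\}$ with $\tau(1)<\cdots<\tau(q)$ and $\tau(q+1)<\cdots<\tau(\kappa)$ (only the identity if $q=0$ or $q=\kappa$); $\mathfrak{S}_\kappa^{\kappa+1}:=\emptyset$, i.e. the $\mathcal{Y}$-term is absent when $s=\kappa+1$. $\delta$ is the Kronecker symbol. *)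

theory Defs
  imports "HOL-Analysis.Analysis" "HOL-Library.Groups_Big_Fun"
    "HOL-Combinatorics.Permutations" "HOL-Library.Multiset"
begin

text \<open>
  The base space has independent variables \<open>x \<in> K\<^sup>n\<close> and dependent variables \<open>y \<in> K\<^sup>m\<close>,
  where \<open>n = CARD('n)\<close>, \<open>m = CARD('m)\<close>, and the scalar field \<open>'k\<close> is any \<open>real_normed_field\<close>;
  the types \<open>real\<close> and \<open>complex\<close> are instances. All derivatives are taken over \<open>'k\<close>, so
  for \<open>'k = complex\<close> they are complex derivatives.
\<close>

type_synonym ('k, 'n, 'm) base = "('k^'n) \<times> ('k^'m)"

text \<open>\<open>Inl i\<close> names the coordinate \<open>x\<^sup>i\<close> and \<open>Inr j\<close> the coordinate \<open>y\<^sup>j\<close>.\<close>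

fun shift :: "'n + 'm \<Rightarrow> 'k \<Rightarrow> ('k::real_normed_field, 'n::finite, 'm::finite) base
    \<Rightarrow> ('k, 'n, 'm) base" where
  "shift (Inl i) t (x, y) = (x + axis i t, y)"
| "shift (Inr j) t (x, y) = (x, y + axis j t)"

definition partial :: "'n + 'm \<Rightarrow> (('k::real_normed_field, 'n::finite, 'm::finite) base \<Rightarrow> 'k)
    \<Rightarrow> ('k, 'n, 'm) base \<Rightarrow> 'k" where
  "partial c f p = deriv (\<lambda>t. f (shift c t p)) 0"

definition partials :: "('n + 'm) list \<Rightarrow> (('k::real_normed_field, 'n::finite, 'm::finite) base \<Rightarrow> 'k)
    \<Rightarrow> ('k, 'n, 'm) base \<Rightarrow> 'k" where
  "partials cs f = foldr partial cs f"

definition smooth_on :: "('k::real_normed_field, 'n::finite, 'm::finite) base set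
    \<Rightarrow> (('k, 'n, 'm) base \<Rightarrow> 'k) \<Rightarrow> bool" where
  "smooth_on U f \<longleftrightarrow>
     (\<forall>cs. continuous_on U (partials cs f) \<and>
       (\<forall>c. \<forall>p\<in>U. (\<lambda>t. partials cs f (shift c t p)) field_differentiable at 0))"

text \<open>
  A point \<open>(x, u)\<close> of the infinite jet space: \<open>u (j, J)\<close> is the value of the jet variable
  \<open>y\<^sup>j\<close> with lower indices \<open>J\<close>. Symmetry in the lower indices is built in by taking \<open>J\<close> to be
  a multiset; \<open>u (j, {#})\<close> is \<open>y\<^sup>j\<close> itself.
\<close>

type_synonym ('k, 'n, 'm) jet = "('k^'n) \<times> ('m \<times> 'n multiset \<Rightarrow> 'k)"

definition jet_base :: "('k, 'n, 'm::finite) jet \<Rightarrow> ('k, 'n, 'm) base" where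
  "jet_base p = (fst p, \<chi> j. snd p (j, {#}))"

definition jet_dx :: "'n \<Rightarrow> (('k::real_normed_field, 'n::finite, 'm) jet \<Rightarrow> 'k)
    \<Rightarrow> ('k, 'n, 'm) jet \<Rightarrow> 'k" where
  "jet_dx i F p = deriv (\<lambda>t. F (fst p + axis i t, snd p)) 0"

definition jet_dy :: "'m \<times> 'n multiset \<Rightarrow> (('k::real_normed_field, 'n::finite, 'm) jet \<Rightarrow> 'k)
    \<Rightarrow> ('k, 'n, 'm) jet \<Rightarrow> 'k" where
  "jet_dy v F p = deriv (\<lambda>t. F (fst p, (snd p)(v := t))) (snd p v)"

text \<open>
  The total derivative in coordinates. \<open>Sum_any\<close> sums over all jet variables (including the
  \<open>y\<^sup>j\<close> themselves); only finitely many summands are nonzero for functions of finitely many jet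
  variables. The lemmas below show that \<open>total_deriv i\<close> is the derivation with the prescribed
  values on functions of \<open>(x, y)\<close> and on jet variables.
\<close>

definition total_deriv :: "'n \<Rightarrow> (('k::real_normed_field, 'n::finite, 'm) jet \<Rightarrow> 'k)
    \<Rightarrow> ('k, 'n, 'm) jet \<Rightarrow> 'k" where
  "total_deriv i F p =
     jet_dx i F p + Sum_any (\<lambda>(j, J). snd p (j, add_mset i J) * jet_dy (j, J) F p)"

lemma Sum_any_superset:
  assumes "finite A" "\<And>a. a \<notin> A \<Longrightarrow> g a = 0"
  shows "Sum_any g = sum g A"
  using assms by (intro Sum_any.expand_superset) auto

lemma total_deriv_base:
  fixes f :: "('k::real_normed_field, 'n::finite, 'm::finite) base \<Rightarrow> 'k"
  shows "total_deriv i (\<lambda>q. f (jet_base q)) p =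
    partial (Inl i) f (jet_base p) +
    (\<Sum>j\<in>UNIV. snd p (j, {#i#}) * partial (Inr j) f (jet_base p))"
proof -
  have dx: "jet_dx i (\<lambda>q. f (jet_base q)) p = partial (Inl i) f (jet_base p)"
    by (simp add: jet_dx_def partial_def jet_base_def)
  have dy0: "jet_dy (j, {#}) (\<lambda>q. f (jet_base q)) p = partial (Inr j) f (jet_base p)" for j
  proof -
    have "jet_base (fst p, (snd p)((j, {#}) := snd p (j, {#}) + t)) =
        shift (Inr j) t (jet_base p)" for t
      by (auto simp: jet_base_def vec_eq_iff axis_def)
    then show ?thesis
      by (simp add: jet_dy_def partial_def deriv_shift_0 [of _ "snd p (j, {#})"] o_def)
  qed
  have dy1: "jet_dy (j, J) (\<lambda>q. f (jet_base q)) p = 0" if "J \<noteq> {#}" for j J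
  proof -
    have "jet_base (fst p, (snd p)((j, J) := t)) = jet_base p" for t
      using that by (auto simp: jet_base_def vec_eq_iff)
    then show ?thesis
      by (simp add: jet_dy_def)
  qed
  have "Sum_any (\<lambda>(j, J). snd p (j, add_mset i J) * jet_dy (j, J) (\<lambda>q. f (jet_base q)) p) =
      (\<Sum>(j, J)\<in>(\<lambda>j. (j, {#})) ` UNIV.
         snd p (j, add_mset i J) * jet_dy (j, J) (\<lambda>q. f (jet_base q)) p)"
    by (rule Sum_any_superset) (auto intro!: dy1)
  also have "\<dots> = (\<Sum>j\<in>UNIV. snd p (j, {#i#}) * partial (Inr j) f (jet_base p))"
    by (subst sum.reindex) (auto simp: inj_on_def dy0)
  finally show ?thesis
    by (simp add: total_deriv_def dx)
qed

lemma total_deriv_jet_variable: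
  fixes p :: "('k::real_normed_field, 'n::finite, 'm) jet"
  shows "total_deriv i (\<lambda>q. snd q (j, J)) p = snd p (j, add_mset i J)"
proof -
  have dy: "jet_dy v (\<lambda>q. snd q (j, J)) p = of_bool (v = (j, J))" for v
    by (cases "v = (j, J)") (auto simp: jet_dy_def)
  have "Sum_any (\<lambda>(j', J'). snd p (j', add_mset i J') * jet_dy (j', J') (\<lambda>q. snd q (j, J)) p) =
      (\<Sum>(j', J')\<in>{(j, J)}.
         snd p (j', add_mset i J') * jet_dy (j', J') (\<lambda>q. snd q (j, J)) p)"
    by (rule Sum_any_superset) (auto simp: dy)
  then show ?thesis
    by (simp add: total_deriv_def jet_dx_def dy)
qed

definition jet_differentiable_at ::
    "(('k::real_normed_field, 'n::finite, 'm) jet \<Rightarrow> 'k) \<Rightarrow> ('k, 'n, 'm) jet \<Rightarrow> bool" where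
  "jet_differentiable_at F p \<longleftrightarrow>
     (\<forall>i. (\<lambda>t. F (fst p + axis i t, snd p)) field_differentiable at 0) \<and>
     (\<forall>v. (\<lambda>t. F (fst p, (snd p)(v := t))) field_differentiable at (snd p v)) \<and>
     finite {v. jet_dy v F p \<noteq> 0}"

lemma total_deriv_add:
  assumes "jet_differentiable_at F p" "jet_differentiable_at G p"
  shows "total_deriv i (\<lambda>q. F q + G q) p = total_deriv i F p + total_deriv i G p"
proof -
  let ?A = "{v. jet_dy v F p \<noteq> 0} \<union> {v. jet_dy v G p \<noteq> 0}"
  have dx: "jet_dx i (\<lambda>q. F q + G q) p = jet_dx i F p + jet_dx i G p"
    using assms by (simp add: jet_dx_def jet_differentiable_at_def)
  have dy: "jet_dy v (\<lambda>q. F q + G q) p = jet_dy v F p + jet_dy v G p" for v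
    using assms by (cases v) (simp add: jet_dy_def jet_differentiable_at_def)
  have fin: "finite ?A"
    using assms by (simp add: jet_differentiable_at_def)
  have eq: "total_deriv i H p =
      jet_dx i H p + (\<Sum>v\<in>?A. snd p (fst v, add_mset i (snd v)) * jet_dy v H p)"
    if "\<And>v. v \<notin> ?A \<Longrightarrow> jet_dy v H p = 0" for H
    unfolding total_deriv_def case_prod_unfold prod.collapse
    using that by (subst Sum_any_superset [OF fin]) auto
  have "total_deriv i (\<lambda>q. F q + G q) p =
      jet_dx i (\<lambda>q. F q + G q) p +
      (\<Sum>v\<in>?A. snd p (fst v, add_mset i (snd v)) * jet_dy v (\<lambda>q. F q + G q) p)"
    by (rule eq) (simp add: dy)
  moreover have "total_deriv i F p =
      jet_dx i F p + (\<Sum>v\<in>?A. snd p (fst v, add_mset i (snd v)) * jet_dy v F p)"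
    by (rule eq) simp
  moreover have "total_deriv i G p =
      jet_dx i G p + (\<Sum>v\<in>?A. snd p (fst v, add_mset i (snd v)) * jet_dy v G p)"
    by (rule eq) simp
  ultimately show ?thesis
    by (simp add: dx dy algebra_simps sum.distrib)
qed

lemma total_deriv_mult:
  assumes "jet_differentiable_at F p" "jet_differentiable_at G p"
  shows "total_deriv i (\<lambda>q. F q * G q) p = total_deriv i F p * G p + F p * total_deriv i G p"
proof -
  let ?A = "{v. jet_dy v F p \<noteq> 0} \<union> {v. jet_dy v G p \<noteq> 0}"
  have dx: "jet_dx i (\<lambda>q. F q * G q) p = jet_dx i F p * G p + F p * jet_dx i G p"
    using assms by (simp add: jet_dx_def jet_differentiable_at_def axis_eq_0_iff [THEN iffD2])
  have dy: "jet_dy v (\<lambda>q. F q * G q) p = jet_dy v F p * G p + F p * jet_dy v G p" for v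
    using assms by (cases v) (simp add: jet_dy_def jet_differentiable_at_def)
  have fin: "finite ?A"
    using assms by (simp add: jet_differentiable_at_def)
  have eq: "total_deriv i H p =
      jet_dx i H p + (\<Sum>v\<in>?A. snd p (fst v, add_mset i (snd v)) * jet_dy v H p)"
    if "\<And>v. v \<notin> ?A \<Longrightarrow> jet_dy v H p = 0" for H
    unfolding total_deriv_def case_prod_unfold prod.collapse
    using that by (subst Sum_any_superset [OF fin]) auto
  have "total_deriv i (\<lambda>q. F q * G q) p =
      jet_dx i (\<lambda>q. F q * G q) p +
      (\<Sum>v\<in>?A. snd p (fst v, add_mset i (snd v)) * jet_dy v (\<lambda>q. F q * G q) p)"
    by (rule eq) (simp add: dy)
  moreover have "total_deriv i F p =
      jet_dx i F p + (\<Sum>v\<in>?A. snd p (fst v, add_mset i (snd v)) * jet_dy v F p)"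
    by (rule eq) simp
  moreover have "total_deriv i G p =
      jet_dx i G p + (\<Sum>v\<in>?A. snd p (fst v, add_mset i (snd v)) * jet_dy v G p)"
    by (rule eq) simp
  ultimately show ?thesis
    by (simp add: dx dy algebra_simps sum.distrib sum_distrib_left)
qed

text \<open>
  \<open>prolong_coeff X Y j i \<kappa>\<close> is the coefficient \<open>\<^bold>Y\<^sup>j\<close> with lower indices \<open>i 1, \<dots>, i \<kappa>\<close>.
  Starting the recursion at \<open>\<kappa> = 0\<close> with \<open>Y j\<close> makes the formula for \<open>\<kappa> = 1\<close> an
  instance of the general step.
\<close>

primrec prolong_coeff :: "('n \<Rightarrow> ('k::real_normed_field, 'n::finite, 'm::finite) base \<Rightarrow> 'k)
    \<Rightarrow> ('m \<Rightarrow> ('k, 'n, 'm) base \<Rightarrow> 'k) \<Rightarrow> 'm \<Rightarrow> (nat \<Rightarrow> 'n) \<Rightarrow> nat \<Rightarrow> ('k, 'n, 'm) jet \<Rightarrow> 'k" where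
  "prolong_coeff X Y j i 0 = (\<lambda>p. Y j (jet_base p))"
| "prolong_coeff X Y j i (Suc \<kappa>) = (\<lambda>p.
     total_deriv (i (Suc \<kappa>)) (prolong_coeff X Y j i \<kappa>) p -
     (\<Sum>k\<in>UNIV. total_deriv (i (Suc \<kappa>)) (\<lambda>q. X k (jet_base q)) p *
        snd p (j, add_mset k (image_mset i (mset_set {1..\<kappa>})))))"

text \<open>
  The tuples \<open>(\<lambda>\<^sub>1, \<dots>, \<lambda>\<^sub>d)\<close> and \<open>(\<mu>\<^sub>1, \<dots>, \<mu>\<^sub>d)\<close> are functions on \<open>{1..d}\<close>, extended by
  \<open>undefined\<close> so that each tuple is represented exactly once.
\<close>

definition weight :: "nat \<Rightarrow> (nat \<Rightarrow> nat) \<Rightarrow> (nat \<Rightarrow> nat) \<Rightarrow> nat" where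
  "weight d lam mu = (\<Sum>e=1..d. mu e * lam e)"

definition lam_tuples :: "nat \<Rightarrow> nat \<Rightarrow> (nat \<Rightarrow> nat) set" where
  "lam_tuples \<kappa> d = {lam \<in> {1..d} \<rightarrow>\<^sub>E {1..\<kappa>}. strict_mono_on {1..d} lam}"

definition mu_tuples :: "nat \<Rightarrow> nat \<Rightarrow> (nat \<Rightarrow> nat) \<Rightarrow> (nat \<Rightarrow> nat) set" where
  "mu_tuples \<kappa> d lam = {mu \<in> {1..d} \<rightarrow>\<^sub>E {1..}. weight d lam mu \<le> \<kappa> + 1}"

lemma finite_lam_tuples: "finite (lam_tuples \<kappa> d)"
  unfolding lam_tuples_def
  by (rule finite_subset [of _ "{1..d} \<rightarrow>\<^sub>E {1..\<kappa>}"]) (auto intro: finite_PiE)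

lemma finite_mu_tuples:
  assumes "lam \<in> lam_tuples \<kappa> d"
  shows "finite (mu_tuples \<kappa> d lam)"
proof (rule finite_subset)
  show "mu_tuples \<kappa> d lam \<subseteq> {1..d} \<rightarrow>\<^sub>E {1..\<kappa> + 1}"
  proof
    fix mu assume mu: "mu \<in> mu_tuples \<kappa> d lam"
    have "mu e \<le> \<kappa> + 1" if e: "e \<in> {1..d}" for e
    proof -
      have "lam e \<ge> 1"
        using assms e by (auto simp: lam_tuples_def PiE_iff)
      then have "mu e \<le> mu e * lam e"
        by simp
      also have "\<dots> \<le> weight d lam mu"
        unfolding weight_def using e by (intro member_le_sum) auto
      finally show ?thesis
        using mu by (simp add: mu_tuples_def)
    qed
    then show "mu \<in> {1..d} \<rightarrow>\<^sub>E {1..\<kappa> + 1}"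
      using mu by (auto simp: mu_tuples_def PiE_iff)
  qed
qed (auto intro: finite_PiE)

text \<open>The pairs \<open>e:\<nu>\<close> and the triples \<open>e:\<nu>:\<gamma>\<close>, in lexicographic order.\<close>

definition blocks :: "nat \<Rightarrow> (nat \<Rightarrow> nat) \<Rightarrow> (nat \<times> nat) list" where
  "blocks d mu = [(e, \<nu>). e \<leftarrow> [1..<d + 1], \<nu> \<leftarrow> [1..<mu e + 1]]"

definition triples :: "nat \<Rightarrow> (nat \<Rightarrow> nat) \<Rightarrow> (nat \<Rightarrow> nat) \<Rightarrow> (nat \<times> nat \<times> nat) list" where
  "triples d lam mu =
     [(e, \<nu>, \<gamma>). e \<leftarrow> [1..<d + 1], \<nu> \<leftarrow> [1..<mu e + 1], \<gamma> \<leftarrow> [1..<lam e + 1]]"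

text \<open>The lexicographic identification of \<open>{1..s}\<close> with the triples.\<close>

definition triple :: "nat \<Rightarrow> (nat \<Rightarrow> nat) \<Rightarrow> (nat \<Rightarrow> nat) \<Rightarrow> nat \<Rightarrow> nat \<times> nat \<times> nat" where
  "triple d lam mu t = triples d lam mu ! (t - 1)"

definition block_of :: "nat \<times> nat \<times> nat \<Rightarrow> nat \<times> nat" where
  "block_of = (\<lambda>(e, \<nu>, \<gamma>). (e, \<nu>))"

text \<open>
  The monomial \<open>\<Prod>\<^sub>e \<Prod>\<^sub>\<nu> y\<close> with lower indices \<open>k\<^sub>e\<^sub>:\<^sub>\<nu>\<^sub>:\<^sub>1, \<dots>\<close>, for \<open>k\<close> indexed by \<open>{1..s}\<close>, is the
  multiset of its factors, and a factor is the multiset of its lower indices. Taking the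
  indeterminate \<open>k\<^sub>t\<close> to be \<open>t\<close> itself, replacing \<open>k\<^sub>t\<close> by \<open>k\<^sub>h\<^sub>(\<^sub>t\<^sub>)\<close> turns \<open>jet_monomial d lam mu id\<close>
  into \<open>jet_monomial d lam mu h\<close>.
\<close>

definition jet_monomial :: "nat \<Rightarrow> (nat \<Rightarrow> nat) \<Rightarrow> (nat \<Rightarrow> nat) \<Rightarrow> (nat \<Rightarrow> 'a) \<Rightarrow> 'a multiset multiset" where
  "jet_monomial d lam mu k =
     image_mset (\<lambda>b. image_mset k
         (mset_set {t \<in> {1..weight d lam mu}. block_of (triple d lam mu t) = b}))
       (mset (blocks d mu))"

definition monomial_stabilizer :: "nat \<Rightarrow> (nat \<Rightarrow> nat) \<Rightarrow> (nat \<Rightarrow> nat) \<Rightarrow> (nat \<Rightarrow> nat) set" where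
  "monomial_stabilizer d lam mu =
     {h. h permutes {1..weight d lam mu} \<and> jet_monomial d lam mu h = jet_monomial d lam mu id}"

definition coset_representatives ::
    "nat \<Rightarrow> (nat \<Rightarrow> nat) \<Rightarrow> (nat \<Rightarrow> nat) \<Rightarrow> (nat \<Rightarrow> nat) set \<Rightarrow> bool" where
  "coset_representatives d lam mu F \<longleftrightarrow>
     F \<subseteq> {\<sigma>. \<sigma> permutes {1..weight d lam mu}} \<and>
     (\<forall>\<sigma>. \<sigma> permutes {1..weight d lam mu} \<longrightarrow>
        (\<exists>!f. f \<in> F \<and> f \<in> (\<lambda>h. h \<circ> \<sigma>) ` monomial_stabilizer d lam mu))"

definition shuffles_at :: "nat \<Rightarrow> nat \<Rightarrow> (nat \<Rightarrow> nat) set" where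
  "shuffles_at \<kappa> q = (if q \<le> \<kappa>
     then {\<tau>. \<tau> permutes {1..\<kappa>} \<and> strict_mono_on {1..q} \<tau> \<and> strict_mono_on {q + 1..\<kappa>} \<tau>}
     else {})"

end

theory Submission
  imports Defs
begin

text \<open>
  Positions \<open>1, \<dots>, \<kappa>\<close> carry the indices \<open>i 1, \<dots>, i \<kappa>\<close>. The formula is the multivariate Faa di
  Bruno formula, written as a sum over set partitions of positions, followed by a count of these set
  partitions with the help of permutations.

  Analysis. Let \<open>D\<^sub>A\<close> be the iterated total derivative along the indices at the positions in \<open>A\<close>.
  Since partial derivatives commute, the product and chain rules give, for \<open>f = f(x, y)\<close>,
  \<open>D\<^sub>A f = \<Sum>\<^sub>S \<partial>\<^sub>S f \<cdot> \<Prod> y\<close>, where \<open>S\<close> runs over the families of disjoint nonempty blocks contained in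
  \<open>A\<close>, each block \<open>b\<close> carrying a label \<open>l\<close>. A block contributes one derivative in \<open>y\<^sup>l\<close> and the
  factor \<open>y\<^sup>l\<close> with lower indices read off from \<open>b\<close>; a position in no block contributes a derivative
  in \<open>x\<close>. Indeed, applying \<open>D\<close> for one more position \<open>a\<close> to such a term differentiates \<open>f\<close> in \<open>x\<close> (\<open>a\<close> stays
  outside all blocks), differentiates \<open>f\<close> in some \<open>y\<^sup>l\<close> (\<open>a\<close> forms a new block), or raises one of the
  jet variables (\<open>a\<close> joins its block): every family on \<open>A \<union> {a}\<close> arises exactly once. This is
  \<open>total_deriv_faa_di_bruno\<close>. The recursion for the prolongation then unwinds to
  \<open>\<^bold>Y\<^sup>j = D Y\<^sup>j - \<Sum>\<^sub>k \<Sum>\<^sub>A D\<^sub>A X\<^sup>k \<cdot> y\<^sup>j\<close>, where \<open>D\<close> uses all positions, \<open>A\<close> runs over the nonempty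
  sets of positions and the last factor has as lower indices \<open>k\<close> and those at the positions outside
  \<open>A\<close> (\<open>prolong_coeff_eq_faa_di_bruno\<close>).

  Combinatorics. In an \<open>X\<close>-term, adjoin the position \<open>\<kappa> + 1\<close> with index \<open>k\<close>. The last factor becomes
  the factor of one more block, which contains \<open>\<kappa> + 1\<close>, has label \<open>j\<close> and is not everything because
  \<open>A\<close> is nonempty; its derivative in \<open>y\<^sup>j\<close> is the one that the formula omits. So both parts of
  the formula are sums over labelled families of blocks, and it remains to parametrise these.

  The sizes of the blocks form a multiset, which is the same as \<open>d\<close>, \<open>\<lambda>\<^sub>1 < \<dots> < \<lambda>\<^sub>d\<close> and the
  multiplicities \<open>\<mu>\<^sub>1, \<dots>, \<mu>\<^sub>d\<close> (\<open>type_sizes_bij\<close>). The union of the blocks is a set of \<open>s\<close> positions, which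
  is the same as a shuffle \<open>\<tau>\<close> (\<open>shuffles_at_bij_subsets\<close>); in an \<open>X\<close>-term the union contains
  \<open>\<kappa> + 1\<close>, so that only \<open>s - 1\<close> positions are free. Finally, \<open>\<sigma>\<close> distributes \<open>\<tau> 1, \<dots>, \<tau> s\<close> over the standard
  blocks \<open>e:\<nu>\<close>, and two permutations give the same set of blocks exactly when they differ by
  an element of the stabilizer on the left; hence representatives \<open>\<sigma>\<close> together with labels \<open>l\<close> correspond
  bijectively to labelled families of the given type (\<open>place_bij\<close>). The Kronecker symbols leave
  exactly one choice of the \<open>k\<close>'s (\<open>sum_lower_indices\<close>), the one for which the monomial of the formula is the
  product of the factors of the blocks.
\<close>

section \<open>Symmetry of iterated partial derivatives\<close>

text \<open>The mean value inequality for \<open>\<phi> x - x c\<close>, which works for values in any normed space.\<close>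

lemma norm_increment_le:
  fixes \<phi> :: "real \<Rightarrow> 'a::real_normed_vector"
  assumes h: "0 \<le> h"
    and d: "\<And>x. x \<in> {0..h} \<Longrightarrow> (\<phi> has_vector_derivative \<phi>' x) (at x)"
    and B: "\<And>x. x \<in> {0..h} \<Longrightarrow> norm (\<phi>' x - c) \<le> B"
  shows "norm (\<phi> h - \<phi> 0 - h *\<^sub>R c) \<le> B * h"
proof -
  let ?g = "\<lambda>x. \<phi> x - x *\<^sub>R c"
  have "norm (?g h - ?g 0) \<le> B * norm (h - 0)"
  proof (rule differentiable_bound [of "{0..h}"])
    fix x assume x: "x \<in> {0..h}"
    show "(?g has_derivative (\<lambda>t. t *\<^sub>R (\<phi>' x - c))) (at x within {0..h})"
    proof (rule has_derivative_at_withinI)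
      have "(\<phi> has_derivative (\<lambda>t. t *\<^sub>R \<phi>' x)) (at x)"
        using d [OF x] by (simp add: has_vector_derivative_def)
      then show "(?g has_derivative (\<lambda>t. t *\<^sub>R (\<phi>' x - c))) (at x)"
        by (auto intro!: derivative_eq_intros simp: scaleR_diff_right)
    qed
    show "onorm (\<lambda>t. t *\<^sub>R (\<phi>' x - c)) \<le> B"
      using B [OF x] by (intro onorm_le) (metis mult.commute mult_right_mono norm_ge_zero norm_scaleR real_norm_def)
  qed (use h in auto)
  then show ?thesis
    using h by (simp add: algebra_simps)
qed

text \<open>
  Two applications of the mean value inequality, to \<open>a \<mapsto> G a h - G a 0\<close> and then to \<open>b \<mapsto> Ga a b\<close>,
  compare the second difference of \<open>G\<close> with \<open>h\<^sup>2\<close> times the mixed derivative. The second difference is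
  symmetric in the two variables, which is what makes the two mixed derivatives agree.
\<close>

lemma mixed_difference_estimate:
  fixes G :: "real \<Rightarrow> real \<Rightarrow> 'a::real_normed_vector"
  assumes Ga: "\<And>a b. \<bar>a\<bar> < r \<Longrightarrow> \<bar>b\<bar> < r \<Longrightarrow> ((\<lambda>a. G a b) has_vector_derivative Ga a b) (at a)"
    and Gab: "\<And>a b. \<bar>a\<bar> < r \<Longrightarrow> \<bar>b\<bar> < r \<Longrightarrow> ((\<lambda>b. Ga a b) has_vector_derivative Gab a b) (at b)"
    and bound: "\<And>a b. \<bar>a\<bar> < r \<Longrightarrow> \<bar>b\<bar> < r \<Longrightarrow> norm (Gab a b - L) \<le> e"
    and h: "0 < h" "h < r"
  shows "norm (G h h - G h 0 - G 0 h + G 0 0 - (h * h) *\<^sub>R L) \<le> e * h * h"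
proof -
  have "norm ((\<lambda>a. G a h - G a 0) h - (\<lambda>a. G a h - G a 0) 0 - h *\<^sub>R (h *\<^sub>R L)) \<le> (e * h) * h"
  proof (rule norm_increment_le)
    fix a assume a: "a \<in> {0..h}"
    show "((\<lambda>a. G a h - G a 0) has_vector_derivative (Ga a h - Ga a 0)) (at a)"
      using a h by (intro has_vector_derivative_diff Ga) auto
    show "norm (Ga a h - Ga a 0 - h *\<^sub>R L) \<le> e * h"
      using a h by (intro norm_increment_le [where \<phi> = "Ga a" and \<phi>' = "Gab a"] Gab bound) auto
  qed (use h in auto)
  then show ?thesis
    by (simp add: algebra_simps)
qed

lemma mixed_derivatives_eq:
  fixes G :: "real \<Rightarrow> real \<Rightarrow> 'a::real_normed_vector"
  assumes r: "0 < r"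
    and Ga: "\<And>a b. \<bar>a\<bar> < r \<Longrightarrow> \<bar>b\<bar> < r \<Longrightarrow> ((\<lambda>a. G a b) has_vector_derivative Ga a b) (at a)"
    and Gab: "\<And>a b. \<bar>a\<bar> < r \<Longrightarrow> \<bar>b\<bar> < r \<Longrightarrow> ((\<lambda>b. Ga a b) has_vector_derivative Gab a b) (at b)"
    and Gb: "\<And>a b. \<bar>a\<bar> < r \<Longrightarrow> \<bar>b\<bar> < r \<Longrightarrow> ((\<lambda>b. G a b) has_vector_derivative Gb a b) (at b)"
    and Gba: "\<And>a b. \<bar>a\<bar> < r \<Longrightarrow> \<bar>b\<bar> < r \<Longrightarrow> ((\<lambda>a. Gb a b) has_vector_derivative Gba a b) (at a)"
    and lim: "((\<lambda>(a, b). Gab a b) \<longlongrightarrow> Gab 0 0) (nhds (0, 0))"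
             "((\<lambda>(a, b). Gba a b) \<longlongrightarrow> Gba 0 0) (nhds (0, 0))"
  shows "Gab 0 0 = Gba 0 0"
proof (rule ccontr)
  assume ne: "Gab 0 0 \<noteq> Gba 0 0"
  \<comment> \<open>Both mixed derivatives are within \<open>e\<close> of \<open>D / h\<^sup>2\<close>, hence within \<open>2 e\<close> of each other.\<close>
  define e where "e = norm (Gab 0 0 - Gba 0 0) / 3"
  have e: "e > 0" using ne by (simp add: e_def)
  have "\<forall>\<^sub>F p in nhds (0, 0). dist (case p of (a, b) \<Rightarrow> Gab a b) (Gab 0 0) < e
      \<and> dist (case p of (a, b) \<Rightarrow> Gba a b) (Gba 0 0) < e"
    using lim e by (intro eventually_conj) (auto dest!: tendstoD)
  then obtain S where S01: "open S" "(0, 0) \<in> S" and S2: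
    "\<forall>p\<in>S. dist (case p of (a, b) \<Rightarrow> Gab a b) (Gab 0 0) < e
      \<and> dist (case p of (a, b) \<Rightarrow> Gba a b) (Gba 0 0) < e"
    unfolding eventually_nhds by blast
  have S: "open S" "(0, 0) \<in> S"
    "\<And>a b. (a, b) \<in> S \<Longrightarrow> norm (Gab a b - Gab 0 0) < e \<and> norm (Gba a b - Gba 0 0) < e"
    using S01 S2 by (fastforce simp: dist_norm)+
  obtain A B where AB: "open A" "open B" "(0, 0) \<in> A \<times> B" "A \<times> B \<subseteq> S"
    using open_prod_elim [OF S(1,2)] by metis
  obtain r1 where r1: "r1 > 0" "\<And>a. dist a 0 < r1 \<Longrightarrow> a \<in> A"
    using AB unfolding open_dist by auto
  obtain r2 where r2: "r2 > 0" "\<And>a. dist a 0 < r2 \<Longrightarrow> a \<in> B"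
    using AB unfolding open_dist by auto
  define r' where "r' = min r (min r1 r2)"
  have r': "r' > 0" "r' \<le> r" using r r1 r2 by (auto simp: r'_def)
  have bd: "norm (Gab a b - Gab 0 0) \<le> e" "norm (Gba a b - Gba 0 0) \<le> e"
    if "\<bar>a\<bar> < r'" "\<bar>b\<bar> < r'" for a b
  proof -
    have "(a, b) \<in> S"
      using that AB(4) r1(2)[of a] r2(2)[of b] by (auto simp: r'_def)
    then show "norm (Gab a b - Gab 0 0) \<le> e" "norm (Gba a b - Gba 0 0) \<le> e"
      using S(3) by (auto simp: less_imp_le)
  qed
  define h where "h = r' / 2"
  have h: "0 < h" "h < r'" using r' by (auto simp: h_def)
  define D where "D = G h h - G h 0 - G 0 h + G 0 0"
  have 1: "norm (D - (h * h) *\<^sub>R Gab 0 0) \<le> e * h * h"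
    unfolding D_def using r' h bd
    by (intro mixed_difference_estimate [where r = r' and Ga = Ga and Gab = Gab] Ga Gab) auto
  have "norm (G h h - G 0 h - G h 0 + G 0 0 - (h * h) *\<^sub>R Gba 0 0) \<le> e * h * h"
    using r' h bd
    by (intro mixed_difference_estimate [where r = r' and G = "\<lambda>b a. G a b" and Ga = "\<lambda>b a. Gb a b"
          and Gab = "\<lambda>b a. Gba a b"] Gb Gba) auto
  then have 2: "norm (D - (h * h) *\<^sub>R Gba 0 0) \<le> e * h * h"
    by (simp add: D_def algebra_simps)
  have "(h * h) * norm (Gab 0 0 - Gba 0 0) = norm ((h * h) *\<^sub>R (Gab 0 0 - Gba 0 0))"
    using h by simp
  also have "\<dots> = norm ((D - (h * h) *\<^sub>R Gba 0 0) - (D - (h * h) *\<^sub>R Gab 0 0))"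
    by (simp add: algebra_simps)
  also have "\<dots> \<le> e * h * h + e * h * h"
    by (rule order_trans [OF norm_triangle_ineq4 add_mono [OF 2 1]])
  finally have "(h * h) * (3 * e) \<le> (h * h) * (2 * e)"
    by (simp add: e_def algebra_simps)
  moreover have "0 < h * h"
    using h by simp
  ultimately have "3 * e \<le> 2 * e"
    by (rule mult_left_le_imp_le)
  then show False
    using e by simp
qed

lemma axis_0: "axis i 0 = (0 :: 'k::real_normed_field^'n)"
  by (simp add: vec_eq_iff axis_def)

lemma shift_0 [simp]: "shift c 0 p = p"
  by (cases c; cases p) (simp_all add: axis_0)

lemma axis_add: "axis i (s + t) = axis i s + (axis i t :: 'k::real_normed_field^'n)"
  by (auto simp: vec_eq_iff axis_def)

lemma shift_shift: "shift c s (shift c t p) = shift c (s + t) p"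
  by (cases c; cases p) (auto simp: axis_add add_ac)

lemma shift_commute: "shift c s (shift d t p) = shift d t (shift c s p)"
  by (cases c; cases d; cases p) (auto simp: add_ac)

lemma continuous_on_axis [continuous_intros]:
  "continuous_on S f \<Longrightarrow> continuous_on S (\<lambda>z. axis i (f z) :: 'k::real_normed_field^'n)"
  unfolding axis_def
proof (rule continuous_on_vec_lambda)
  show "continuous_on S (\<lambda>z. if l = i then f z else 0)" if "continuous_on S f" for l
    using that by (cases "l = i") auto
qed

lemma continuous_on_shift [continuous_intros]:
  assumes "continuous_on S f" "continuous_on S g"
  shows "continuous_on S (\<lambda>z. shift c (f z) (g z))"
proof -
  have "shift c t q = (case c of Inl i \<Rightarrow> (fst q + axis i t, snd q) | Inr j \<Rightarrow> (fst q, snd q + axis j t))"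
    for t :: 'b and q :: "('b, 'c, 'd) base"
    by (cases c; cases q) auto
  then show ?thesis
    using assms by (cases c) (auto intro!: continuous_intros)
qed

lemma partials_Nil [simp]: "partials [] f = f"
  by (simp add: partials_def)

lemma partials_Cons [simp]: "partials (c # cs) f = partial c (partials cs f)"
  by (simp add: partials_def)

lemma partials_append: "partials (cs @ ds) f = partials cs (partials ds f)"
  by (simp add: partials_def)

lemma smooth_on_partials: "smooth_on U f \<Longrightarrow> smooth_on U (partials cs f)"
  by (simp add: smooth_on_def flip: partials_append)

lemma smooth_on_partial: "smooth_on U f \<Longrightarrow> smooth_on U (partial c f)"
  using smooth_on_partials [of U f "[c]"] by simp

lemma smooth_on_continuous: "smooth_on U f \<Longrightarrow> continuous_on U f"
  unfolding smooth_on_def by (metis partials_Nil)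

lemma smooth_on_differentiable:
  "smooth_on U f \<Longrightarrow> p \<in> U \<Longrightarrow> (\<lambda>t. f (shift c t p)) field_differentiable at 0"
  unfolding smooth_on_def by (metis partials_Nil)

lemma eventually_shift_in:
  assumes "open U" "p \<in> U"
  shows "\<forall>\<^sub>F t in nhds 0. shift c t p \<in> U"
proof -
  have "open ((\<lambda>t. shift c t p) -` U)"
    using assms by (intro open_vimage continuous_intros)
  then show ?thesis
    using assms by (auto simp: eventually_nhds)
qed

lemma partial_cong:
  assumes "open U" "p \<in> U" "\<And>q. q \<in> U \<Longrightarrow> f q = g q"
  shows "partial c f p = partial c g p"
  unfolding partial_def
  by (rule deriv_cong_ev [OF eventually_mono [OF eventually_shift_in [OF assms(1,2), of c]]])
    (use assms in auto)

lemma smooth_on_has_derivative_shift: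
  assumes "smooth_on U f" "shift c t p \<in> U"
  shows "((\<lambda>t. f (shift c t p)) has_field_derivative partial c f (shift c t p)) (at t)"
proof -
  have "((\<lambda>s. f (shift c s (shift c t p))) has_field_derivative partial c f (shift c t p)) (at 0)"
    unfolding partial_def
    using smooth_on_differentiable [OF assms] by (simp add: DERIV_deriv_iff_field_differentiable)
  then have "((\<lambda>s. f (shift c (s + t) p)) has_field_derivative partial c f (shift c t p)) (at 0)"
    by (simp add: shift_shift)
  then show ?thesis
    by (simp add: DERIV_shift [of _ _ 0 t, simplified])
qed

text \<open>
  A derivative over \<open>'k\<close> along a coordinate is also the derivative along real multiples of that
  coordinate. So Schwarz's theorem on a real two-dimensional slice through \<open>p\<close> suffices, for real
  and complex scalars alike.
\<close>

lemma partial_commute: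
  fixes f :: "('k::real_normed_field, 'n::finite, 'm::finite) base \<Rightarrow> 'k"
  assumes U: "open U" and f: "smooth_on U f" and p: "p \<in> U"
  shows "partial c (partial d f) p = partial d (partial c f) p"
proof -
  define q :: "real \<times> real \<Rightarrow> ('k, 'n, 'm) base"
    where "q = (\<lambda>(a, b). shift c (of_real a) (shift d (of_real b) p))"
  have q': "q (a, b) = shift d (of_real b) (shift c (of_real a) p)" for a b
    by (simp add: q_def shift_commute)
  have q0: "q (0, 0) = p" by (simp add: q_def)
  have contq: "continuous_on UNIV q"
    unfolding q_def case_prod_unfold by (intro continuous_intros)
  have "open (q -` U)" "(0, 0) \<in> q -` U"
    using U contq p q0 by (auto intro: open_vimage)
  then obtain A B where AB: "open A" "open B" "(0, 0) \<in> A \<times> B" "A \<times> B \<subseteq> q -` U"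
    by (metis open_prod_elim)
  obtain r1 where r1: "r1 > 0" "\<And>a. dist a 0 < r1 \<Longrightarrow> a \<in> A"
    using AB unfolding open_dist by auto
  obtain r2 where r2: "r2 > 0" "\<And>a. dist a 0 < r2 \<Longrightarrow> a \<in> B"
    using AB unfolding open_dist by auto
  define r where "r = min r1 r2"
  have r: "r > 0" using r1 r2 by (simp add: r_def)
  have qU: "q (a, b) \<in> U" if "\<bar>a\<bar> < r" "\<bar>b\<bar> < r" for a b
    using that AB(4) r1(2)[of a] r2(2)[of b] by (auto simp: r_def)
  have dc: "((\<lambda>a. g (q (a, b))) has_vector_derivative partial c g (q (a, b))) (at a)"
    if "smooth_on U g" "\<bar>a\<bar> < r" "\<bar>b\<bar> < r" for g a b
    using smooth_on_has_derivative_shift [OF that(1), of c "of_real a" "shift d (of_real b) p"]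
      qU [OF that(2,3)]
    unfolding q_def by (auto intro: has_vector_derivative_real_field)
  have dd: "((\<lambda>b. g (q (a, b))) has_vector_derivative partial d g (q (a, b))) (at b)"
    if "smooth_on U g" "\<bar>a\<bar> < r" "\<bar>b\<bar> < r" for g a b
    using smooth_on_has_derivative_shift [OF that(1), of d "of_real b" "shift c (of_real a) p"]
      qU [OF that(2,3)]
    unfolding q' by (auto intro: has_vector_derivative_real_field)
  have lim: "((\<lambda>(a, b). g (q (a, b))) \<longlongrightarrow> g (q (0, 0))) (nhds (0, 0))" if "smooth_on U g" for g
  proof -
    have "continuous_on (q -` U) (\<lambda>z. g (q z))"
      by (rule continuous_on_compose2 [OF smooth_on_continuous [OF that]
            continuous_on_subset [OF contq]]) auto
    then have "isCont (\<lambda>z. g (q z)) (0, 0)"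
      using \<open>open (q -` U)\<close> \<open>(0, 0) \<in> q -` U\<close> continuous_on_eq_continuous_at by blast
    then show ?thesis
      using tendsto_at_iff_tendsto_nhds [of "\<lambda>z. g (q z)" "(0, 0)"]
      by (simp add: isCont_def case_prod_unfold)
  qed
  have "partial d (partial c f) (q (0, 0)) = partial c (partial d f) (q (0, 0))"
    by (rule mixed_derivatives_eq [where G = "\<lambda>a b. f (q (a, b))" and r = r
          and Ga = "\<lambda>a b. partial c f (q (a, b))" and Gb = "\<lambda>a b. partial d f (q (a, b))"])
      (use r f in \<open>auto intro!: dc dd lim smooth_on_partial\<close>)
  then show ?thesis
    by (simp add: q0)
qed

lemma partials_move_to_front:
  assumes "open U" "smooth_on U f" "p \<in> U"
  shows "partials (as @ c # bs) f p = partial c (partials (as @ bs) f) p"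
  using assms(3)
proof (induction as arbitrary: p)
  case (Cons a as)
  have "partials ((a # as) @ c # bs) f p = partial a (partial c (partials (as @ bs) f)) p"
    using partial_cong [OF assms(1) Cons.prems Cons.IH] by simp
  also have "\<dots> = partial c (partial a (partials (as @ bs) f)) p"
    using assms Cons.prems by (intro partial_commute smooth_on_partials)
  finally show ?case by simp
qed simp

lemma partials_cong_mset:
  assumes "open U" "smooth_on U f" "p \<in> U" "mset cs = mset cs'"
  shows "partials cs f p = partials cs' f p"
  using assms(3,4)
proof (induction cs arbitrary: cs' p)
  case (Cons c cs)
  then have "c \<in> set cs'" by (metis list.set_intros(1) mset_eq_setD)
  then obtain as bs where cs': "cs' = as @ c # bs" by (meson split_list)
  with Cons.prems have "mset cs = mset (as @ bs)" by simp
  then have "partials (c # cs) f p = partial c (partials (as @ bs) f) p"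
    using partial_cong [OF assms(1) Cons.prems(1) Cons.IH] by simp
  also have "\<dots> = partials cs' f p"
    unfolding cs' using assms Cons.prems by (intro partials_move_to_front [symmetric])
  finally show ?case .
qed simp

text \<open>
  Partial derivatives indexed by a multiset of coordinates. The order in which they are taken is an
  arbitrary choice, which is irrelevant for smooth functions on an open set.
\<close>

definition partials_mset :: "('n + 'm) multiset \<Rightarrow> (('k::real_normed_field, 'n::finite, 'm::finite) base \<Rightarrow> 'k)
    \<Rightarrow> ('k, 'n, 'm) base \<Rightarrow> 'k" where
  "partials_mset M = partials (SOME cs. mset cs = M)"

lemma mset_some: "mset (SOME cs. mset cs = M) = M"
  using ex_mset by (rule someI_ex)

lemma partials_mset:
  assumes "open U" "smooth_on U f" "p \<in> U" "mset cs = M"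
  shows "partials cs f p = partials_mset M f p"
  unfolding partials_mset_def
  by (intro partials_cong_mset [OF assms(1-3)]) (simp add: mset_some assms)

lemma partials_mset_add:
  assumes "open U" "smooth_on U f" "p \<in> U"
  shows "partial c (partials_mset M f) p = partials_mset (add_mset c M) f p"
proof -
  have "partial c (partials_mset M f) p = partials (c # (SOME cs. mset cs = M)) f p"
    by (simp add: partials_mset_def)
  also have "\<dots> = partials_mset (add_mset c M) f p"
    using assms by (intro partials_mset) (auto simp: mset_some)
  finally show ?thesis .
qed

lemma smooth_on_partials_mset: "smooth_on U f \<Longrightarrow> smooth_on U (partials_mset M f)"
  by (simp add: partials_mset_def smooth_on_partials)

section \<open>Calculus of the total derivative\<close>

lemma jet_base_x: "jet_base (fst p + axis i t, snd p) = shift (Inl i) t (jet_base p)"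
  by (simp add: jet_base_def)

lemma jet_base_y0:
  "jet_base (fst p, (snd p)((j, {#}) := t)) = shift (Inr j) (t - snd p (j, {#})) (jet_base p)"
  by (auto simp: jet_base_def vec_eq_iff axis_def)

lemma jet_base_y:
  "J \<noteq> {#} \<Longrightarrow> jet_base (fst p, (snd p)((j, J) := t)) = jet_base p"
  by (auto simp: jet_base_def vec_eq_iff)

text \<open>
  Formulas that hold over \<open>U\<close> only can still be differentiated, because moving one jet coordinate
  slightly keeps the base point in \<open>U\<close>.
\<close>

lemma total_deriv_cong:
  assumes U: "open U" "jet_base p \<in> U" and eq: "\<And>q. jet_base q \<in> U \<Longrightarrow> F q = G q"
  shows "total_deriv i F p = total_deriv i G p"
proof -
  have "jet_dx i F p = jet_dx i G p"
    unfolding jet_dx_def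
    by (rule deriv_cong_ev [OF eventually_mono [OF eventually_shift_in [OF U]]])
      (auto intro!: eq simp: jet_base_x)
  moreover have "jet_dy (j, J) F p = jet_dy (j, J) G p" for j J
  proof (cases "J = {#}")
    case True
    have ev: "\<forall>\<^sub>F t in nhds (snd p (j, {#})). shift (Inr j) (t - snd p (j, {#})) (jet_base p) \<in> U"
    proof -
      have "open ((\<lambda>t. shift (Inr j) (t - snd p (j, {#})) (jet_base p)) -` U)"
        using U by (intro open_vimage continuous_intros)
      then show ?thesis
        using U by (auto simp: eventually_nhds)
    qed
    show ?thesis
      unfolding jet_dy_def True
      by (rule deriv_cong_ev [OF eventually_mono [OF ev]]) (auto intro!: eq simp: jet_base_y0)
  next
    case False
    then show ?thesis
      using U eq by (simp add: jet_dy_def jet_base_y)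
  qed
  ultimately show ?thesis
    by (simp add: total_deriv_def)
qed

lemma jet_differentiable_at_base:
  assumes "smooth_on U g" "jet_base p \<in> U"
  shows "jet_differentiable_at (\<lambda>q. g (jet_base q)) p"
  unfolding jet_differentiable_at_def
proof (intro conjI allI)
  show "(\<lambda>t. g (jet_base (fst p + axis i t, snd p))) field_differentiable at 0" for i
    using smooth_on_differentiable [OF assms] by (simp add: jet_base_x)
  fix v :: "'c \<times> 'b multiset"
  obtain j J where v: "v = (j, J)" by fastforce
  show "(\<lambda>t. g (jet_base (fst p, (snd p)(v := t)))) field_differentiable at (snd p v)"
  proof (cases "J = {#}")
    case True
    have "(\<lambda>t. g (shift (Inr j) t (jet_base p))) field_differentiable at (snd p v - snd p v)"
      using smooth_on_differentiable [OF assms] by simp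
    then have "((\<lambda>t. g (shift (Inr j) t (jet_base p))) \<circ> (\<lambda>t. t - snd p v))
        field_differentiable at (snd p v)"
      by (intro field_differentiable_compose) (auto intro!: derivative_intros)
    then show ?thesis
      by (simp add: v True jet_base_y0 o_def)
  qed (simp add: v jet_base_y)
next
  have "jet_dy (j, J) (\<lambda>q. g (jet_base q)) p = 0" if "J \<noteq> {#}" for j J
    using that by (simp add: jet_dy_def jet_base_y)
  then have "{v. jet_dy v (\<lambda>q. g (jet_base q)) p \<noteq> 0} \<subseteq> range (\<lambda>j. (j, {#}))"
    by force
  then show "finite {v. jet_dy v (\<lambda>q. g (jet_base q)) p \<noteq> 0}"
    by (rule finite_subset) simp
qed

lemma jet_differentiable_at_var: "jet_differentiable_at (\<lambda>q. snd q v) p"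
proof -
  have "jet_dy w (\<lambda>q. snd q v) p = 0" if "w \<noteq> v" for w
    using that by (simp add: jet_dy_def)
  then have "{w. jet_dy w (\<lambda>q. snd q v) p \<noteq> 0} \<subseteq> {v}"
    by blast
  moreover have "(\<lambda>t. snd (fst p, (snd p)(w := t)) v) field_differentiable at (snd p w)" for w
    by (cases "w = v") auto
  ultimately show ?thesis
    by (auto simp: jet_differentiable_at_def dest: finite_subset)
qed

lemma jet_differentiable_at_const: "jet_differentiable_at (\<lambda>q. c) p"
  by (simp add: jet_differentiable_at_def jet_dy_def)

lemma jet_differentiable_at_add:
  assumes "jet_differentiable_at F p" "jet_differentiable_at G p"
  shows "jet_differentiable_at (\<lambda>q. F q + G q) p"
proof -
  have "{v. jet_dy v (\<lambda>q. F q + G q) p \<noteq> 0} \<subseteq> {v. jet_dy v F p \<noteq> 0} \<union> {v. jet_dy v G p \<noteq> 0}"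
    using assms by (auto simp: jet_dy_def jet_differentiable_at_def)
  then have "finite {v. jet_dy v (\<lambda>q. F q + G q) p \<noteq> 0}"
    by (rule finite_subset) (use assms in \<open>auto simp: jet_differentiable_at_def\<close>)
  then show ?thesis
    using assms by (auto simp: jet_differentiable_at_def intro!: field_differentiable_add)
qed

lemma jet_differentiable_at_mult:
  assumes "jet_differentiable_at F p" "jet_differentiable_at G p"
  shows "jet_differentiable_at (\<lambda>q. F q * G q) p"
proof -
  have "{v. jet_dy v (\<lambda>q. F q * G q) p \<noteq> 0} \<subseteq> {v. jet_dy v F p \<noteq> 0} \<union> {v. jet_dy v G p \<noteq> 0}"
    using assms by (auto simp: jet_dy_def jet_differentiable_at_def)
  then have "finite {v. jet_dy v (\<lambda>q. F q * G q) p \<noteq> 0}"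
    by (rule finite_subset) (use assms in \<open>auto simp: jet_differentiable_at_def\<close>)
  then show ?thesis
    using assms by (auto simp: jet_differentiable_at_def intro!: field_differentiable_mult)
qed

lemma jet_differentiable_at_sum:
  "(\<And>a. a \<in> A \<Longrightarrow> jet_differentiable_at (F a) p) \<Longrightarrow> jet_differentiable_at (\<lambda>q. \<Sum>a\<in>A. F a q) p"
  by (induction A rule: infinite_finite_induct)
    (auto intro: jet_differentiable_at_const jet_differentiable_at_add)

lemma jet_differentiable_at_prod:
  "(\<And>a. a \<in> A \<Longrightarrow> jet_differentiable_at (F a) p) \<Longrightarrow> jet_differentiable_at (\<lambda>q. \<Prod>a\<in>A. F a q) p"
  by (induction A rule: infinite_finite_induct)
    (auto intro: jet_differentiable_at_const jet_differentiable_at_mult)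

lemma total_deriv_const: "total_deriv i (\<lambda>q. c) p = 0"
  by (simp add: total_deriv_def jet_dx_def jet_dy_def case_prod_unfold)

lemma total_deriv_sum:
  "(\<And>a. a \<in> A \<Longrightarrow> jet_differentiable_at (F a) p) \<Longrightarrow>
    total_deriv i (\<lambda>q. \<Sum>a\<in>A. F a q) p = (\<Sum>a\<in>A. total_deriv i (F a) p)"
  by (induction A rule: infinite_finite_induct)
    (simp_all add: total_deriv_const total_deriv_add jet_differentiable_at_sum)

lemma total_deriv_prod:
  "(\<And>a. a \<in> A \<Longrightarrow> jet_differentiable_at (F a) p) \<Longrightarrow> finite A \<Longrightarrow>
    total_deriv i (\<lambda>q. \<Prod>a\<in>A. F a q) p = (\<Sum>a\<in>A. total_deriv i (F a) p * (\<Prod>b\<in>A - {a}. F b p))"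
proof (induction A rule: infinite_finite_induct)
  case (insert x A)
  have "(\<Prod>b\<in>insert x A - {a}. F b p) = F x p * (\<Prod>b\<in>A - {a}. F b p)" if "a \<in> A" for a
  proof -
    have "insert x A - {a} = insert x (A - {a})" using that insert by auto
    then show ?thesis using insert by simp
  qed
  moreover have "insert x A - {x} = A" using insert by auto
  ultimately show ?case
    using insert
    by (simp add: total_deriv_mult jet_differentiable_at_prod sum_distrib_left mult_ac)
qed (simp_all add: total_deriv_const)

lemma total_deriv_diff:
  assumes "jet_differentiable_at F p" "jet_differentiable_at G p"
  shows "total_deriv i (\<lambda>q. F q - G q) p = total_deriv i F p - total_deriv i G p"
proof -
  have "total_deriv i (\<lambda>q. c * G q) p = c * total_deriv i G p" for c
    using total_deriv_mult [OF jet_differentiable_at_const assms(2)] by (simp add: total_deriv_const)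
  then have "total_deriv i (\<lambda>q. F q + c * G q) p = total_deriv i F p + c * total_deriv i G p" for c
    using assms by (simp add: total_deriv_add jet_differentiable_at_mult jet_differentiable_at_const)
  from this [of "-1"] show ?thesis by simp
qed

section \<open>Labelled families of blocks and the Faa di Bruno formula\<close>

text \<open>
  The blocks are disjoint and nonempty but need not cover \<open>A\<close>. As they are nonempty, disjointness for
  distinct pairs also forces each block to carry a single label. Pairing blocks with labels, instead
  of using a partition with a separate labelling, turns the double sum over partitions and labels
  into one sum.
\<close>

definition labelled_partitions :: "'a set \<Rightarrow> ('a set \<times> 'm) set set" where
  "labelled_partitions A = {S. S \<subseteq> (Pow A - {{}}) \<times> UNIV \<and> disjoint_family_on fst S}"

definition support :: "('a set \<times> 'm) set \<Rightarrow> 'a set" where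
  "support S = \<Union>(fst ` S)"

lemma finite_labelled_partitions:
  "finite A \<Longrightarrow> finite (labelled_partitions A :: ('a set \<times> 'm::finite) set set)"
  unfolding labelled_partitions_def
  by (rule finite_subset [of _ "Pow ((Pow A - {{}}) \<times> UNIV)"]) auto

lemma labelled_partitions_finite:
  "finite A \<Longrightarrow> S \<in> labelled_partitions A \<Longrightarrow> finite (S :: ('a set \<times> 'm::finite) set)"
  unfolding labelled_partitions_def
  by (rule finite_subset [of _ "(Pow A - {{}}) \<times> UNIV"]) auto

lemma labelled_partitionsI:
  assumes "\<And>b l. (b, l) \<in> S \<Longrightarrow> b \<subseteq> A \<and> b \<noteq> {}"
    and "\<And>x y. x \<in> S \<Longrightarrow> y \<in> S \<Longrightarrow> x \<noteq> y \<Longrightarrow> fst x \<inter> fst y = {}"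
  shows "S \<in> labelled_partitions A"
  using assms by (auto simp: labelled_partitions_def disjoint_family_on_def)

lemma labelled_partitionsD:
  assumes "S \<in> labelled_partitions A"
  shows "x \<in> S \<Longrightarrow> fst x \<subseteq> A" "x \<in> S \<Longrightarrow> fst x \<noteq> {}"
    "x \<in> S \<Longrightarrow> y \<in> S \<Longrightarrow> x \<noteq> y \<Longrightarrow> fst x \<inter> fst y = {}"
proof -
  have S: "S \<subseteq> (Pow A - {{}}) \<times> UNIV" "disjoint_family_on fst S"
    using assms by (auto simp: labelled_partitions_def)
  show "fst x \<subseteq> A" "fst x \<noteq> {}" if "x \<in> S"
    using subsetD [OF S(1) that] by (auto simp: mem_Times_iff)
  show "fst x \<inter> fst y = {}" if "x \<in> S" "y \<in> S" "x \<noteq> y"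
    using that by (intro disjoint_family_onD [OF S(2)])
qed

lemma labelled_partitions_eqI:
  assumes "S \<in> labelled_partitions A" "x \<in> S" "y \<in> S" "a \<in> fst x" "a \<in> fst y"
  shows "x = y"
  using assms labelled_partitionsD(3) by blast

definition y_derivs :: "('a set \<times> 'm) set \<Rightarrow> ('n + 'm) multiset" where
  "y_derivs S = image_mset (Inr \<circ> snd) (mset_set S)"

definition x_derivs :: "('a \<Rightarrow> 'n) \<Rightarrow> 'a set \<Rightarrow> ('n + 'm) multiset" where
  "x_derivs i A = image_mset (Inl \<circ> i) (mset_set A)"

definition jet_var :: "('a \<Rightarrow> 'n) \<Rightarrow> 'a set \<times> 'm \<Rightarrow> 'm \<times> 'n multiset" where
  "jet_var i x = (snd x, image_mset i (mset_set (fst x)))"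

definition jet_term :: "('a \<Rightarrow> 'n) \<Rightarrow> (('k::real_normed_field, 'n::finite, 'm::finite) base \<Rightarrow> 'k)
    \<Rightarrow> 'a set \<Rightarrow> ('k, 'n, 'm) jet \<Rightarrow> ('a set \<times> 'm) set \<Rightarrow> 'k" where
  "jet_term i f A p S = partials_mset (x_derivs i (A - support S) + y_derivs S) f (jet_base p) *
     (\<Prod>x\<in>S. snd p (jet_var i x))"

definition faa_di_bruno :: "('a \<Rightarrow> 'n) \<Rightarrow> (('k::real_normed_field, 'n::finite, 'm::finite) base \<Rightarrow> 'k)
    \<Rightarrow> 'a set \<Rightarrow> ('k, 'n, 'm) jet \<Rightarrow> 'k" where
  "faa_di_bruno i f A p = (\<Sum>S\<in>labelled_partitions A. jet_term i f A p S)"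

text \<open>
  The point \<open>a\<close> joins the block \<open>x\<close>. If \<open>x\<close> is an empty block \<open>({}, l)\<close>, then \<open>a\<close> forms a new block
  with label \<open>l\<close>: this mirrors the total derivative, for which \<open>y\<^sup>l\<close> is the jet variable
  without lower indices.
\<close>

definition insert_point :: "'a \<Rightarrow> ('a set \<times> 'm) set \<Rightarrow> 'a set \<times> 'm \<Rightarrow> ('a set \<times> 'm) set" where
  "insert_point a S x = insert (insert a (fst x), snd x) (S - {x})"

text \<open>Deleting \<open>a\<close> from its block, and the block as well if it becomes empty, is the inverse.\<close>

lemma insert_point_bij:
  assumes a: "a \<notin> A"
  shows "bij_betw (\<lambda>(S, x). insert_point a S x)
    (SIGMA S:labelled_partitions A :: ('a set \<times> 'm) set set. S \<union> {{}} \<times> UNIV)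
    {S \<in> labelled_partitions (insert a A). a \<in> support S}"
  (is "bij_betw _ ?D ?R")
proof (rule bij_betw_byWitness)
  \<comment> \<open>\<open>pt S\<close> is the block of \<open>a\<close> in \<open>S\<close>; the removal of all empty blocks covers the case of a block \<open>{a}\<close>.\<close>
  define pt where "pt S = (THE x. x \<in> S \<and> a \<in> fst x)" for S :: "('a set \<times> 'm) set"
  define del where "del S = ((S - {pt S} \<union> {(fst (pt S) - {a}, snd (pt S))}) - {{}} \<times> UNIV,
       (fst (pt S) - {a}, snd (pt S)))" for S :: "('a set \<times> 'm) set"
  have pt: "pt S = x" if "S \<in> labelled_partitions B" "x \<in> S" "a \<in> fst x" for S B x
    unfolding pt_def using that by (intro the_equality) (auto dest: labelled_partitions_eqI)
  have notin: "a \<notin> fst x" if "S \<in> labelled_partitions A" "x \<in> S" for S :: "('a set \<times> 'm) set" and x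
    using labelled_partitionsD(1) [OF that] a by blast
  have img: "insert_point a S x \<in> ?R" if S: "S \<in> labelled_partitions A" and x: "x \<in> S \<union> {{}} \<times> UNIV"
    for S :: "('a set \<times> 'm) set" and x
  proof -
    have disj: "fst x \<inter> fst y = {}" if "y \<in> S" "y \<noteq> x" for y
      using x that labelled_partitionsD(3) [OF S, of x y] by auto
    have xA: "fst x \<subseteq> A" using x labelled_partitionsD(1) [OF S, of x] by auto
    have "insert_point a S x \<in> labelled_partitions (insert a A)"
      unfolding insert_point_def
    proof (rule labelled_partitionsI)
      show "b \<subseteq> insert a A \<and> b \<noteq> {}" if "(b, l) \<in> insert (insert a (fst x), snd x) (S - {x})" for b l
        using that xA labelled_partitionsD(1,2) [OF S, of "(b, l)"] by auto
      show "fst y \<inter> fst z = {}" if "y \<in> insert (insert a (fst x), snd x) (S - {x})"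
        "z \<in> insert (insert a (fst x), snd x) (S - {x})" "y \<noteq> z" for y z
        using that disj [of y] disj [of z] labelled_partitionsD(3) [OF S, of y z] notin [OF S, of y] notin [OF S, of z]
        by auto
    qed
    then show ?thesis by (auto simp: support_def insert_point_def)
  qed
  then show "(\<lambda>(S, x). insert_point a S x) ` ?D \<subseteq> ?R"
    by auto
  show "\<forall>z\<in>?D. del ((\<lambda>(S, x). insert_point a S x) z) = z"
  proof clarify
    fix S :: "('a set \<times> 'm) set" and b l
    assume S: "S \<in> labelled_partitions A" and x: "(b, l) \<in> S \<union> {{}} \<times> UNIV"
    have R: "insert_point a S (b, l) \<in> labelled_partitions (insert a A)"
      using img [OF S x] by simp
    have p: "pt (insert_point a S (b, l)) = (insert a b, l)"
      by (rule pt [OF R]) (auto simp: insert_point_def)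
    have "a \<notin> b" using x notin [OF S, of "(b, l)"] by auto
    moreover have "(insert a b, l) \<notin> S" using notin [OF S, of "(insert a b, l)"] by auto
    moreover have "({}, l') \<notin> S" for l' using labelled_partitionsD(2) [OF S] by fastforce
    ultimately show "del (insert_point a S (b, l)) = (S, (b, l))"
      using x unfolding del_def p by (auto simp: insert_point_def)
  qed
  have reinsert: "del S \<in> ?D \<and> (\<lambda>(S, x). insert_point a S x) (del S) = S" if "S \<in> ?R" for S
  proof -
    from that have S: "S \<in> labelled_partitions (insert a A)" and "a \<in> support S" by auto
    then obtain b l where x: "(b, l) \<in> S" "a \<in> b" by (auto simp: support_def)
    have p: "pt S = (b, l)" using x by (intro pt [OF S]) auto
    have other: "a \<notin> fst y \<and> fst y \<inter> b = {}" if "y \<in> S" "y \<noteq> (b, l)" for y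
      using labelled_partitionsD(3) [OF S that(1) x(1) that(2)] x(2) by auto
    have ne: "({}, l') \<notin> S" for l' using labelled_partitionsD(2) [OF S] by fastforce
    have b: "b \<subseteq> insert a A" using labelled_partitionsD(1) [OF S x(1)] by simp
    have *: "(S - {(b, l)} \<union> {(b - {a}, l)}) - {{}} \<times> UNIV \<in> labelled_partitions A"
    proof (rule labelled_partitionsI)
      show "c \<subseteq> A \<and> c \<noteq> {}" if "(c, l') \<in> (S - {(b, l)} \<union> {(b - {a}, l)}) - {{}} \<times> UNIV" for c l'
        using that other [of "(c, l')"] b labelled_partitionsD(1) [OF S, of "(c, l')"] by auto
      show "fst y \<inter> fst z = {}" if "y \<in> (S - {(b, l)} \<union> {(b - {a}, l)}) - {{}} \<times> UNIV"
        "z \<in> (S - {(b, l)} \<union> {(b - {a}, l)}) - {{}} \<times> UNIV" "y \<noteq> z" for y z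
        using that other [of y] other [of z] labelled_partitionsD(3) [OF S, of y z] by auto
    qed
    have notS: "(b - {a}, l) \<notin> S"
    proof
      assume b': "(b - {a}, l) \<in> S"
      then have "b - {a} = {}" using other [of "(b - {a}, l)"] x(2) by auto
      with b' ne show False by simp
    qed
    show ?thesis
      unfolding del_def p using * x notS ne by (auto simp: insert_point_def insert_absorb)
  qed
  show "\<forall>z\<in>?R. (\<lambda>(S, x). insert_point a S x) (del z) = z"
    by (intro ballI conjunct2 [OF reinsert])
  show "del ` ?R \<subseteq> ?D"
    by (intro image_subsetI conjunct1 [OF reinsert])
qed

lemma support_insert_point:
  assumes S: "S \<in> labelled_partitions A" and x: "x \<in> S \<union> {{}} \<times> UNIV"
  shows "support (insert_point a S x) = insert a (support S)"
  using x labelled_partitionsD(3) [OF S, of _ x]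
  by (auto simp: support_def insert_point_def)

lemma x_derivs_insert:
  "finite A \<Longrightarrow> a \<notin> A \<Longrightarrow> x_derivs i (insert a A) = add_mset (Inl (i a)) (x_derivs i A)"
  by (simp add: x_derivs_def)

lemma y_derivs_insert:
  "finite S \<Longrightarrow> x \<notin> S \<Longrightarrow> y_derivs (insert x S) = add_mset (Inr (snd x)) (y_derivs S)"
  by (simp add: y_derivs_def)

lemma faa_di_bruno_empty:
  fixes i :: "'a \<Rightarrow> 'n::finite" and f :: "('k::real_normed_field, 'n, 'm::finite) base \<Rightarrow> 'k"
  shows "faa_di_bruno i f {} p = f (jet_base p)"
proof -
  have "labelled_partitions {} = {{} :: ('a set \<times> 'm) set}"
    by (auto simp: labelled_partitions_def disjoint_family_on_def)
  moreover have "(SOME cs. mset cs = {#}) = []"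
    using mset_some [of "{#}"] by simp
  ultimately show ?thesis
    by (simp add: faa_di_bruno_def jet_term_def x_derivs_def y_derivs_def partials_mset_def)
qed

lemma jet_differentiable_at_jet_term:
  assumes "smooth_on U f" "jet_base p \<in> U"
  shows "jet_differentiable_at (\<lambda>q. jet_term i f A q S) p"
  unfolding jet_term_def
  using assms
  by (intro jet_differentiable_at_mult jet_differentiable_at_prod
      jet_differentiable_at_var jet_differentiable_at_base [where U = U] smooth_on_partials_mset)

lemma jet_differentiable_at_faa_di_bruno:
  assumes "smooth_on U f" "jet_base p \<in> U"
  shows "jet_differentiable_at (faa_di_bruno i f A) p"
  unfolding faa_di_bruno_def [abs_def]
  by (intro jet_differentiable_at_sum jet_differentiable_at_jet_term [OF assms])

text \<open>
  The product rule turns the term of \<open>S\<close> into the terms of all families on \<open>insert a A\<close> that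
  restrict to \<open>S\<close>: the derivative of the coefficient in \<open>x\<close> leaves \<open>a\<close> outside the blocks, its
  derivative in \<open>y\<^sup>l\<close> creates the block \<open>{a}\<close>, and the derivative of a jet variable adds \<open>a\<close> to a
  block.
\<close>

lemma total_deriv_faa_di_bruno:
  fixes i :: "'a \<Rightarrow> 'n::finite" and f :: "('k::real_normed_field, 'n, 'm::finite) base \<Rightarrow> 'k"
  assumes U: "open U" "smooth_on U f" "jet_base p \<in> U" and A: "finite A" "a \<notin> A"
  shows "total_deriv (i a) (faa_di_bruno i f A) p = faa_di_bruno i f (insert a A) p"
proof -
  let ?L = "labelled_partitions A :: ('a set \<times> 'm) set set"
  let ?L' = "labelled_partitions (insert a A) :: ('a set \<times> 'm) set set"
  note fin = finite_labelled_partitions [OF A(1)] labelled_partitions_finite [OF A(1)]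
  have deriv_term: "total_deriv (i a) (\<lambda>q. jet_term i f A q S) p =
      jet_term i f (insert a A) p S +
      (\<Sum>x\<in>S \<union> {{}} \<times> UNIV. jet_term i f (insert a A) p (insert_point a S x))"
    if S: "S \<in> ?L" for S
  proof -
    let ?P = "partials_mset (x_derivs i (A - support S) + y_derivs S) f"
    let ?Q = "\<lambda>q. \<Prod>x\<in>S. snd q (jet_var i x)"
    have jt: "(\<lambda>q. jet_term i f A q S) = (\<lambda>q. ?P (jet_base q) * ?Q q)"
      by (simp add: jet_term_def)
    have finS: "finite S" using fin(2) S .
    have supp: "support S \<subseteq> A" using labelled_partitionsD(1) [OF S] by (auto simp: support_def)
    then have aS: "a \<notin> support S" using A by blast
    have ne: "({}, l) \<notin> S" for l using labelled_partitionsD(2) [OF S] by fastforce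
    have sm: "smooth_on U ?P" by (intro smooth_on_partials_mset U)
    have "total_deriv (i a) (\<lambda>q. ?P (jet_base q) * ?Q q) p =
        total_deriv (i a) (\<lambda>q. ?P (jet_base q)) p * ?Q p + ?P (jet_base p) * total_deriv (i a) ?Q p"
      by (intro total_deriv_mult jet_differentiable_at_prod jet_differentiable_at_var
          jet_differentiable_at_base [OF sm U(3)])
    also have "total_deriv (i a) (\<lambda>q. ?P (jet_base q)) p =
        partials_mset (add_mset (Inl (i a)) (x_derivs i (A - support S) + y_derivs S)) f (jet_base p) +
        (\<Sum>l\<in>UNIV. snd p (l, {#i a#}) *
          partials_mset (add_mset (Inr l) (x_derivs i (A - support S) + y_derivs S)) f (jet_base p))"
      unfolding total_deriv_base using U by (simp add: partials_mset_add)
    also have "total_deriv (i a) ?Q p =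
        (\<Sum>x\<in>S. snd p (snd x, add_mset (i a) (image_mset i (mset_set (fst x)))) *
          (\<Prod>y\<in>S - {x}. snd p (jet_var i y)))"
      using finS by (subst total_deriv_prod)
        (auto simp: jet_var_def total_deriv_jet_variable intro: jet_differentiable_at_var)
    finally have D: "total_deriv (i a) (\<lambda>q. ?P (jet_base q) * ?Q q) p =
        partials_mset (add_mset (Inl (i a)) (x_derivs i (A - support S) + y_derivs S)) f (jet_base p) * ?Q p +
        (\<Sum>l\<in>UNIV. snd p (l, {#i a#}) *
          partials_mset (add_mset (Inr l) (x_derivs i (A - support S) + y_derivs S)) f (jet_base p) * ?Q p) +
        (\<Sum>x\<in>S. ?P (jet_base p) * (snd p (snd x, add_mset (i a) (image_mset i (mset_set (fst x)))) *
          (\<Prod>y\<in>S - {x}. snd p (jet_var i y))))"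
      by (simp add: algebra_simps sum_distrib_left sum_distrib_right)
    have 1: "jet_term i f (insert a A) p S =
        partials_mset (add_mset (Inl (i a)) (x_derivs i (A - support S) + y_derivs S)) f (jet_base p) * ?Q p"
      using A aS by (simp add: jet_term_def insert_Diff_if x_derivs_insert)
    have new: "(insert a (fst x), snd x) \<notin> S" for x
      using aS by (force simp: support_def)
    have mvar: "snd p (jet_var i (insert a (fst x), snd x)) =
        snd p (snd x, add_mset (i a) (image_mset i (mset_set (fst x))))"
      if "x \<in> S \<union> {{}} \<times> UNIV" for x
    proof -
      have "finite (fst x)" "a \<notin> fst x"
        using that supp aS A labelled_partitionsD(1) [OF S, of x]
        by (auto simp: support_def intro: finite_subset)
      then show ?thesis by (simp add: jet_var_def)
    qed
    have ip: "jet_term i f (insert a A) p (insert_point a S x) =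
        partials_mset (x_derivs i (A - support S) + add_mset (Inr (snd x)) (y_derivs (S - {x}))) f (jet_base p) *
        (snd p (snd x, add_mset (i a) (image_mset i (mset_set (fst x)))) *
          (\<Prod>y\<in>S - {x}. snd p (jet_var i y)))" if x: "x \<in> S \<union> {{}} \<times> UNIV" for x
    proof -
      have "insert a A - support (insert_point a S x) = A - support S"
        unfolding support_insert_point [OF S x] using A by auto
      then show ?thesis
        unfolding jet_term_def insert_point_def
        using finS new [of x] mvar [OF x] by (simp add: y_derivs_insert)
    qed
    have "(\<Sum>x\<in>S \<union> {{}} \<times> UNIV. jet_term i f (insert a A) p (insert_point a S x)) =
        (\<Sum>x\<in>S. jet_term i f (insert a A) p (insert_point a S x)) +
        (\<Sum>x\<in>{{}} \<times> UNIV. jet_term i f (insert a A) p (insert_point a S x))"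
      using finS ne by (intro sum.union_disjoint) auto
    also have "(\<Sum>x\<in>{{}} \<times> UNIV. jet_term i f (insert a A) p (insert_point a S x)) =
        (\<Sum>l\<in>UNIV. jet_term i f (insert a A) p (insert_point a S ({}, l)))"
      by (rule sum.reindex_bij_witness [of _ "\<lambda>l. ({}, l)" snd]) auto
    also have "\<dots> = (\<Sum>l\<in>UNIV. snd p (l, {#i a#}) *
          partials_mset (add_mset (Inr l) (x_derivs i (A - support S) + y_derivs S)) f (jet_base p) * ?Q p)"
      using ne by (intro sum.cong refl) (simp add: ip)
    also have "(\<Sum>x\<in>S. jet_term i f (insert a A) p (insert_point a S x)) =
        (\<Sum>x\<in>S. ?P (jet_base p) * (snd p (snd x, add_mset (i a) (image_mset i (mset_set (fst x)))) *
          (\<Prod>y\<in>S - {x}. snd p (jet_var i y))))"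
    proof (intro sum.cong refl)
      fix x assume x: "x \<in> S"
      have *: "add_mset (Inr (snd x)) (y_derivs (S - {x})) = (y_derivs S :: ('n + 'm) multiset)"
        by (subst y_derivs_insert [symmetric]) (use finS x in \<open>auto simp: insert_absorb\<close>)
      show "jet_term i f (insert a A) p (insert_point a S x) =
          ?P (jet_base p) * (snd p (snd x, add_mset (i a) (image_mset i (mset_set (fst x)))) *
          (\<Prod>y\<in>S - {x}. snd p (jet_var i y)))"
        unfolding ip [OF UnI1 [OF x]] * ..
    qed
    finally show ?thesis
      unfolding jt D 1 by simp
  qed
  have "total_deriv (i a) (faa_di_bruno i f A) p =
      (\<Sum>S\<in>?L. jet_term i f (insert a A) p S + (\<Sum>x\<in>S \<union> {{}} \<times> UNIV. jet_term i f (insert a A) p (insert_point a S x)))"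
    unfolding faa_di_bruno_def [abs_def]
    using deriv_term by (subst total_deriv_sum) (auto intro: jet_differentiable_at_jet_term [OF U(2,3)])
  also have "\<dots> = (\<Sum>S\<in>?L. jet_term i f (insert a A) p S) +
      (\<Sum>(S, x)\<in>(SIGMA S:?L. S \<union> {{}} \<times> UNIV). jet_term i f (insert a A) p (insert_point a S x))"
    using fin by (subst sum.Sigma [symmetric]) (auto simp: sum.distrib)
  also have "(\<Sum>(S, x)\<in>(SIGMA S:?L. S \<union> {{}} \<times> UNIV). jet_term i f (insert a A) p (insert_point a S x)) =
      (\<Sum>S\<in>{S \<in> ?L'. a \<in> support S}. jet_term i f (insert a A) p S)"
    by (subst sum.reindex_bij_betw [OF insert_point_bij [OF A(2)], symmetric])
      (simp add: case_prod_unfold)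
  also have "?L = {S \<in> ?L'. a \<notin> support S}"
    using A(2) by (fastforce simp: labelled_partitions_def support_def)
  also have "(\<Sum>S\<in>{S \<in> ?L'. a \<notin> support S}. jet_term i f (insert a A) p S) +
      (\<Sum>S\<in>{S \<in> ?L'. a \<in> support S}. jet_term i f (insert a A) p S) = (\<Sum>S\<in>?L'. jet_term i f (insert a A) p S)"
    using A(1) by (subst sum.union_disjoint [symmetric])
      (auto simp: finite_labelled_partitions intro!: sum.cong)
  finally show ?thesis
    by (simp add: faa_di_bruno_def [abs_def])
qed

lemma sum_nonempty_subsets_insert:
  assumes "finite K" "a \<notin> K"
  shows "(\<Sum>A\<in>Pow (insert a K) - {{}}. h A) =
    (\<Sum>A\<in>Pow K - {{}}. h (insert a A) + h A) + h {a}"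
proof -
  have "Pow (insert a K) - {{}} = (Pow K - {{}}) \<union> insert a ` Pow K"
    by (auto simp: Pow_insert)
  then have "sum h (Pow (insert a K) - {{}}) = sum h (Pow K - {{}}) + sum h (insert a ` Pow K)"
    using assms by (simp only:) (rule sum.union_disjoint; auto)
  also have "inj_on (insert a) (Pow K)"
    using assms by (intro inj_on_inverseI [where g = "\<lambda>B. B - {a}"]) auto
  then have "sum h (insert a ` Pow K) = (\<Sum>A\<in>Pow K. h (insert a A))"
    by (simp add: sum.reindex)
  also have "\<dots> = (\<Sum>A\<in>Pow K - {{}}. h (insert a A)) + h {a}"
    using assms by (simp add: sum.remove [of "Pow K" "{}"] add.commute)
  finally show ?thesis
    by (simp add: sum.distrib add_ac)
qed

text \<open>
  The induction step differentiates the term of \<open>A\<close>, which gives the term of \<open>insert (\<kappa> + 1) A\<close> and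
  the term of \<open>A\<close> for the larger set of positions. The correction in the recursion is the missing
  term of \<open>{\<kappa> + 1}\<close>. No term with \<open>A = {}\<close> ever appears: the iterated
  total derivative of \<open>Y\<^sup>j - \<Sum>\<^sub>k X\<^sup>k y\<^sup>j\<^sub>k\<close> would contain it as its term of highest order in the jet
  variables, and the recursion is designed to cancel it.
\<close>

lemma prolong_coeff_eq_faa_di_bruno:
  fixes X :: "'n::finite \<Rightarrow> ('k::real_normed_field, 'n, 'm::finite) base \<Rightarrow> 'k"
  assumes U: "open U" and X: "\<And>k. smooth_on U (X k)" and Y: "\<And>l. smooth_on U (Y l)"
    and p: "jet_base p \<in> U"
  shows "prolong_coeff X Y j i \<kappa> p = faa_di_bruno i (Y j) {1..\<kappa>} p -
    (\<Sum>k\<in>UNIV. \<Sum>A\<in>Pow {1..\<kappa>} - {{}}. faa_di_bruno i (X k) A p *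
       snd p (j, add_mset k (image_mset i (mset_set ({1..\<kappa>} - A)))))"
  using p
proof (induction \<kappa> arbitrary: p)
  case 0
  then show ?case by (simp add: faa_di_bruno_empty)
next
  case (Suc \<kappa>)
  let ?K = "{1..\<kappa>}" and ?a = "Suc \<kappa>"
  define v where "v k B = (j, add_mset k (image_mset i (mset_set B)))" for k B
  have K: "{1..?a} = insert ?a ?K" by auto
  note jd = jet_differentiable_at_faa_di_bruno [OF X Suc.prems]
    jet_differentiable_at_faa_di_bruno [OF Y Suc.prems]
    jet_differentiable_at_sum jet_differentiable_at_mult jet_differentiable_at_var
  have td: "total_deriv (i ?a) (\<lambda>q. faa_di_bruno i (X k) A q * snd q (v k (?K - A))) p =
      faa_di_bruno i (X k) (insert ?a A) p * snd p (v k (?K - A)) +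
      faa_di_bruno i (X k) A p * snd p (v k (insert ?a ?K - A))" if "A \<subseteq> ?K" for k A
  proof -
    have "?a \<notin> A" "finite A" using that by (auto intro: finite_subset)
    moreover have "insert ?a ?K - A = insert ?a (?K - A)" using that by auto
    ultimately show ?thesis
      using total_deriv_faa_di_bruno [OF U X Suc.prems, of A ?a i k]
      by (subst total_deriv_mult)
        (auto intro!: jd simp: v_def total_deriv_jet_variable add_mset_commute)
  qed
  have "total_deriv (i ?a) (prolong_coeff X Y j i \<kappa>) p =
      total_deriv (i ?a) (\<lambda>q. faa_di_bruno i (Y j) ?K q -
        (\<Sum>k\<in>UNIV. \<Sum>A\<in>Pow ?K - {{}}. faa_di_bruno i (X k) A q * snd q (v k (?K - A)))) p"
    unfolding v_def by (rule total_deriv_cong [OF U Suc.prems]) (rule Suc.IH)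
  also have "\<dots> = faa_di_bruno i (Y j) {1..?a} p - (\<Sum>k\<in>UNIV. \<Sum>A\<in>Pow ?K - {{}}.
      faa_di_bruno i (X k) (insert ?a A) p * snd p (v k (?K - A)) +
      faa_di_bruno i (X k) A p * snd p (v k (insert ?a ?K - A)))"
  proof (subst total_deriv_diff)
    have "total_deriv (i ?a) (\<lambda>q. \<Sum>A\<in>Pow ?K - {{}}. faa_di_bruno i (X k) A q * snd q (v k (?K - A))) p =
        (\<Sum>A\<in>Pow ?K - {{}}. faa_di_bruno i (X k) (insert ?a A) p * snd p (v k (?K - A)) +
          faa_di_bruno i (X k) A p * snd p (v k (insert ?a ?K - A)))" for k
      by (subst total_deriv_sum, intro jd) (intro sum.cong refl td, blast)
    moreover have "total_deriv (i ?a) (faa_di_bruno i (Y j) ?K) p = faa_di_bruno i (Y j) {1..?a} p"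
      unfolding K using total_deriv_faa_di_bruno [OF U Y Suc.prems, of ?K ?a i j] by simp
    ultimately show "total_deriv (i ?a) (faa_di_bruno i (Y j) ?K) p -
        total_deriv (i ?a) (\<lambda>q. \<Sum>k\<in>UNIV. \<Sum>A\<in>Pow ?K - {{}}.
          faa_di_bruno i (X k) A q * snd q (v k (?K - A))) p =
        faa_di_bruno i (Y j) {1..?a} p - (\<Sum>k\<in>UNIV. \<Sum>A\<in>Pow ?K - {{}}.
          faa_di_bruno i (X k) (insert ?a A) p * snd p (v k (?K - A)) +
          faa_di_bruno i (X k) A p * snd p (v k (insert ?a ?K - A)))"
      by (subst total_deriv_sum) (auto intro!: jd)
  qed (intro jd)+
  finally have 1: "total_deriv (i ?a) (prolong_coeff X Y j i \<kappa>) p =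
      faa_di_bruno i (Y j) {1..?a} p - (\<Sum>k\<in>UNIV. \<Sum>A\<in>Pow ?K - {{}}.
      faa_di_bruno i (X k) (insert ?a A) p * snd p (v k (?K - A)) +
      faa_di_bruno i (X k) A p * snd p (v k (insert ?a ?K - A)))" .
  have 2: "total_deriv (i ?a) (\<lambda>q. X k (jet_base q)) p = faa_di_bruno i (X k) {?a} p" for k
    using total_deriv_faa_di_bruno [OF U X Suc.prems, of "{}" ?a i k]
    by (simp add: faa_di_bruno_empty [abs_def])
  have 3: "(\<Sum>A\<in>Pow (insert ?a ?K) - {{}}. faa_di_bruno i (X k) A p * snd p (v k (insert ?a ?K - A))) =
      (\<Sum>A\<in>Pow ?K - {{}}. faa_di_bruno i (X k) (insert ?a A) p * snd p (v k (?K - A)) +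
         faa_di_bruno i (X k) A p * snd p (v k (insert ?a ?K - A))) +
      faa_di_bruno i (X k) {?a} p * snd p (v k ?K)" for k
  proof -
    have "insert ?a ?K - insert ?a A = ?K - A" for A
      by auto
    then show ?thesis
      by (subst sum_nonempty_subsets_insert) auto
  qed
  show ?case
    unfolding prolong_coeff.simps 1 2 v_def [symmetric] K 3 by (simp add: sum.distrib)
qed

section \<open>Shuffles and subsets\<close>

lemma strict_mono_on_nat_image_eq:
  fixes f g :: "nat \<Rightarrow> nat"
  assumes f: "strict_mono_on {1..d} f" and g: "strict_mono_on {1..d} g"
    and eq: "f ` {1..d} = g ` {1..d}" and t: "t \<in> {1..d}"
  shows "f t = g t"
proof -
  have sorted: "sorted_wrt (<) (map h [1..<d + 1])" if "strict_mono_on {1..d} h" for h :: "nat \<Rightarrow> nat"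
    unfolding sorted_wrt_map
    by (rule sorted_wrt_mono_rel [OF _ sorted_wrt_upt])
      (auto intro!: strict_mono_onD [OF that] simp del: upt_Suc)
  have "set (map h [1..<d + 1]) = h ` {1..d}" for h :: "nat \<Rightarrow> nat"
    by (simp add: atLeastLessThanSuc_atLeastAtMost del: upt_Suc)
  then have "map f [1..<d + 1] = map g [1..<d + 1]"
    using eq by (intro strict_sorted_equal [OF sorted [OF g] sorted [OF f]]) simp
  then show ?thesis
    using t by (simp del: upt_Suc)
qed

lemma ex_strict_mono_on_enumeration:
  fixes A :: "nat set"
  assumes "finite A"
  obtains h where "strict_mono_on {1..card A} h" "h ` {1..card A} = A"
proof -
  obtain g where g: "bij_betw g {..<card A} A" "strict_mono_on {..<card A} g"
    using ex_bij_betw_strict_mono_card [OF assms] by blast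
  have "strict_mono_on {1..card A} (\<lambda>t. g (t - 1))"
    by (intro strict_mono_onI strict_mono_onD [OF g(2)]) auto
  moreover have "(\<lambda>t. g (t - 1)) ` {1..card A} = g ` {..<card A}"
  proof
    show "g ` {..<card A} \<subseteq> (\<lambda>t. g (t - 1)) ` {1..card A}"
    proof
      fix y assume "y \<in> g ` {..<card A}"
      then obtain a where "a < card A" "y = g a" by auto
      then show "y \<in> (\<lambda>t. g (t - 1)) ` {1..card A}"
        by (intro image_eqI [of _ _ "Suc a"]) auto
    qed
  qed auto
  ultimately show ?thesis
    using that g(1) by (metis bij_betw_imp_surj_on)
qed

text \<open>
  A shuffle is increasing on \<open>{1..q}\<close> and on the rest, so it is determined by the image of
  \<open>{1..q}\<close>: it enumerates that image and then the complement.
\<close>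

lemma shuffles_at_bij_subsets:
  "bij_betw (\<lambda>\<tau>. \<tau> ` {1..q}) (shuffles_at \<kappa> q) {B. B \<subseteq> {1..\<kappa>} \<and> card B = q}"
proof (cases "q \<le> \<kappa>")
  case False
  then have "{B. B \<subseteq> {1..\<kappa>} \<and> card B = q} = {}"
    using card_mono [of "{1..\<kappa>}"] by fastforce
  then show ?thesis
    using False by (simp add: shuffles_at_def bij_betw_def)
next
  case q: True
  have split: "{1..\<kappa>} = {1..q} \<union> {q + 1..\<kappa>}" "{1..q} \<inter> {q + 1..\<kappa>} = {}"
    using q by auto
  show ?thesis
  proof (rule bij_betw_imageI)
    show "inj_on (\<lambda>\<tau>. \<tau> ` {1..q}) (shuffles_at \<kappa> q)"
    proof (rule inj_onI)
      fix \<tau> \<tau>' assume T: "\<tau> \<in> shuffles_at \<kappa> q" "\<tau>' \<in> shuffles_at \<kappa> q" "\<tau> ` {1..q} = \<tau>' ` {1..q}"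
      have P: "\<tau> permutes {1..\<kappa>}" "\<tau>' permutes {1..\<kappa>}"
        and M: "strict_mono_on {1..q} \<tau>" "strict_mono_on {1..q} \<tau>'"
          "strict_mono_on {q + 1..\<kappa>} \<tau>" "strict_mono_on {q + 1..\<kappa>} \<tau>'"
        using T q by (auto simp: shuffles_at_def)
      have compl: "\<rho> ` {q + 1..\<kappa>} = {1..\<kappa>} - \<rho> ` {1..q}" if "\<rho> permutes {1..\<kappa>}" for \<rho>
      proof -
        have "{q + 1..\<kappa>} = {1..\<kappa>} - {1..q}" by auto
        then show ?thesis
          using image_set_diff [OF permutes_inj [OF that]] permutes_image [OF that] by metis
      qed
      have shiftM: "strict_mono_on {1..\<kappa> - q} (\<lambda>t. \<rho> (t + q))" if "strict_mono_on {q + 1..\<kappa>} \<rho>"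
        for \<rho> :: "nat \<Rightarrow> nat"
        by (intro strict_mono_onI strict_mono_onD [OF that]) auto
      have shiftI: "(\<lambda>t. \<rho> (t + q)) ` {1..\<kappa> - q} = \<rho> ` {q + 1..\<kappa>}" for \<rho> :: "nat \<Rightarrow> nat"
      proof -
        have "(\<lambda>t. t + q) ` {1..\<kappa> - q} = {q + 1..\<kappa>}"
          using q by simp
        then show ?thesis by (metis image_image)
      qed
      have 1: "\<tau> t = \<tau>' t" if "t \<in> {1..q}" for t
        using strict_mono_on_nat_image_eq [OF M(1,2) T(3) that] .
      have 2: "\<tau> t = \<tau>' t" if "t \<in> {q + 1..\<kappa>}" for t
      proof -
        have "(\<lambda>t. \<tau> (t + q)) ` {1..\<kappa> - q} = (\<lambda>t. \<tau>' (t + q)) ` {1..\<kappa> - q}"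
          unfolding shiftI compl [OF P(1)] compl [OF P(2)] T(3) ..
        moreover have "t - q \<in> {1..\<kappa> - q}" "t - q + q = t"
          using that by auto
        ultimately show ?thesis
          using strict_mono_on_nat_image_eq [OF shiftM [OF M(3)] shiftM [OF M(4)], of "t - q"] by simp
      qed
      show "\<tau> = \<tau>'"
      proof
        fix t show "\<tau> t = \<tau>' t"
          using 1 [of t] 2 [of t] P split by (cases "t \<in> {1..\<kappa>}") (auto simp: permutes_not_in)
      qed
    qed
    show "(\<lambda>\<tau>. \<tau> ` {1..q}) ` shuffles_at \<kappa> q = {B. B \<subseteq> {1..\<kappa>} \<and> card B = q}"
    proof (intro equalityI subsetI)
      fix B assume "B \<in> (\<lambda>\<tau>. \<tau> ` {1..q}) ` shuffles_at \<kappa> q"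
      then obtain \<tau> where \<tau>: "\<tau> permutes {1..\<kappa>}" "B = \<tau> ` {1..q}"
        using q by (auto simp: shuffles_at_def)
      have "\<tau> ` {1..q} \<subseteq> \<tau> ` {1..\<kappa>}" using q by (intro image_mono) auto
      moreover have "card (\<tau> ` {1..q}) = q"
        using \<tau> by (subst card_image) (auto intro: inj_on_subset permutes_inj)
      ultimately show "B \<in> {B. B \<subseteq> {1..\<kappa>} \<and> card B = q}"
        using \<tau> permutes_image [OF \<tau>(1)] by auto
    next
      fix B assume "B \<in> {B. B \<subseteq> {1..\<kappa>} \<and> card B = q}"
      then have B: "B \<subseteq> {1..\<kappa>}" "card B = q" by auto
      then have fB: "finite B" using finite_subset by blast
      have cB: "card ({1..\<kappa>} - B) = \<kappa> - q"
        using B fB by (simp add: card_Diff_subset)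
      obtain g where g: "strict_mono_on {1..q} g" "g ` {1..q} = B"
        using ex_strict_mono_on_enumeration [OF fB] B(2) by metis
      obtain h where h: "strict_mono_on {1..\<kappa> - q} h" "h ` {1..\<kappa> - q} = {1..\<kappa>} - B"
        using ex_strict_mono_on_enumeration [of "{1..\<kappa>} - B"] cB by (metis finite_Diff finite_atLeastAtMost)
      define \<tau> where "\<tau> t = (if t \<in> {1..q} then g t else if t \<in> {q + 1..\<kappa>} then h (t - q) else t)" for t
      have i1: "\<tau> ` {1..q} = B" using g(2) by (force simp: \<tau>_def)
      have "(\<lambda>t. t - q) ` {q + 1..\<kappa>} = {1..\<kappa> - q}"
      proof (intro equalityI subsetI)
        fix t assume "t \<in> {1..\<kappa> - q}"
        then show "t \<in> (\<lambda>t. t - q) ` {q + 1..\<kappa>}" by (intro image_eqI [of _ _ "t + q"]) auto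
      qed auto
      then have "(\<lambda>t. h (t - q)) ` {q + 1..\<kappa>} = {1..\<kappa>} - B"
        using h(2) by (metis image_image)
      moreover have "\<tau> ` {q + 1..\<kappa>} = (\<lambda>t. h (t - q)) ` {q + 1..\<kappa>}"
        by (intro image_cong refl) (auto simp: \<tau>_def)
      ultimately have i2: "\<tau> ` {q + 1..\<kappa>} = {1..\<kappa>} - B" by simp
      have img: "\<tau> ` {1..\<kappa>} = {1..\<kappa>}"
        unfolding split(1) [of] image_Un i1 i2 using B split by blast
      then have "inj_on \<tau> {1..\<kappa>}"
        by (intro eq_card_imp_inj_on) auto
      then have "\<tau> permutes {1..\<kappa>}"
        using img q by (intro bij_imp_permutes bij_betw_imageI) (auto simp: \<tau>_def)
      moreover have "strict_mono_on {1..q} \<tau>"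
        using g(1) by (auto simp: strict_mono_on_def \<tau>_def)
      moreover have "strict_mono_on {q + 1..\<kappa>} \<tau>"
        by (intro strict_mono_onI) (auto simp: \<tau>_def intro!: strict_mono_onD [OF h(1)])
      ultimately have "\<tau> \<in> shuffles_at \<kappa> q"
        using q by (simp add: shuffles_at_def)
      then show "B \<in> (\<lambda>\<tau>. \<tau> ` {1..q}) ` shuffles_at \<kappa> q"
        using i1 by blast
    qed
  qed
qed

section \<open>Standard blocks and types\<close>

lemma set_blocks: "set (blocks d mu) = (SIGMA e:{1..d}. {1..mu e})"
  by (auto simp: blocks_def atLeastLessThanSuc_atLeastAtMost simp del: upt_Suc)

lemma set_triples: "set (triples d lam mu) = {(e, \<nu>, \<gamma>). (e, \<nu>) \<in> set (blocks d mu) \<and> \<gamma> \<in> {1..lam e}}"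
  by (force simp: triples_def set_blocks atLeastLessThanSuc_atLeastAtMost simp del: upt_Suc)

lemma sum_list_upt: "(\<Sum>e\<leftarrow>[Suc 0..<Suc d]. f e) = (\<Sum>e = Suc 0..d. f e)"
  by (simp add: sum_list_distinct_conv_sum_set atLeastLessThanSuc_atLeastAtMost del: upt_Suc)

lemma distinct_blocks: "distinct (blocks d mu)"
proof (rule card_distinct)
  have "length (blocks d mu) = (\<Sum>e = 1..d. mu e)"
    by (simp add: blocks_def length_concat o_def sum_list_upt del: upt_Suc)
  then show "card (set (blocks d mu)) = length (blocks d mu)"
    by (simp add: set_blocks)
qed

lemma length_triples: "length (triples d lam mu) = weight d lam mu"
  by (simp add: triples_def weight_def length_concat o_def
      sum_list_upt sum_list_triv del: upt_Suc)

lemma distinct_triples: "distinct (triples d lam mu)"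
proof (rule card_distinct)
  have "set (triples d lam mu) = (SIGMA e:{1..d}. {1..mu e} \<times> {1..lam e})"
    by (auto simp: set_triples set_blocks)
  then show "card (set (triples d lam mu)) = length (triples d lam mu)"
    by (simp add: length_triples weight_def)
qed

lemma triple_bij: "bij_betw (triple d lam mu) {1..weight d lam mu} (set (triples d lam mu))"
proof -
  have "bij_betw (\<lambda>t. t - 1) {1..weight d lam mu} {..<weight d lam mu}"
    by (rule bij_betw_byWitness [where f' = Suc]) auto
  then have "bij_betw ((\<lambda>t. triples d lam mu ! t) \<circ> (\<lambda>t. t - 1)) {1..weight d lam mu} (set (triples d lam mu))"
    by (rule bij_betw_trans) (intro bij_betw_nth; simp add: distinct_triples length_triples)
  then show ?thesis
    by (simp add: triple_def [abs_def] o_def)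
qed

definition block_positions :: "nat \<Rightarrow> (nat \<Rightarrow> nat) \<Rightarrow> (nat \<Rightarrow> nat) \<Rightarrow> nat \<times> nat \<Rightarrow> nat set" where
  "block_positions d lam mu b = {t \<in> {1..weight d lam mu}. block_of (triple d lam mu t) = b}"

text \<open>
  The monomial of the formula ranges over \<open>\<gamma>\<close>, whereas permutations act on positions; this equation
  translates between the two.
\<close>

lemma triple_image_block_positions:
  assumes "(e, \<nu>) \<in> set (blocks d mu)"
  shows "triple d lam mu ` block_positions d lam mu (e, \<nu>) = (\<lambda>\<gamma>. (e, \<nu>, \<gamma>)) ` {1..lam e}"
proof (intro equalityI subsetI)
  fix x assume "x \<in> triple d lam mu ` block_positions d lam mu (e, \<nu>)"
  then obtain t where t: "t \<in> {1..weight d lam mu}" "x = triple d lam mu t" "block_of x = (e, \<nu>)"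
    by (auto simp: block_positions_def)
  then have "x \<in> set (triples d lam mu)"
    using triple_bij bij_betwE by blast
  then show "x \<in> (\<lambda>\<gamma>. (e, \<nu>, \<gamma>)) ` {1..lam e}"
    using t(3) by (auto simp: set_triples block_of_def)
next
  fix x assume x: "x \<in> (\<lambda>\<gamma>. (e, \<nu>, \<gamma>)) ` {1..lam e}"
  then have "x \<in> set (triples d lam mu)"
    using assms by (auto simp: set_triples)
  then obtain t where "t \<in> {1..weight d lam mu}" "x = triple d lam mu t"
    using triple_bij [of d lam mu] by (metis bij_betw_imp_surj_on imageE)
  then show "x \<in> triple d lam mu ` block_positions d lam mu (e, \<nu>)"
    using x by (auto simp: block_positions_def block_of_def)
qed

lemma card_block_positions:
  assumes "b \<in> set (blocks d mu)"
  shows "card (block_positions d lam mu b) = lam (fst b)"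
proof -
  obtain e \<nu> where b: "b = (e, \<nu>)" by fastforce
  have "inj_on (triple d lam mu) (block_positions d lam mu b)"
    using triple_bij by (rule inj_on_subset [OF bij_betw_imp_inj_on]) (auto simp: block_positions_def)
  then have "card (block_positions d lam mu b) = card (triple d lam mu ` block_positions d lam mu b)"
    by (simp add: card_image)
  also have "\<dots> = lam e"
    unfolding b by (subst triple_image_block_positions) (use assms b in \<open>auto simp: card_image inj_on_def\<close>)
  finally show ?thesis by (simp add: b)
qed

lemma UN_block_positions:
  "(\<Union>b\<in>set (blocks d mu). block_positions d lam mu b) = {1..weight d lam mu}"
proof (intro equalityI subsetI)
  fix t assume t: "t \<in> {1..weight d lam mu}"
  then have "triple d lam mu t \<in> set (triples d lam mu)"
    using triple_bij bij_betwE by blast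
  then show "t \<in> (\<Union>b\<in>set (blocks d mu). block_positions d lam mu b)"
    using t by (auto simp: set_triples block_positions_def block_of_def)
qed (auto simp: block_positions_def)

definition block_sizes :: "('a set \<times> 'm) set \<Rightarrow> nat multiset" where
  "block_sizes S = image_mset (card \<circ> fst) (mset_set S)"

definition type_sizes :: "nat \<Rightarrow> (nat \<Rightarrow> nat) \<Rightarrow> (nat \<Rightarrow> nat) \<Rightarrow> nat multiset" where
  "type_sizes d lam mu = (\<Sum>e = 1..d. replicate_mset (mu e) (lam e))"

lemma image_mset_blocks:
  "image_mset (\<lambda>b. lam (fst b)) (mset_set (set (blocks d mu))) = type_sizes d lam mu"
proof -
  have "image_mset (\<lambda>b. lam (fst b)) (mset (blocks d mu)) =
      (\<Sum>e\<leftarrow>[1..<d + 1]. replicate_mset (mu e) (lam e))"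
    by (induction d) (simp_all add: blocks_def image_mset.compositionality o_def image_mset_const_eq
        del: upt_Suc add: upt_Suc_append)
  then show ?thesis
    by (simp add: type_sizes_def mset_set_set distinct_blocks sum_list_upt del: upt_Suc)
qed

text \<open>The multiplicities \<open>\<mu>\<close> can be read off from the multiset of block sizes if the \<open>\<lambda>\<close> are distinct.\<close>

lemma count_type_sizes:
  assumes "inj_on lam {1..d}"
  shows "e \<in> {1..d} \<Longrightarrow> count (type_sizes d lam mu) (lam e) = mu e"
    and "r \<notin> lam ` {1..d} \<Longrightarrow> count (type_sizes d lam mu) r = 0"
proof -
  have c: "count (type_sizes d lam mu) r = (\<Sum>e' = 1..d. if lam e' = r then mu e' else 0)" for r
    by (auto simp: type_sizes_def count_sum intro!: sum.cong)
  show "count (type_sizes d lam mu) (lam e) = mu e" if e: "e \<in> {1..d}"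
  proof -
    have "count (type_sizes d lam mu) (lam e) = (\<Sum>e' = 1..d. if e' = e then mu e' else 0)"
      unfolding c using assms e by (intro sum.cong) (auto dest: inj_onD)
    then show ?thesis using e by simp
  qed
  show "count (type_sizes d lam mu) r = 0" if "r \<notin> lam ` {1..d}"
    unfolding c using that by (intro sum.neutral) auto
qed

lemma sum_mset_type_sizes: "sum_mset (type_sizes d lam mu) = weight d lam mu"
  by (simp add: type_sizes_def weight_def)
     (induction d; simp)

text \<open>The index set of the three outer sums of the formula.\<close>

definition block_types :: "nat \<Rightarrow> (nat \<times> (nat \<Rightarrow> nat) \<times> (nat \<Rightarrow> nat)) set" where
  "block_types \<kappa> = (SIGMA d:{1..\<kappa> + 1}. SIGMA lam:lam_tuples \<kappa> d. mu_tuples \<kappa> d lam)"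

lemma finite_block_types: "finite (block_types \<kappa>)"
  unfolding block_types_def by (intro finite_SigmaI finite_lam_tuples finite_mu_tuples) auto

text \<open>
  Conversely, \<open>d\<close> is the number of distinct elements of \<open>M\<close>, the tuple \<open>\<lambda>\<close> lists them in increasing
  order and \<open>\<mu>\<close> lists their multiplicities. The bound \<open>d \<le> \<kappa> + 1\<close> holds because each
  distinct size contributes at least 1 to the sum of \<open>M\<close>.
\<close>

lemma type_sizes_bij:
  "bij_betw (\<lambda>(d, lam, mu). type_sizes d lam mu) (block_types \<kappa>)
    {M. M \<noteq> {#} \<and> set_mset M \<subseteq> {1..\<kappa>} \<and> sum_mset M \<le> \<kappa> + 1}"
proof (rule bij_betw_imageI)
  have setm: "set_mset (type_sizes d lam mu) = lam ` {1..d}"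
    if "(d, lam, mu) \<in> block_types \<kappa>" for d lam mu
  proof -
    have inj: "inj_on lam {1..d}"
      using that by (auto simp: block_types_def lam_tuples_def intro: strict_mono_on_imp_inj_on)
    have mu: "mu e > 0" if "e \<in> {1..d}" for e
    proof -
      have "mu \<in> {1..d} \<rightarrow>\<^sub>E {1..}"
        using \<open>(d, lam, mu) \<in> block_types \<kappa>\<close> by (simp add: block_types_def mu_tuples_def)
      then have "mu e \<in> {1..}" using that by (rule PiE_mem)
      then show ?thesis by simp
    qed
    show ?thesis
    proof (rule set_eqI)
      fix r show "r \<in># type_sizes d lam mu \<longleftrightarrow> r \<in> lam ` {1..d}"
      proof (cases "r \<in> lam ` {1..d}")
        case True
        then obtain e where e: "e \<in> {1..d}" "r = lam e" by blast
        then have "count (type_sizes d lam mu) r > 0"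
          using count_type_sizes(1) [OF inj e(1), of mu] mu [OF e(1)] by simp
        then show ?thesis using True by simp
      next
        case False
        then show ?thesis
          using count_type_sizes(2) [OF inj False, of mu] by (simp add: count_eq_zero_iff)
      qed
    qed
  qed
  show "inj_on (\<lambda>(d, lam, mu). type_sizes d lam mu) (block_types \<kappa>)"
  proof (rule inj_onI)
    fix z z' assume z: "z \<in> block_types \<kappa>" "z' \<in> block_types \<kappa>"
      "(case z of (d, lam, mu) \<Rightarrow> type_sizes d lam mu) = (case z' of (d, lam, mu) \<Rightarrow> type_sizes d lam mu)"
    obtain d lam mu d' lam' mu' where zd: "z = (d, lam, mu)" "z' = (d', lam', mu')"
      by (metis prod_cases3)
    have t: "(d, lam, mu) \<in> block_types \<kappa>" "(d', lam', mu') \<in> block_types \<kappa>"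
      and eq: "type_sizes d lam mu = type_sizes d' lam' mu'"
      using z by (simp_all add: zd)
    have M: "strict_mono_on {1..d} lam" "strict_mono_on {1..d'} lam'"
      "lam \<in> extensional {1..d}" "lam' \<in> extensional {1..d'}"
      "mu \<in> extensional {1..d}" "mu' \<in> extensional {1..d'}"
      using t by (auto simp: block_types_def lam_tuples_def mu_tuples_def PiE_def)
    note inj = M(1,2) [THEN strict_mono_on_imp_inj_on]
    have img: "lam ` {1..d} = lam' ` {1..d'}"
      using setm [OF t(1)] setm [OF t(2)] eq by simp
    then have d: "d = d'"
      using card_image [OF inj(1)] card_image [OF inj(2)] by simp
    have l: "lam = lam'"
      using M strict_mono_on_nat_image_eq [OF M(1), of lam'] img unfolding d
      by (intro extensionalityI [of _ "{1..d'}"]) auto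
    have "mu e = mu' e" if "e \<in> {1..d}" for e
      using count_type_sizes(1) [OF inj(1) that, of mu] count_type_sizes(1) [OF inj(2), of e mu'] that
        eq l d by simp
    then have "mu = mu'"
      using M d by (intro extensionalityI [of _ "{1..d}"]) auto
    then show "z = z'"
      using d l by (simp add: zd)
  qed
  show "(\<lambda>(d, lam, mu). type_sizes d lam mu) ` block_types \<kappa> =
      {M. M \<noteq> {#} \<and> set_mset M \<subseteq> {1..\<kappa>} \<and> sum_mset M \<le> \<kappa> + 1}"
  proof (intro equalityI subsetI)
    fix M assume "M \<in> (\<lambda>(d, lam, mu). type_sizes d lam mu) ` block_types \<kappa>"
    then obtain d lam mu where t: "(d, lam, mu) \<in> block_types \<kappa>" and M: "M = type_sizes d lam mu"
      by auto
    then have "lam ` {1..d} \<subseteq> {1..\<kappa>}" "d \<ge> 1"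
      by (auto simp: block_types_def lam_tuples_def PiE_iff)
    then have "set_mset (type_sizes d lam mu) \<subseteq> {1..\<kappa>}" "set_mset (type_sizes d lam mu) \<noteq> {}"
      using setm [OF t] by auto
    moreover have "sum_mset (type_sizes d lam mu) \<le> \<kappa> + 1"
      using t by (simp add: sum_mset_type_sizes block_types_def mu_tuples_def)
    ultimately show "M \<in> {M. M \<noteq> {#} \<and> set_mset M \<subseteq> {1..\<kappa>} \<and> sum_mset M \<le> \<kappa> + 1}"
      unfolding M by auto
  next
    fix M assume "M \<in> {M. M \<noteq> {#} \<and> set_mset M \<subseteq> {1..\<kappa>} \<and> sum_mset M \<le> \<kappa> + 1}"
    then have M: "M \<noteq> {#}" "set_mset M \<subseteq> {1..\<kappa>}" "sum_mset M \<le> \<kappa> + 1" by auto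
    define d where "d = card (set_mset M)"
    obtain h where h: "strict_mono_on {1..d} h" "h ` {1..d} = set_mset M"
      unfolding d_def using ex_strict_mono_on_enumeration [of "set_mset M"] by auto
    define lam where "lam = restrict h {1..d}"
    define mu where "mu = restrict (\<lambda>e. count M (h e)) {1..d}"
    have lam: "lam \<in> lam_tuples \<kappa> d"
      using h M by (auto simp: lam_tuples_def lam_def strict_mono_on_def)
    have inj: "inj_on lam {1..d}"
      using lam by (auto simp: lam_tuples_def intro: strict_mono_on_imp_inj_on)
    have eq: "type_sizes d lam mu = M"
    proof (rule multiset_eqI)
      fix r show "count (type_sizes d lam mu) r = count M r"
      proof (cases "r \<in> lam ` {1..d}")
        case True
        then obtain e where e: "e \<in> {1..d}" "r = lam e" by blast
        then show ?thesis
          using count_type_sizes(1) [OF inj e(1), of mu] by (simp add: mu_def lam_def)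
      next
        case False
        moreover have "lam ` {1..d} = set_mset M"
          using h(2) by (auto simp: lam_def)
        ultimately show ?thesis
          using count_type_sizes(2) [OF inj False] by (metis count_inI)
      qed
    qed
    have w: "weight d lam mu = sum_mset M"
      using sum_mset_type_sizes [of d lam mu] eq by simp
    have mu1: "mu e \<ge> 1" if "e \<in> {1..d}" for e
    proof -
      have "h e \<in># M" using h(2) that by blast
      then show ?thesis using that by (simp add: mu_def Suc_le_eq)
    qed
    then have mu: "mu \<in> mu_tuples \<kappa> d lam"
      using M(3) w by (auto simp: mu_tuples_def mu_def PiE_iff)
    have d1: "d \<ge> 1"
      using M(1) by (simp add: d_def Suc_le_eq card_gt_0_iff)
    have "d = (\<Sum>e = 1..d. 1)" by simp
    also have "\<dots> \<le> weight d lam mu"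
      unfolding weight_def
    proof (rule sum_mono)
      fix e assume e: "e \<in> {1..d}"
      then have "lam e \<ge> 1" using lam by (auto simp: lam_tuples_def PiE_iff)
      then show "1 \<le> mu e * lam e" using mu1 [OF e] by simp
    qed
    finally have "d \<le> \<kappa> + 1" using M(3) w by simp
    then have "(d, lam, mu) \<in> block_types \<kappa>"
      using d1 lam mu by (simp add: block_types_def)
    then show "M \<in> (\<lambda>(d, lam, mu). type_sizes d lam mu) ` block_types \<kappa>"
      using eq by force
  qed
qed

section \<open>Permutations modulo the stabilizer and families of blocks\<close>

lemma image_mset_eq_obtain_bij:
  assumes "finite A" "finite B"
    and eq: "image_mset f (mset_set A) = image_mset g (mset_set B)"
  obtains \<theta> where "bij_betw \<theta> A B" "\<And>a. a \<in> A \<Longrightarrow> g (\<theta> a) = f a"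
proof -
  have "card A = card B"
    using arg_cong [OF eq, of size] by simp
  then obtain \<phi> where \<phi>: "bij_betw \<phi> A B"
    using finite_same_card_bij [OF assms(1,2)] by blast
  have "image_mset f (mset_set A) = image_mset (\<lambda>a. g (\<phi> a)) (mset_set A)"
    using eq \<phi> image_mset_mset_set [of \<phi> A]
    by (simp add: bij_betw_def flip: image_mset.compositionality [unfolded o_def])
  then obtain p where p: "p permutes A" "\<forall>a\<in>A. f a = g (\<phi> (p a))"
    using image_mset_eq_implies_permutes [OF assms(1)] by blast
  show thesis
  proof (rule that)
    show "bij_betw (\<phi> \<circ> p) A B"
      using permutes_imp_bij [OF p(1)] \<phi> by (rule bij_betw_trans)
  qed (use p in auto)
qed

text \<open>
  The block \<open>b\<close> is moved to \<open>\<rho> ` (\<sigma> -` P b)\<close>: the place \<open>t\<close> carries the element \<open>\<rho> t\<close> and goes to the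
  block that contains \<open>\<sigma> t\<close>. The inverse image appears because the Kronecker symbols of the
  formula equate the index at \<open>\<tau> t\<close> with \<open>k\<close> at \<open>\<sigma> t\<close>.
\<close>

definition place :: "'b set \<Rightarrow> ('b \<Rightarrow> 'w set) \<Rightarrow> ('w \<Rightarrow> 'a) \<Rightarrow> ('w \<Rightarrow> 'w) \<Rightarrow> ('b \<Rightarrow> 'm) \<Rightarrow> ('a set \<times> 'm) set" where
  "place I P \<rho> \<sigma> l = (\<lambda>b. (\<rho> ` (\<sigma> -` P b), l b)) ` I"

locale block_family =
  fixes I :: "'b set" and P :: "'b \<Rightarrow> 'w set" and W :: "'w set"
  assumes finite_I: "finite I" and finite_W: "finite W"
    and W: "W = (\<Union>b\<in>I. P b)"
    and nonempty: "b \<in> I \<Longrightarrow> P b \<noteq> {}"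
    and disjoint: "b \<in> I \<Longrightarrow> c \<in> I \<Longrightarrow> b \<noteq> c \<Longrightarrow> P b \<inter> P c = {}"
begin

lemma P_subset: "b \<in> I \<Longrightarrow> P b \<subseteq> W"
  using W by blast

lemma P_finite: "b \<in> I \<Longrightarrow> finite (P b)"
  using P_subset finite_W finite_subset by blast

lemma P_eqD: "b \<in> I \<Longrightarrow> c \<in> I \<Longrightarrow> P b = P c \<Longrightarrow> b = c"
  using nonempty disjoint by (metis inf.idem)

lemma vimage_subset:
  assumes "\<sigma> permutes W" "b \<in> I"
  shows "\<sigma> -` P b \<subseteq> W"
  using assms P_subset permutes_in_image [OF assms(1)] by blast

lemma place_inj:
  assumes "inj_on \<rho> W" "\<sigma> permutes W"
  shows "inj_on (\<lambda>b. (\<rho> ` (\<sigma> -` P b), l b)) I"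
proof (rule inj_onI)
  fix b c assume b: "b \<in> I" "c \<in> I" "(\<rho> ` (\<sigma> -` P b), l b) = (\<rho> ` (\<sigma> -` P c), l c)"
  then have "\<rho> ` (\<sigma> -` P b) = \<rho> ` (\<sigma> -` P c)" by simp
  then have "\<sigma> -` P b = \<sigma> -` P c"
    using inj_on_image_eq_iff [OF assms(1) vimage_subset [OF assms(2) b(1)] vimage_subset [OF assms(2) b(2)]]
    by simp
  then have "P b = P c"
    using surj_image_vimage_eq [OF permutes_surj [OF assms(2)]] by metis
  then show "b = c" using P_eqD b by blast
qed

lemma support_place:
  assumes "\<sigma> permutes W"
  shows "support (place I P \<rho> \<sigma> l) = \<rho> ` W"
proof -
  have "\<sigma> -` W = W"
    using permutes_vimage [OF assms] .
  moreover have "\<sigma> -` W = (\<Union>b\<in>I. \<sigma> -` P b)"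
    unfolding W by (rule vimage_UN)
  ultimately have "(\<Union>b\<in>I. \<sigma> -` P b) = W" by simp
  then show ?thesis
    unfolding support_def place_def by auto
qed

lemma place_in:
  assumes "inj_on \<rho> W" "\<sigma> permutes W"
  shows "place I P \<rho> \<sigma> l \<in> labelled_partitions (\<rho> ` W)"
proof (rule labelled_partitionsI)
  fix c l' assume "(c, l') \<in> place I P \<rho> \<sigma> l"
  then obtain b where b: "b \<in> I" "c = \<rho> ` (\<sigma> -` P b)" by (auto simp: place_def)
  have "\<sigma> -` P b \<noteq> {}"
    using nonempty [OF b(1)] permutes_surj [OF assms(2)] by (metis image_empty surj_image_vimage_eq)
  then show "c \<subseteq> \<rho> ` W \<and> c \<noteq> {}"
    using b vimage_subset [OF assms(2) b(1)] by auto
next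
  fix x y assume "x \<in> place I P \<rho> \<sigma> l" "y \<in> place I P \<rho> \<sigma> l" "x \<noteq> y"
  then obtain b c where bc: "b \<in> I" "c \<in> I" "x = (\<rho> ` (\<sigma> -` P b), l b)" "y = (\<rho> ` (\<sigma> -` P c), l c)"
    by (auto simp: place_def)
  with \<open>x \<noteq> y\<close> have "P b \<inter> P c = {}" by (intro disjoint) auto
  then have "\<sigma> -` P b \<inter> \<sigma> -` P c = {}" by blast
  then show "fst x \<inter> fst y = {}"
    using bc inj_on_image_Int [OF assms(1) vimage_subset [OF assms(2) bc(1)] vimage_subset [OF assms(2) bc(2)]]
    by simp
qed

lemma card_placed_block:
  assumes "inj_on \<rho> W" "\<sigma> permutes W" "b \<in> I"
  shows "card (\<rho> ` (\<sigma> -` P b)) = card (P b)"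
proof -
  have "card (\<rho> ` (\<sigma> -` P b)) = card (\<sigma> -` P b)"
    using inj_on_subset [OF assms(1) vimage_subset [OF assms(2,3)]] by (rule card_image)
  also have "\<dots> = card (P b)"
    using card_vimage_inj [OF permutes_inj [OF assms(2)], of "P b"] permutes_surj [OF assms(2)] by simp
  finally show ?thesis .
qed

lemma block_sizes_place:
  assumes "inj_on \<rho> W" "\<sigma> permutes W"
  shows "block_sizes (place I P \<rho> \<sigma> l) = image_mset (\<lambda>b. card (P b)) (mset_set I)"
proof -
  have "block_sizes (place I P \<rho> \<sigma> l) =
      image_mset (card \<circ> fst \<circ> (\<lambda>b. (\<rho> ` (\<sigma> -` P b), l b))) (mset_set I)"
    unfolding block_sizes_def place_def
    by (simp add: image_mset_mset_set [OF place_inj [OF assms], symmetric] image_mset.compositionality o_assoc)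
  also have "\<dots> = image_mset (\<lambda>b. card (P b)) (mset_set I)"
    using card_placed_block [OF assms] finite_I by (intro image_mset_cong) simp
  finally show ?thesis .
qed

text \<open>
  Bijections from each standard block onto the prescribed block of the same size glue to a bijection
  of \<open>W\<close>; its inverse is the permutation wanted.
\<close>

lemma surj_place_permutation:
  assumes "inj_on \<rho> W" and S: "S \<in> labelled_partitions (\<rho> ` W)"
    and g: "bij_betw g I S" and c: "\<And>b. b \<in> I \<Longrightarrow> card (fst (g b)) = card (P b)"
  obtains \<sigma> where "\<sigma> permutes W" "\<And>b. b \<in> I \<Longrightarrow> \<rho> ` (\<sigma> -` P b) = fst (g b)"
proof -
  have gS: "g b \<in> S" if "b \<in> I" for b
    using g that bij_betwE by blast
  have sub: "fst (g b) \<subseteq> \<rho> ` W" if "b \<in> I" for b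
    using labelled_partitionsD(1) [OF S gS [OF that]] .
  have "\<exists>\<psi>. bij_betw \<psi> (P b) (fst (g b))" if "b \<in> I" for b
    using that c [OF that] P_finite [OF that] sub [OF that] finite_W
    by (intro finite_same_card_bij) (auto intro: finite_subset)
  then obtain \<psi> where \<psi>: "\<And>b. b \<in> I \<Longrightarrow> bij_betw (\<psi> b) (P b) (fst (g b))"
    by metis
  define blk where "blk w = (THE b. b \<in> I \<and> w \<in> P b)" for w
  have blk: "blk w = b" if "b \<in> I" "w \<in> P b" for w b
    unfolding blk_def using that disjoint by (intro the_equality) auto
  \<comment> \<open>\<open>\<tau>\<close> sends the standard block \<open>P b\<close> to the places that \<open>\<rho>\<close> maps onto the block of \<open>g b\<close>.\<close>
  define \<tau> where "\<tau> w = (if w \<in> W then inv_into W \<rho> (\<psi> (blk w) w) else w)" for w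
  have \<rho>\<tau>: "\<rho> (\<tau> w) = \<psi> b w" "\<tau> w \<in> W" if "b \<in> I" "w \<in> P b" for b w
  proof -
    have "\<psi> b w \<in> \<rho> ` W"
      using sub [OF that(1)] bij_betwE [OF \<psi> [OF that(1)]] that(2) by blast
    moreover have "w \<in> W" using that P_subset by blast
    ultimately show "\<rho> (\<tau> w) = \<psi> b w" "\<tau> w \<in> W"
      using blk [OF that] by (auto simp: \<tau>_def f_inv_into_f inv_into_into)
  qed
  have "inj_on \<tau> W"
  proof (rule inj_onI)
    fix v w assume vw: "v \<in> W" "w \<in> W" "\<tau> v = \<tau> w"
    then obtain b c where b: "b \<in> I" "v \<in> P b" and c: "c \<in> I" "w \<in> P c"
      unfolding W by blast
    have eq: "\<psi> b v = \<psi> c w"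
      using \<rho>\<tau>(1) [OF b] \<rho>\<tau>(1) [OF c] vw(3) by simp
    moreover have "\<psi> b v \<in> fst (g b)" "\<psi> c w \<in> fst (g c)"
      using bij_betwE [OF \<psi>] b c by blast+
    ultimately have "g b = g c"
      using labelled_partitions_eqI [OF S gS [OF b(1)] gS [OF c(1)]] by metis
    then have "b = c"
      using g b c by (meson bij_betw_imp_inj_on inj_onD)
    then show "v = w"
      using eq b c \<psi> [OF b(1)] by (meson bij_betw_imp_inj_on inj_onD)
  qed
  moreover have "\<tau> ` W \<subseteq> W"
    using \<rho>\<tau>(2) W by blast
  ultimately have "bij_betw \<tau> W W"
    using finite_W by (simp add: bij_betw_def endo_inj_surj)
  then have \<tau>: "\<tau> permutes W"
    by (rule bij_imp_permutes) (simp add: \<tau>_def)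
  show thesis
  proof (rule that)
    show "inv \<tau> permutes W" using permutes_inv [OF \<tau>] .
    fix b assume b: "b \<in> I"
    have "inv \<tau> -` P b = \<tau> ` P b"
      using bij_vimage_eq_inv_image [OF permutes_bij [OF permutes_inv [OF \<tau>]]]
      by (simp add: permutes_inv_inv [OF \<tau>])
    then have "\<rho> ` (inv \<tau> -` P b) = \<psi> b ` P b"
      using \<rho>\<tau>(1) [OF b] by (simp add: image_image)
    then show "\<rho> ` (inv \<tau> -` P b) = fst (g b)"
      using \<psi> [OF b] by (simp add: bij_betw_def)
  qed
qed

text \<open>A permutation that preserves the set of blocks permutes the blocks by some \<open>\<pi>\<close>.\<close>

lemma vimage_stabilizer:
  assumes h: "h permutes W" "(\<lambda>b. h ` P b) ` I = P ` I"
  obtains \<pi> where "\<pi> ` I = I" "\<And>b. b \<in> I \<Longrightarrow> h -` P b = P (\<pi> b)"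
proof -
  have "\<exists>c. c \<in> I \<and> h -` P b = P c" if "b \<in> I" for b
  proof -
    have "P b \<in> (\<lambda>b. h ` P b) ` I" using h(2) that by auto
    then obtain c where "c \<in> I" "P b = h ` P c" by auto
    then show ?thesis
      using inj_vimage_image_eq [OF permutes_inj [OF h(1)]] by auto
  qed
  then obtain \<pi> where \<pi>: "\<And>b. b \<in> I \<Longrightarrow> \<pi> b \<in> I" "\<And>b. b \<in> I \<Longrightarrow> h -` P b = P (\<pi> b)"
    by metis
  have "c \<in> \<pi> ` I" if c: "c \<in> I" for c
  proof -
    have "h ` P c \<in> P ` I" using h(2) c by auto
    then obtain b where b: "b \<in> I" "h ` P c = P b" by auto
    then have "h -` P b = P c"
      using inj_vimage_image_eq [OF permutes_inj [OF h(1)]] by metis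
    then have "\<pi> b = c" using \<pi> b(1) c P_eqD by metis
    then show ?thesis using b(1) by blast
  qed
  then have "\<pi> ` I = I" using \<pi>(1) by auto
  then show thesis using that \<pi>(2) by blast
qed

text \<open>
  The hypotheses on \<open>F\<close> say that it represents the cosets of the stabilizer of \<open>P ` I\<close>, acting by
  composition on the left. If \<open>\<sigma>\<close> and \<open>\<sigma>'\<close> place the same blocks, then \<open>\<sigma>' \<circ> inv \<sigma>\<close> lies in that stabilizer,
  so \<open>\<sigma> = \<sigma>'\<close>, and then the labels agree too. Every family of the right sizes is placed by some permutation,
  and passing to the representative of its coset only renames the standard blocks, which can be
  absorbed in the labels.
\<close>

lemma place_bij:
  fixes \<rho> :: "'w \<Rightarrow> 'a" and F :: "('w \<Rightarrow> 'w) set"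
  assumes \<rho>: "inj_on \<rho> W"
    and F: "\<And>\<sigma>. \<sigma> \<in> F \<Longrightarrow> \<sigma> permutes W"
    and uniq: "\<And>\<sigma> h. \<sigma> \<in> F \<Longrightarrow> h permutes W \<Longrightarrow> (\<lambda>b. h ` P b) ` I = P ` I \<Longrightarrow> h \<circ> \<sigma> \<in> F \<Longrightarrow> h \<circ> \<sigma> = \<sigma>"
    and ex: "\<And>\<sigma>. \<sigma> permutes W \<Longrightarrow> \<exists>h. h permutes W \<and> (\<lambda>b. h ` P b) ` I = P ` I \<and> h \<circ> \<sigma> \<in> F"
  shows "bij_betw (\<lambda>(\<sigma>, l). place I P \<rho> \<sigma> l) (F \<times> (I \<rightarrow>\<^sub>E (UNIV :: 'm::finite set)))
    {S \<in> labelled_partitions (\<rho> ` W). support S = \<rho> ` W \<and>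
      block_sizes S = image_mset (\<lambda>b. card (P b)) (mset_set I)}"
    (is "bij_betw _ ?D ?R")
proof (rule bij_betw_imageI)
  show "inj_on (\<lambda>(\<sigma>, l). place I P \<rho> \<sigma> l) ?D"
  proof (rule inj_onI)
    fix z z' assume z: "z \<in> ?D" "z' \<in> ?D"
      "(case z of (\<sigma>, l) \<Rightarrow> place I P \<rho> \<sigma> l) = (case z' of (\<sigma>, l) \<Rightarrow> place I P \<rho> \<sigma> l)"
    obtain \<sigma> l \<sigma>' l' where zd: "z = (\<sigma>, l)" "z' = (\<sigma>', l')" by (metis surj_pair)
    have FF: "\<sigma> \<in> F" "\<sigma>' \<in> F" and l: "l \<in> extensional I" "l' \<in> extensional I"
      and eq: "place I P \<rho> \<sigma> l = place I P \<rho> \<sigma>' l'"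
      using z by (auto simp: zd PiE_def)
    note perm = F [OF FF(1)] F [OF FF(2)]
    have "fst ` place I P \<rho> \<sigma> l = fst ` place I P \<rho> \<sigma>' l'" using eq by simp
    then have "(\<lambda>X. \<rho> ` X) ` ((\<lambda>b. \<sigma> -` P b) ` I) = (\<lambda>X. \<rho> ` X) ` ((\<lambda>b. \<sigma>' -` P b) ` I)"
      by (simp add: place_def image_image)
    moreover have "(\<lambda>b. \<sigma> -` P b) ` I \<subseteq> Pow W"
      by (intro image_subsetI PowI vimage_subset perm)
    moreover have "(\<lambda>b. \<sigma>' -` P b) ` I \<subseteq> Pow W"
      by (intro image_subsetI PowI vimage_subset perm)
    ultimately have eqv: "(\<lambda>b. \<sigma> -` P b) ` I = (\<lambda>b. \<sigma>' -` P b) ` I"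
      by (simp add: inj_on_image_eq_iff [OF inj_on_image_Pow [OF \<rho>]])
    define h where "h = \<sigma>' \<circ> inv \<sigma>"
    have h: "h permutes W"
      unfolding h_def using perm by (intro permutes_compose permutes_inv)
    have "h ` P b = \<sigma>' ` (\<sigma> -` P b)" for b
      unfolding h_def using bij_vimage_eq_inv_image [OF permutes_bij [OF perm(1)]]
      by (simp add: image_comp)
    then have "(\<lambda>b. h ` P b) ` I = (\<lambda>X. \<sigma>' ` X) ` ((\<lambda>b. \<sigma> -` P b) ` I)"
      by (simp add: image_image)
    also have "\<dots> = (\<lambda>b. \<sigma>' ` (\<sigma>' -` P b)) ` I"
      unfolding eqv by (simp add: image_image)
    also have "\<dots> = P ` I"
      using surj_image_vimage_eq [OF permutes_surj [OF perm(2)]] by simp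
    finally have hI: "(\<lambda>b. h ` P b) ` I = P ` I" .
    have "h \<circ> \<sigma> = \<sigma>'"
      unfolding h_def using permutes_inv_o [OF perm(1)] by (simp add: comp_assoc)
    then have s: "\<sigma>' = \<sigma>"
      using uniq [OF FF(1) h hI] FF(2) by simp
    have "l b = l' b" if b: "b \<in> I" for b
    proof -
      have "(\<rho> ` (\<sigma> -` P b), l b) \<in> place I P \<rho> \<sigma> l'"
        using eq b unfolding s place_def by blast
      then obtain c where c: "c \<in> I" "\<rho> ` (\<sigma> -` P b) = \<rho> ` (\<sigma> -` P c)" "l b = l' c"
        by (auto simp: place_def)
      then have "b = c"
        using b by (intro inj_onD [OF place_inj [OF \<rho> perm(1), of "\<lambda>_. ()"]]) simp_all
      then show ?thesis using c by simp
    qed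
    then have "l = l'" using l by (intro extensionalityI)
    then show "z = z'" by (simp add: zd s)
  qed
  show "(\<lambda>(\<sigma>, l). place I P \<rho> \<sigma> l) ` ?D = ?R"
  proof (intro equalityI subsetI)
    fix S assume "S \<in> (\<lambda>(\<sigma>, l). place I P \<rho> \<sigma> l) ` ?D"
    then obtain \<sigma> l where \<sigma>: "\<sigma> \<in> F" and S: "S = place I P \<rho> \<sigma> l" by auto
    show "S \<in> ?R"
      unfolding S by (simp add: place_in [OF \<rho> F [OF \<sigma>]] support_place [OF F [OF \<sigma>]]
          block_sizes_place [OF \<rho> F [OF \<sigma>]])
  next
    fix S assume "S \<in> ?R"
    then have S: "S \<in> labelled_partitions (\<rho> ` W)" "support S = \<rho> ` W"
      and sizes: "image_mset (\<lambda>b. card (P b)) (mset_set I) = image_mset (card \<circ> fst) (mset_set S)"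
      by (auto simp: block_sizes_def)
    have "finite S" using labelled_partitions_finite S(1) finite_W by blast
    then obtain g where g: "bij_betw g I S" "\<And>b. b \<in> I \<Longrightarrow> card (fst (g b)) = card (P b)"
      using image_mset_eq_obtain_bij [OF finite_I _ sizes] by (metis comp_apply)
    obtain \<sigma> where \<sigma>: "\<sigma> permutes W" "\<And>b. b \<in> I \<Longrightarrow> \<rho> ` (\<sigma> -` P b) = fst (g b)"
      using surj_place_permutation [OF \<rho> S(1) g] by blast
    obtain h where h: "h permutes W" "(\<lambda>b. h ` P b) ` I = P ` I" "h \<circ> \<sigma> \<in> F"
      using ex [OF \<sigma>(1)] by blast
    obtain \<pi> where \<pi>: "\<pi> ` I = I" "\<And>b. b \<in> I \<Longrightarrow> h -` P b = P (\<pi> b)"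
      using vimage_stabilizer [OF h(1,2)] by blast
    define l where "l = restrict (\<lambda>b. snd (g (\<pi> b))) I"
    have "(\<rho> ` ((h \<circ> \<sigma>) -` P b), l b) = g (\<pi> b)" if b: "b \<in> I" for b
    proof -
      have "\<pi> b \<in> I" using \<pi>(1) b by blast
      then have "\<rho> ` (\<sigma> -` (h -` P b)) = fst (g (\<pi> b))"
        using \<sigma>(2) \<pi>(2) [OF b] by simp
      then show ?thesis using b by (simp add: l_def vimage_comp [symmetric])
    qed
    then have "place I P \<rho> (h \<circ> \<sigma>) l = (\<lambda>b. g (\<pi> b)) ` I"
      unfolding place_def by (rule image_cong [OF refl])
    also have "\<dots> = g ` (\<pi> ` I)" by (simp add: image_image)
    also have "\<dots> = S" using \<pi>(1) g(1) by (simp add: bij_betw_def)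
    finally have "place I P \<rho> (h \<circ> \<sigma>) l = S" .
    moreover have "l \<in> I \<rightarrow>\<^sub>E UNIV" by (simp add: l_def)
    ultimately show "S \<in> (\<lambda>(\<sigma>, l). place I P \<rho> \<sigma> l) ` ?D"
      using h(3) by (intro image_eqI [of _ _ "(h \<circ> \<sigma>, l)"]) auto
  qed
qed

end

section \<open>The sums belonging to one type\<close>

lemma block_family_blocks:
  assumes "(d, lam, mu) \<in> block_types \<kappa>"
  shows "block_family (set (blocks d mu)) (block_positions d lam mu) {1..weight d lam mu}"
proof
  show "{1..weight d lam mu} = (\<Union>b\<in>set (blocks d mu). block_positions d lam mu b)"
    by (rule UN_block_positions [symmetric])
  show "block_positions d lam mu b \<noteq> {}" if b: "b \<in> set (blocks d mu)" for b
  proof -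
    have "lam (fst b) \<ge> 1"
      using assms b by (auto simp: block_types_def lam_tuples_def PiE_iff set_blocks)
    then show ?thesis
      using card_block_positions [OF b, of lam] by auto
  qed
  show "block_positions d lam mu b \<inter> block_positions d lam mu c = {}" if "b \<noteq> c" for b c
    using that by (auto simp: block_positions_def)
qed auto

text \<open>
  When the indeterminates are the positions themselves, distinct blocks give distinct factors. The
  monomial is then determined by the set of the images of the blocks.
\<close>

lemma monomial_stabilizer_iff:
  assumes t: "(d, lam, mu) \<in> block_types \<kappa>"
  shows "h \<in> monomial_stabilizer d lam mu \<longleftrightarrow> h permutes {1..weight d lam mu} \<and>
    (\<lambda>b. h ` block_positions d lam mu b) ` set (blocks d mu) =
      block_positions d lam mu ` set (blocks d mu)"
proof -
  interpret block_family "set (blocks d mu)" "block_positions d lam mu" "{1..weight d lam mu}"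
    using block_family_blocks [OF t] .
  let ?I = "set (blocks d mu)" and ?P = "block_positions d lam mu"
  have monomial: "jet_monomial d lam mu h = mset_set (mset_set ` ((\<lambda>b. h ` ?P b) ` ?I))"
    if h: "h permutes {1..weight d lam mu}" for h
  proof -
    have "jet_monomial d lam mu h = image_mset (\<lambda>b. image_mset h (mset_set (?P b))) (mset_set ?I)"
      by (simp add: jet_monomial_def block_positions_def mset_set_set distinct_blocks)
    also have "\<dots> = image_mset (\<lambda>b. mset_set (h ` ?P b)) (mset_set ?I)"
      by (intro image_mset_cong image_mset_mset_set inj_on_subset [OF permutes_inj [OF h]]) auto
    also have "\<dots> = mset_set ((\<lambda>b. mset_set (h ` ?P b)) ` ?I)"
    proof (rule image_mset_mset_set, rule inj_onI)
      fix b c assume bc: "b \<in> ?I" "c \<in> ?I" "mset_set (h ` ?P b) = mset_set (h ` ?P c)"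
      then have "h ` ?P b = h ` ?P c" using P_finite by simp
      then have "?P b = ?P c" using permutes_inj [OF h] by (simp add: inj_image_eq_iff)
      then show "b = c" using bc P_eqD by blast
    qed
    finally show ?thesis by (simp add: image_image)
  qed
  have "jet_monomial d lam mu h = jet_monomial d lam mu id \<longleftrightarrow>
      (\<lambda>b. h ` ?P b) ` ?I = ?P ` ?I" if h: "h permutes {1..weight d lam mu}"
  proof -
    have inj: "inj_on mset_set (Collect finite :: nat set set)"
      by (auto intro: inj_onI)
    have "(\<lambda>b. h ` ?P b) ` ?I \<subseteq> Collect finite" "?P ` ?I \<subseteq> Collect finite"
      using P_finite by auto
    then show ?thesis
      unfolding monomial [OF h] monomial [OF permutes_id]
      by (simp add: inj_on_image_eq_iff [OF inj])
  qed
  then show ?thesis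
    by (auto simp: monomial_stabilizer_def)
qed

lemma coset_representatives_place_bij:
  fixes \<rho> :: "nat \<Rightarrow> 'a"
  assumes t: "(d, lam, mu) \<in> block_types \<kappa>" and F: "coset_representatives d lam mu F"
    and \<rho>: "inj_on \<rho> {1..weight d lam mu}"
  shows "bij_betw (\<lambda>(\<sigma>, l). place (set (blocks d mu)) (block_positions d lam mu) \<rho> \<sigma> l)
    (F \<times> (set (blocks d mu) \<rightarrow>\<^sub>E (UNIV :: 'm::finite set)))
    {S \<in> labelled_partitions (\<rho> ` {1..weight d lam mu}). support S = \<rho> ` {1..weight d lam mu} \<and>
      block_sizes S = type_sizes d lam mu}"
proof -
  let ?I = "set (blocks d mu)" and ?P = "block_positions d lam mu" and ?W = "{1..weight d lam mu}"
  interpret block_family ?I ?P ?W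
    using block_family_blocks [OF t] .
  have "image_mset (\<lambda>b. card (?P b)) (mset_set ?I) = image_mset (\<lambda>b. lam (fst b)) (mset_set ?I)"
    by (intro image_mset_cong) (simp add: card_block_positions)
  then have sizes: "image_mset (\<lambda>b. card (?P b)) (mset_set ?I) = type_sizes d lam mu"
    by (simp add: image_mset_blocks)
  have Fp: "\<sigma> permutes ?W" if "\<sigma> \<in> F" for \<sigma>
    using F that by (auto simp: coset_representatives_def)
  have F1: "\<exists>!f. f \<in> F \<and> f \<in> (\<lambda>h. h \<circ> \<sigma>) ` monomial_stabilizer d lam mu" if "\<sigma> permutes ?W" for \<sigma>
    using F that by (auto simp: coset_representatives_def)
  have idH: "id \<in> monomial_stabilizer d lam mu"
    unfolding monomial_stabilizer_iff [OF t] by (simp add: permutes_id)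
  show ?thesis
    unfolding sizes [symmetric]
  proof (rule place_bij [OF \<rho> Fp])
    fix \<sigma> h assume a: "\<sigma> \<in> F" "h permutes ?W" "(\<lambda>b. h ` ?P b) ` ?I = ?P ` ?I" "h \<circ> \<sigma> \<in> F"
    then have "h \<in> monomial_stabilizer d lam mu"
      by (simp add: monomial_stabilizer_iff [OF t])
    then have "h \<circ> \<sigma> \<in> F \<and> h \<circ> \<sigma> \<in> (\<lambda>h. h \<circ> \<sigma>) ` monomial_stabilizer d lam mu"
      using a by blast
    moreover have "\<sigma> \<in> F \<and> \<sigma> \<in> (\<lambda>h. h \<circ> \<sigma>) ` monomial_stabilizer d lam mu"
      using a idH by (auto intro: image_eqI [of _ _ id])
    ultimately show "h \<circ> \<sigma> = \<sigma>"
      using F1 [OF Fp [OF a(1)]] by blast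
  next
    fix \<sigma> assume "\<sigma> permutes ?W"
    then obtain f where "f \<in> F" "f \<in> (\<lambda>h. h \<circ> \<sigma>) ` monomial_stabilizer d lam mu"
      using F1 by blast
    then show "\<exists>h. h permutes ?W \<and> (\<lambda>b. h ` ?P b) ` ?I = ?P ` ?I \<and> h \<circ> \<sigma> \<in> F"
      using monomial_stabilizer_iff [OF t] by blast
  qed
qed

lemma card_support:
  assumes "S \<in> labelled_partitions N" "finite N"
  shows "card (support S) = sum_mset (block_sizes (S :: ('a set \<times> 'm::finite) set))"
proof -
  have "finite S" using labelled_partitions_finite [OF assms(2,1)] .
  moreover have "finite (fst x)" if "x \<in> S" for x
    using labelled_partitionsD(1) [OF assms(1) that] assms(2) finite_subset by blast
  ultimately have "card (support S) = (\<Sum>x\<in>S. card (fst x))"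
    unfolding support_def using labelled_partitionsD(3) [OF assms(1)]
    by (intro card_UN_disjoint) auto
  also have "\<dots> = sum_mset (block_sizes S)"
    by (simp add: block_sizes_def sum_unfold_sum_mset o_def)
  finally show ?thesis .
qed

text \<open>
  Here \<open>\<Theta>\<close> stands for the shuffles and \<open>\<rho> \<tau>\<close> for an enumeration of the union of the blocks. Over all \<open>\<tau>\<close>
  these unions exhaust the sets in \<open>\<B>\<close> of the right size, and the families are grouped by
  their union.
\<close>

lemma sum_placements:
  fixes G :: "('a set \<times> 'm::finite) set \<Rightarrow> 'k::comm_monoid_add" and \<rho> :: "'t \<Rightarrow> nat \<Rightarrow> 'a"
  assumes t: "(d, lam, mu) \<in> block_types \<kappa>" and F: "coset_representatives d lam mu F"
    and N: "finite N" "\<B> \<subseteq> Pow N"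
    and \<rho>: "\<And>\<tau>. \<tau> \<in> \<Theta> \<Longrightarrow> inj_on (\<rho> \<tau>) {1..weight d lam mu}"
    and bij: "bij_betw (\<lambda>\<tau>. \<rho> \<tau> ` {1..weight d lam mu}) \<Theta> {B \<in> \<B>. card B = weight d lam mu}"
  shows "(\<Sum>\<tau>\<in>\<Theta>. \<Sum>\<sigma>\<in>F. \<Sum>l\<in>set (blocks d mu) \<rightarrow>\<^sub>E UNIV.
      G (place (set (blocks d mu)) (block_positions d lam mu) (\<rho> \<tau>) \<sigma> l)) =
    (\<Sum>S\<in>{S \<in> labelled_partitions N. support S \<in> \<B> \<and> block_sizes S = type_sizes d lam mu}. G S)"
proof -
  let ?I = "set (blocks d mu)" and ?P = "block_positions d lam mu" and ?W = "{1..weight d lam mu}"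
  let ?A = "{S \<in> (labelled_partitions N :: ('a set \<times> 'm) set set). support S \<in> \<B> \<and> block_sizes S = type_sizes d lam mu}"
  let ?Bs = "{B \<in> \<B>. card B = weight d lam mu}"
  have fibre: "{S \<in> (labelled_partitions B :: ('a set \<times> 'm) set set). support S = B \<and> block_sizes S = type_sizes d lam mu} =
      {S \<in> ?A. support S = B}" if "B \<in> ?Bs" for B
    using that N(2) by (fastforce simp: labelled_partitions_def support_def)
  have "(\<Sum>\<sigma>\<in>F. \<Sum>l\<in>?I \<rightarrow>\<^sub>E UNIV. G (place ?I ?P (\<rho> \<tau>) \<sigma> l)) =
      (\<Sum>S\<in>{S \<in> ?A. support S = \<rho> \<tau> ` ?W}. G S)" if \<tau>: "\<tau> \<in> \<Theta>" for \<tau>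
  proof -
    have "\<rho> \<tau> ` ?W \<in> ?Bs" using bij_betwE [OF bij] \<tau> by blast
    note fibre [OF this]
    with sum.reindex_bij_betw [OF coset_representatives_place_bij [OF t F \<rho> [OF \<tau>]], of G]
    show ?thesis
      by (simp add: sum.cartesian_product case_prod_unfold)
  qed
  then have "(\<Sum>\<tau>\<in>\<Theta>. \<Sum>\<sigma>\<in>F. \<Sum>l\<in>?I \<rightarrow>\<^sub>E UNIV. G (place ?I ?P (\<rho> \<tau>) \<sigma> l)) =
      (\<Sum>\<tau>\<in>\<Theta>. \<Sum>S\<in>{S \<in> ?A. support S = \<rho> \<tau> ` ?W}. G S)"
    by (intro sum.cong refl)
  also have "\<dots> = (\<Sum>B\<in>?Bs. \<Sum>S\<in>{S \<in> ?A. support S = B}. G S)"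
    by (rule sum.reindex_bij_betw [OF bij])
  also have "\<dots> = (\<Sum>S\<in>?A. G S)"
  proof (rule sum.group)
    show "finite ?A" by (simp add: finite_labelled_partitions [OF N(1)])
    show "finite ?Bs" using N finite_subset [of \<B> "Pow N"] by simp
    show "support ` ?A \<subseteq> ?Bs"
      by (auto simp: sum_mset_type_sizes card_support [OF _ N(1)])
  qed
  finally show ?thesis .
qed

text \<open>The Kronecker symbols prescribe \<open>k\<close> at every triple, because \<open>t \<mapsto> T (\<sigma> t)\<close> is a bijection.\<close>

lemma sum_lower_indices:
  fixes \<iota> :: "nat \<Rightarrow> 'n::finite"
  assumes \<sigma>: "\<sigma> permutes {1..weight d lam mu}"
  obtains k where "\<And>t. t \<in> {1..weight d lam mu} \<Longrightarrow> k (triple d lam mu (\<sigma> t)) = \<iota> t"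
    "\<And>C :: _ \<Rightarrow> 'k::comm_semiring_1. (\<Sum>k\<in>set (triples d lam mu) \<rightarrow>\<^sub>E UNIV.
      (\<Prod>t = 1..weight d lam mu. of_bool (\<iota> t = k (triple d lam mu (\<sigma> t)))) * C k) = C k"
proof -
  let ?W = "{1..weight d lam mu}" and ?T = "triple d lam mu" and ?A = "set (triples d lam mu)"
  have bij: "bij_betw (\<lambda>t. ?T (\<sigma> t)) ?W ?A"
    using bij_betw_trans [OF permutes_imp_bij [OF \<sigma>] triple_bij] by (simp add: o_def)
  define k where "k = restrict (\<lambda>a. \<iota> (inv_into ?W (\<lambda>t. ?T (\<sigma> t)) a)) ?A"
  have k: "k (?T (\<sigma> t)) = \<iota> t" if "t \<in> ?W" for t
    using that bij bij_betwE [OF bij] bij_betw_inv_into_left [OF bij that] by (simp add: k_def)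
  have kE: "k \<in> ?A \<rightarrow>\<^sub>E UNIV" by (simp add: k_def)
  have delta: "(\<Prod>t\<in>?W. of_bool (\<iota> t = k' (?T (\<sigma> t)))) = (of_bool (k' = k) :: 'k)"
    if k': "k' \<in> ?A \<rightarrow>\<^sub>E UNIV" for k'
  proof (cases "k' = k")
    case True
    then show ?thesis using k by (intro trans [OF prod.neutral]) auto
  next
    case False
    then obtain a where a: "a \<in> ?A" "k' a \<noteq> k a"
      using k' kE by (meson PiE_ext)
    then obtain t where "t \<in> ?W" "a = ?T (\<sigma> t)"
      using bij by (metis (no_types, lifting) bij_betw_imp_surj_on imageE)
    then have "\<exists>t\<in>?W. of_bool (\<iota> t = k' (?T (\<sigma> t))) = (0 :: 'k)"
      using a k by (intro bexI [of _ t]) auto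
    then show ?thesis using False by (simp add: prod_zero)
  qed
  show thesis
  proof (rule that [OF k])
    fix C :: "(nat \<times> nat \<times> nat \<Rightarrow> 'n) \<Rightarrow> 'k"
    have "(\<Sum>k'\<in>?A \<rightarrow>\<^sub>E UNIV. (\<Prod>t\<in>?W. of_bool (\<iota> t = k' (?T (\<sigma> t)))) * C k') =
        (\<Sum>k'\<in>?A \<rightarrow>\<^sub>E UNIV. if k' = k then C k else 0)"
      by (intro sum.cong refl, subst delta) auto
    also have "\<dots> = C k"
      using kE by (simp add: finite_PiE)
    finally show "(\<Sum>k'\<in>?A \<rightarrow>\<^sub>E UNIV. (\<Prod>t\<in>?W. of_bool (\<iota> t = k' (?T (\<sigma> t)))) * C k') = C k" .
  qed simp
qed

lemma sum_lower_indices_monomial: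
  fixes i :: "'a \<Rightarrow> 'n::finite" and u :: "'m \<times> 'n multiset \<Rightarrow> 'k::comm_ring_1"
  assumes t: "(d, lam, mu) \<in> block_types \<kappa>" and \<sigma>: "\<sigma> permutes {1..weight d lam mu}"
    and \<rho>: "inj_on \<rho> {1..weight d lam mu}"
  shows "(\<Sum>k\<in>set (triples d lam mu) \<rightarrow>\<^sub>E UNIV.
      (\<Prod>t = 1..weight d lam mu. of_bool (i (\<rho> t) = k (triple d lam mu (\<sigma> t)))) *
      (c * (\<Prod>e = 1..d. \<Prod>\<nu> = 1..mu e.
         u (l (e, \<nu>), image_mset (\<lambda>\<gamma>. k (e, \<nu>, \<gamma>)) (mset_set {1..lam e}))))) =
    c * (\<Prod>x\<in>place (set (blocks d mu)) (block_positions d lam mu) \<rho> \<sigma> l. u (jet_var i x))"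
proof -
  let ?I = "set (blocks d mu)" and ?P = "block_positions d lam mu" and ?W = "{1..weight d lam mu}"
  let ?T = "triple d lam mu"
  interpret block_family ?I ?P ?W
    using block_family_blocks [OF t] .
  obtain k where k: "\<And>t. t \<in> ?W \<Longrightarrow> k (?T (\<sigma> t)) = i (\<rho> t)"
    and delta: "\<And>C :: _ \<Rightarrow> 'k. (\<Sum>k\<in>set (triples d lam mu) \<rightarrow>\<^sub>E UNIV.
      (\<Prod>t \<in> ?W. of_bool (i (\<rho> t) = k (?T (\<sigma> t)))) * C k) = C k"
    using sum_lower_indices [OF \<sigma>, of "\<lambda>t. i (\<rho> t)"] by blast
  have "image_mset (\<lambda>\<gamma>. k (e, \<nu>, \<gamma>)) (mset_set {1..lam e}) =
      image_mset i (mset_set (\<rho> ` (\<sigma> -` ?P (e, \<nu>))))" if b: "(e, \<nu>) \<in> ?I" for e \<nu>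
  proof -
    have sub: "\<sigma> -` ?P (e, \<nu>) \<subseteq> ?W" using vimage_subset [OF \<sigma> b] .
    have "?T ` \<sigma> ` (\<sigma> -` ?P (e, \<nu>)) = (\<lambda>\<gamma>. (e, \<nu>, \<gamma>)) ` {1..lam e}"
      unfolding surj_image_vimage_eq [OF permutes_surj [OF \<sigma>]]
      by (rule triple_image_block_positions [OF b])
    then have img: "(\<lambda>t. ?T (\<sigma> t)) ` (\<sigma> -` ?P (e, \<nu>)) = (\<lambda>\<gamma>. (e, \<nu>, \<gamma>)) ` {1..lam e}"
      by (simp only: image_image)
    have inj: "inj_on (\<lambda>t. ?T (\<sigma> t)) ?W"
      using bij_betw_trans [OF permutes_imp_bij [OF \<sigma>] triple_bij] by (simp add: o_def bij_betw_def)
    have "image_mset (\<lambda>\<gamma>. k (e, \<nu>, \<gamma>)) (mset_set {1..lam e}) =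
        image_mset k (image_mset (\<lambda>\<gamma>. (e, \<nu>, \<gamma>)) (mset_set {1..lam e}))"
      by (simp add: image_mset.compositionality o_def)
    also have "image_mset (\<lambda>\<gamma>. (e, \<nu>, \<gamma>)) (mset_set {1..lam e}) =
        image_mset (\<lambda>t. ?T (\<sigma> t)) (mset_set (\<sigma> -` ?P (e, \<nu>)))"
      unfolding image_mset_mset_set [OF inj_on_subset [OF inj sub]] img
      by (intro image_mset_mset_set) (simp add: inj_on_def)
    also have "image_mset k \<dots> = image_mset (\<lambda>t. i (\<rho> t)) (mset_set (\<sigma> -` ?P (e, \<nu>)))"
      unfolding image_mset.compositionality o_def
    proof (rule image_mset_cong)
      fix t assume "t \<in># mset_set (\<sigma> -` ?P (e, \<nu>))"
      then have "t \<in> \<sigma> -` ?P (e, \<nu>)" by (metis elem_mset_set empty_iff mset_set.infinite set_mset_empty)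
      then show "k (?T (\<sigma> t)) = i (\<rho> t)" using k sub by blast
    qed
    also have "\<dots> = image_mset i (mset_set (\<rho> ` (\<sigma> -` ?P (e, \<nu>))))"
      unfolding image_mset_mset_set [OF inj_on_subset [OF \<rho> sub], symmetric]
      by (simp add: image_mset.compositionality o_def)
    finally show ?thesis .
  qed
  then have "(\<Prod>e = 1..d. \<Prod>\<nu> = 1..mu e.
         u (l (e, \<nu>), image_mset (\<lambda>\<gamma>. k (e, \<nu>, \<gamma>)) (mset_set {1..lam e}))) =
      (\<Prod>e = 1..d. \<Prod>\<nu> = 1..mu e. u (jet_var i (\<rho> ` (\<sigma> -` ?P (e, \<nu>)), l (e, \<nu>))))"
    by (intro prod.cong refl) (auto simp: jet_var_def set_blocks)
  also have "\<dots> = (\<Prod>b\<in>?I. u (jet_var i (\<rho> ` (\<sigma> -` ?P b), l b)))"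
    unfolding set_blocks by (subst prod.Sigma) (auto simp: case_prod_unfold)
  also have "\<dots> = (\<Prod>x\<in>place ?I ?P \<rho> \<sigma> l. u (jet_var i x))"
    unfolding place_def by (simp add: prod.reindex [OF place_inj [OF \<rho> \<sigma>]])
  finally show ?thesis
    unfolding delta by simp
qed

lemma y_derivs_place:
  assumes t: "(d, lam, mu) \<in> block_types \<kappa>" and \<sigma>: "\<sigma> permutes {1..weight d lam mu}"
    and \<rho>: "inj_on \<rho> {1..weight d lam mu}"
  shows "y_derivs (place (set (blocks d mu)) (block_positions d lam mu) \<rho> \<sigma> l) =
    mset (map (\<lambda>b. Inr (l b)) (blocks d mu))"
proof -
  interpret block_family "set (blocks d mu)" "block_positions d lam mu" "{1..weight d lam mu}"
    using block_family_blocks [OF t] .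
  show ?thesis
    unfolding y_derivs_def place_def image_mset_mset_set [OF place_inj [OF \<rho> \<sigma>], symmetric]
    by (simp add: image_mset.compositionality o_def mset_set_set distinct_blocks)
qed

lemma sum_swap_inside_out:
  fixes a :: "_ \<Rightarrow> _ \<Rightarrow> _ \<Rightarrow> _ \<Rightarrow> 'k::comm_ring_1"
  shows "(\<Sum>l\<in>L. \<Sum>k\<in>K. (\<Sum>\<sigma>\<in>F. \<Sum>\<tau>\<in>\<Theta>. a \<sigma> \<tau> l k) * m l k) =
    (\<Sum>\<tau>\<in>\<Theta>. \<Sum>\<sigma>\<in>F. \<Sum>l\<in>L. \<Sum>k\<in>K. a \<sigma> \<tau> l k * m l k)"
proof -
  let ?f = "\<lambda>z \<sigma> \<tau>. a \<sigma> \<tau> (fst z) (snd z) * m (fst z) (snd z)"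
  have pairs: "(\<Sum>l\<in>L. \<Sum>k\<in>K. g l k) = (\<Sum>z\<in>L \<times> K. g (fst z) (snd z))" for g :: "_ \<Rightarrow> _ \<Rightarrow> 'k"
    by (simp add: sum.cartesian_product case_prod_unfold)
  have "(\<Sum>l\<in>L. \<Sum>k\<in>K. (\<Sum>\<sigma>\<in>F. \<Sum>\<tau>\<in>\<Theta>. a \<sigma> \<tau> l k) * m l k) =
      (\<Sum>z\<in>L \<times> K. \<Sum>\<sigma>\<in>F. \<Sum>\<tau>\<in>\<Theta>. ?f z \<sigma> \<tau>)"
    unfolding pairs sum_distrib_right ..
  also have "\<dots> = (\<Sum>\<sigma>\<in>F. \<Sum>z\<in>L \<times> K. \<Sum>\<tau>\<in>\<Theta>. ?f z \<sigma> \<tau>)"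
    by (rule sum.swap)
  also have "\<dots> = (\<Sum>\<sigma>\<in>F. \<Sum>\<tau>\<in>\<Theta>. \<Sum>z\<in>L \<times> K. ?f z \<sigma> \<tau>)"
    by (intro sum.cong refl sum.swap)
  also have "\<dots> = (\<Sum>\<tau>\<in>\<Theta>. \<Sum>\<sigma>\<in>F. \<Sum>z\<in>L \<times> K. ?f z \<sigma> \<tau>)"
    by (rule sum.swap)
  finally show ?thesis
    unfolding pairs .
qed

lemma mset_map_upt:
  assumes "inj_on \<tau> {a..\<kappa>}"
  shows "mset (map (\<lambda>t. Inl (i (\<tau> t))) [a..<\<kappa> + 1]) = x_derivs i (\<tau> ` {a..\<kappa>})"
proof -
  have "mset [a..<\<kappa> + 1] = mset_set {a..\<kappa>}"
    by (metis Suc_eq_plus1 atLeastLessThanSuc_atLeastAtMost mset_upt)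
  then show ?thesis
    unfolding x_derivs_def image_mset_mset_set [OF assms, symmetric]
    by (simp add: image_mset.compositionality o_def del: upt_Suc mset_upt)
qed

lemma permutes_image_compl:
  fixes q \<kappa> :: nat
  assumes "\<tau> permutes {1..\<kappa>}" "q \<le> \<kappa>"
  shows "\<tau> ` {q + 1..\<kappa>} = {1..\<kappa>} - \<tau> ` {1..q}"
proof -
  have "{q + 1..\<kappa>} = {1..\<kappa>} - {1..q}" by auto
  then have "\<tau> ` {q + 1..\<kappa>} = \<tau> ` {1..\<kappa>} - \<tau> ` {1..q}"
    using image_set_diff [OF permutes_inj [OF assms(1)]] by metis
  then show ?thesis using permutes_image [OF assms(1)] by simp
qed

text \<open>
  The part of the formula that involves \<open>Y\<close>. Here the union of the blocks is an arbitrary set of \<open>s\<close>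
  positions, enumerated by the shuffle itself.
\<close>

lemma sum_type_jet_terms:
  fixes f :: "('k::real_normed_field, 'n::finite, 'm::finite) base \<Rightarrow> 'k"
  assumes U: "open U" "smooth_on U f" "jet_base p \<in> U"
    and t: "(d, lam, mu) \<in> block_types \<kappa>" and F: "coset_representatives d lam mu F"
  defines "s \<equiv> weight d lam mu" and "T \<equiv> triple d lam mu"
  shows "(\<Sum>l\<in>set (blocks d mu) \<rightarrow>\<^sub>E (UNIV :: 'm set). \<Sum>k\<in>set (triples d lam mu) \<rightarrow>\<^sub>E (UNIV :: 'n set).
      (\<Sum>\<sigma>\<in>F. \<Sum>\<tau>\<in>shuffles_at \<kappa> s.
        (\<Prod>t = 1..s. of_bool (i (\<tau> t) = k (T (\<sigma> t)))) *
        partials (map (\<lambda>t. Inl (i (\<tau> t))) [s + 1..<\<kappa> + 1] @ map (\<lambda>b. Inr (l b)) (blocks d mu)) f (jet_base p)) *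
      (\<Prod>e = 1..d. \<Prod>\<nu> = 1..mu e. snd p (l (e, \<nu>), image_mset (\<lambda>\<gamma>. k (e, \<nu>, \<gamma>)) (mset_set {1..lam e})))) =
    (\<Sum>S\<in>{S \<in> labelled_partitions {1..\<kappa>}. block_sizes S = type_sizes d lam mu}. jet_term i f {1..\<kappa>} p S)"
proof -
  let ?I = "set (blocks d mu)" and ?P = "block_positions d lam mu"
  interpret block_family ?I ?P "{1..s}"
    unfolding s_def using block_family_blocks [OF t] .
  have summand: "(\<Sum>k\<in>set (triples d lam mu) \<rightarrow>\<^sub>E UNIV.
        (\<Prod>t = 1..s. of_bool (i (\<tau> t) = k (T (\<sigma> t)))) *
        partials (map (\<lambda>t. Inl (i (\<tau> t))) [s + 1..<\<kappa> + 1] @ map (\<lambda>b. Inr (l b)) (blocks d mu)) f (jet_base p) *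
        (\<Prod>e = 1..d. \<Prod>\<nu> = 1..mu e. snd p (l (e, \<nu>), image_mset (\<lambda>\<gamma>. k (e, \<nu>, \<gamma>)) (mset_set {1..lam e})))) =
      jet_term i f {1..\<kappa>} p (place ?I ?P \<tau> \<sigma> l)"
    if \<tau>: "\<tau> \<in> shuffles_at \<kappa> s" and \<sigma>: "\<sigma> \<in> F" for \<tau> \<sigma> l
  proof -
    have s: "s \<le> \<kappa>" and perm: "\<tau> permutes {1..\<kappa>}"
      using \<tau> by (auto simp: shuffles_at_def split: if_splits)
    have \<sigma>p: "\<sigma> permutes {1..s}"
      using F \<sigma> by (auto simp: coset_representatives_def s_def)
    have inj: "inj_on \<tau> A" for A
      using permutes_inj [OF perm] inj_on_subset by blast
    let ?S = "place ?I ?P \<tau> \<sigma> l"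
    have "mset (map (\<lambda>t. Inl (i (\<tau> t))) [s + 1..<\<kappa> + 1] @ map (\<lambda>b. Inr (l b)) (blocks d mu)) =
        x_derivs i ({1..\<kappa>} - support ?S) + y_derivs ?S"
      unfolding mset_append mset_map_upt [OF inj] y_derivs_place [OF t \<sigma>p [unfolded s_def] inj]
        support_place [OF \<sigma>p] permutes_image_compl [OF perm s] ..
    then have P: "partials (map (\<lambda>t. Inl (i (\<tau> t))) [s + 1..<\<kappa> + 1] @ map (\<lambda>b. Inr (l b)) (blocks d mu)) f (jet_base p) =
        partials_mset (x_derivs i ({1..\<kappa>} - support ?S) + y_derivs ?S) f (jet_base p)"
      by (rule partials_mset [OF U])
    show ?thesis
      unfolding P unfolding jet_term_def s_def T_def mult.assoc
      by (rule sum_lower_indices_monomial [OF t \<sigma>p [unfolded s_def] inj])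
  qed
  have "(\<Sum>\<tau>\<in>shuffles_at \<kappa> s. \<Sum>\<sigma>\<in>F. \<Sum>l\<in>?I \<rightarrow>\<^sub>E UNIV. jet_term i f {1..\<kappa>} p (place ?I ?P \<tau> \<sigma> l)) =
      (\<Sum>S\<in>{S \<in> labelled_partitions {1..\<kappa>}. support S \<in> Pow {1..\<kappa>} \<and> block_sizes S = type_sizes d lam mu}.
        jet_term i f {1..\<kappa>} p S)"
  proof (rule sum_placements [OF t F])
    show "inj_on \<tau> {1..weight d lam mu}" if "\<tau> \<in> shuffles_at \<kappa> s" for \<tau>
      using that by (auto simp: shuffles_at_def split: if_splits intro: inj_on_subset permutes_inj)
    show "bij_betw (\<lambda>\<tau>. \<tau> ` {1..weight d lam mu}) (shuffles_at \<kappa> s)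
        {B \<in> Pow {1..\<kappa>}. card B = weight d lam mu}"
      using shuffles_at_bij_subsets [of s \<kappa>] by (simp add: s_def)
  qed auto
  also have "{S \<in> labelled_partitions {1..\<kappa>}. support S \<in> Pow {1..\<kappa>} \<and> block_sizes S = type_sizes d lam mu} =
      {S \<in> (labelled_partitions {1..\<kappa>} :: (nat set \<times> 'm) set set). block_sizes S = type_sizes d lam mu}"
    by (auto simp: support_def dest: labelled_partitionsD(1))
  finally show ?thesis
    unfolding sum_swap_inside_out by (rule trans [rotated]) (intro sum.cong refl summand)
qed

text \<open>
  The terms with \<open>X\<close>. The position \<open>N\<close> is the additional one and carries the index \<open>c\<close> of \<open>X\<^sup>c\<close>. Its block
  must have label \<open>j\<close>, and the derivative in \<open>y\<^sup>j\<close> that this block would contribute is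
  omitted.
\<close>

definition hatted_term :: "(nat \<Rightarrow> 'n) \<Rightarrow> (('k::real_normed_field, 'n::finite, 'm::finite) base \<Rightarrow> 'k)
    \<Rightarrow> 'm \<Rightarrow> 'n \<Rightarrow> nat \<Rightarrow> ('k, 'n, 'm) jet \<Rightarrow> (nat set \<times> 'm) set \<Rightarrow> 'k" where
  "hatted_term i f j c N p S =
     of_bool (\<exists>x\<in>S. N \<in> fst x \<and> snd x = j) *
     partials_mset (x_derivs i ({1..N} - support S) + y_derivs S - {#Inr j#}) f (jet_base p) *
     (\<Prod>x\<in>S. snd p (jet_var (i(N := c)) x))"

lemma mset_filter_neq:
  "distinct xs \<Longrightarrow> b \<in> set xs \<Longrightarrow> mset xs = add_mset b (mset (filter (\<lambda>x. x \<noteq> b) xs))"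
proof (induction xs)
  case (Cons x xs)
  show ?case
  proof (cases "x = b")
    case True
    then have "filter (\<lambda>x. x \<noteq> b) xs = xs"
      using Cons.prems by (auto simp: filter_id_conv)
    then show ?thesis using True by simp
  qed (use Cons in auto)
qed simp

lemma inj_on_fun_upd_insert:
  "inj_on f A \<Longrightarrow> a \<notin> A \<Longrightarrow> b \<notin> f ` A \<Longrightarrow> inj_on (f(a := b)) (insert a A)"
  by (auto simp: inj_on_def)

text \<open>
  The part of the formula that involves \<open>X\<close>. The free index \<open>k\<close> at \<open>\<sigma> s\<close> is named \<open>c\<close> and treated as
  the index at the additional position \<open>\<kappa> + 1\<close>. With the shuffle extended by \<open>s \<mapsto> \<kappa> + 1\<close>, the
  product of \<open>s - 1\<close> Kronecker symbols is completed to one of \<open>s\<close> symbols, and the two parts of the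
  formula have the same shape.
\<close>

lemma sum_type_hatted_terms:
  fixes X :: "'n::finite \<Rightarrow> ('k::real_normed_field, 'n, 'm::finite) base \<Rightarrow> 'k"
  assumes U: "open U" "\<And>c. smooth_on U (X c)" "jet_base p \<in> U"
    and t: "(d, lam, mu) \<in> block_types \<kappa>" and F: "coset_representatives d lam mu F"
  defines "s \<equiv> weight d lam mu" and "T \<equiv> triple d lam mu"
  shows "(\<Sum>l\<in>set (blocks d mu) \<rightarrow>\<^sub>E (UNIV :: 'm set). \<Sum>k\<in>set (triples d lam mu) \<rightarrow>\<^sub>E (UNIV :: 'n set).
      (\<Sum>\<sigma>\<in>F. \<Sum>\<tau>\<in>shuffles_at \<kappa> (s - 1).
        (\<Prod>t = 1..s - 1. of_bool (i (\<tau> t) = k (T (\<sigma> t)))) *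
        of_bool (j = l (block_of (T (\<sigma> s)))) *
        partials (map (\<lambda>t. Inl (i (\<tau> t))) [s..<\<kappa> + 1] @
            map (\<lambda>b. Inr (l b)) (filter (\<lambda>b. b \<noteq> block_of (T (\<sigma> s))) (blocks d mu)))
          (X (k (T (\<sigma> s)))) (jet_base p)) *
      (\<Prod>e = 1..d. \<Prod>\<nu> = 1..mu e. snd p (l (e, \<nu>), image_mset (\<lambda>\<gamma>. k (e, \<nu>, \<gamma>)) (mset_set {1..lam e})))) =
    (\<Sum>c\<in>UNIV. \<Sum>S\<in>{S \<in> labelled_partitions {1..\<kappa> + 1}. \<kappa> + 1 \<in> support S \<and> block_sizes S = type_sizes d lam mu}.
      hatted_term i (X c) j c (\<kappa> + 1) p S)"
proof -
  let ?I = "set (blocks d mu)" and ?P = "block_positions d lam mu" and ?N = "\<kappa> + 1"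
  interpret block_family ?I ?P "{1..s}"
    unfolding s_def using block_family_blocks [OF t] .
  have s1: "s \<ge> 1"
  proof -
    have "type_sizes d lam mu \<noteq> {#} \<and> set_mset (type_sizes d lam mu) \<subseteq> {1..\<kappa>}"
      using bspec [OF bij_betwE [OF type_sizes_bij] t] by simp
    moreover from this obtain r where "r \<in># type_sizes d lam mu"
      by (auto elim: multiset_nonemptyE)
    ultimately have "sum_mset (type_sizes d lam mu) \<noteq> 0"
      by (auto simp: subset_iff intro!: bexI [of _ r])
    then show ?thesis by (simp add: s_def sum_mset_type_sizes)
  qed
  have ins: "{1..s} = insert s {1..s - 1}" "s \<notin> {1..s - 1}" using s1 by auto
  have summand: "(\<Sum>k\<in>set (triples d lam mu) \<rightarrow>\<^sub>E UNIV.
        (\<Prod>t = 1..s - 1. of_bool (i (\<tau> t) = k (T (\<sigma> t)))) *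
        of_bool (j = l (block_of (T (\<sigma> s)))) *
        partials (map (\<lambda>t. Inl (i (\<tau> t))) [s..<\<kappa> + 1] @
            map (\<lambda>b. Inr (l b)) (filter (\<lambda>b. b \<noteq> block_of (T (\<sigma> s))) (blocks d mu)))
          (X (k (T (\<sigma> s)))) (jet_base p) *
        (\<Prod>e = 1..d. \<Prod>\<nu> = 1..mu e. snd p (l (e, \<nu>), image_mset (\<lambda>\<gamma>. k (e, \<nu>, \<gamma>)) (mset_set {1..lam e})))) =
      (\<Sum>c\<in>UNIV. hatted_term i (X c) j c ?N p (place ?I ?P (\<tau>(s := ?N)) \<sigma> l))"
    if \<tau>: "\<tau> \<in> shuffles_at \<kappa> (s - 1)" and \<sigma>: "\<sigma> \<in> F" for \<tau> \<sigma> l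
  proof -
    let ?\<rho> = "\<tau>(s := ?N)" and ?b = "block_of (T (\<sigma> s))"
    let ?S = "place ?I ?P ?\<rho> \<sigma> l"
    let ?L = "map (\<lambda>t. Inl (i (\<tau> t))) [s..<\<kappa> + 1] @
            map (\<lambda>b. Inr (l b)) (filter (\<lambda>b. b \<noteq> ?b) (blocks d mu))"
    let ?M = "\<lambda>k. (\<Prod>e = 1..d. \<Prod>\<nu> = 1..mu e.
        snd p (l (e, \<nu>), image_mset (\<lambda>\<gamma>. k (e, \<nu>, \<gamma>)) (mset_set {1..lam e})))"
    have s: "s - 1 \<le> \<kappa>" and perm: "\<tau> permutes {1..\<kappa>}"
      using \<tau> by (auto simp: shuffles_at_def split: if_splits)
    have \<sigma>p: "\<sigma> permutes {1..s}"
      using F \<sigma> by (auto simp: coset_representatives_def s_def)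
    have inj: "inj_on \<tau> A" for A
      using permutes_inj [OF perm] inj_on_subset by blast
    have range: "\<tau> t \<in> {1..\<kappa>}" if "t \<in> {1..s - 1}" for t
      using that s permutes_in_image [OF perm, of t] by auto
    have \<rho>inj: "inj_on ?\<rho> {1..s}"
      unfolding ins(1) using range by (intro inj_on_fun_upd_insert inj ins(2)) fastforce
    have \<rho>img: "?\<rho> ` {1..s} = insert ?N (\<tau> ` {1..s - 1})"
      unfolding ins(1) using ins(2) by auto
    have "s \<in> {1..s}" using s1 by simp
    then have \<sigma>s: "\<sigma> s \<in> {1..s}" using permutes_in_image [OF \<sigma>p] by blast
    then have b: "?b \<in> ?I" "\<sigma> s \<in> ?P ?b"
    proof -
      show "\<sigma> s \<in> ?P ?b" using \<sigma>s by (simp add: block_positions_def T_def s_def)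
      obtain c where "c \<in> ?I" "\<sigma> s \<in> ?P c" using \<sigma>s W by blast
      then show "?b \<in> ?I" by (simp add: block_positions_def T_def)
    qed
    \<comment> \<open>The additional position is the element at place \<open>s\<close>, so its block is the one that contains \<open>\<sigma> s\<close>.\<close>
    have N_in: "?N \<in> ?\<rho> ` (\<sigma> -` ?P b') \<longleftrightarrow> b' = ?b" if b': "b' \<in> ?I" for b'
    proof
      assume "?N \<in> ?\<rho> ` (\<sigma> -` ?P b')"
      then obtain t where t: "\<sigma> t \<in> ?P b'" "?\<rho> t = ?N" by auto
      then have "t \<in> {1..s}" using vimage_subset [OF \<sigma>p b'] by auto
      then have "t = s" using t(2) range [of t] ins by (cases "t = s") auto
      then show "b' = ?b" using t(1) b disjoint [OF b' b(1)] by auto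
    next
      assume "b' = ?b"
      then show "?N \<in> ?\<rho> ` (\<sigma> -` ?P b')"
        using b(2) by (intro image_eqI [of _ _ s]) auto
    qed
    have label: "(\<exists>x\<in>?S. ?N \<in> fst x \<and> snd x = j) \<longleftrightarrow> j = l ?b"
      unfolding place_def using N_in b(1) by auto
    have "mset ?L = x_derivs i ({1..?N} - support ?S) + y_derivs ?S - {#Inr j#}" if j: "j = l ?b"
    proof -
      have "\<tau> ` {s..\<kappa>} = {1..\<kappa>} - \<tau> ` {1..s - 1}"
        using permutes_image_compl [OF perm s] s1 by simp
      also have "\<dots> = {1..?N} - support ?S"
        unfolding support_place [OF \<sigma>p] \<rho>img by auto
      finally have x: "mset (map (\<lambda>t. Inl (i (\<tau> t))) [s..<\<kappa> + 1]) = x_derivs i ({1..?N} - support ?S)"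
        using mset_map_upt [OF inj, of i s \<kappa>] by simp
      have *: "mset (blocks d mu) = add_mset ?b (mset (filter (\<lambda>b. b \<noteq> ?b) (blocks d mu)))"
        by (rule mset_filter_neq [OF distinct_blocks b(1)])
      have "y_derivs ?S = (add_mset (Inr j) (mset (map (\<lambda>b. Inr (l b))
          (filter (\<lambda>b. b \<noteq> ?b) (blocks d mu)))) :: ('n + 'm) multiset)"
        unfolding y_derivs_place [OF t \<sigma>p [unfolded s_def] \<rho>inj [unfolded s_def], folded s_def]
        unfolding mset_map by (subst *) (simp add: j)
      then show ?thesis
        unfolding mset_append x by simp
    qed
    then have P: "of_bool (j = l ?b) * partials ?L (X c) (jet_base p) =
        of_bool (\<exists>x\<in>?S. ?N \<in> fst x \<and> snd x = j) *
        partials_mset (x_derivs i ({1..?N} - support ?S) + y_derivs ?S - {#Inr j#}) (X c) (jet_base p)" for c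
      unfolding label using partials_mset [OF U(1) U(2) U(3)] by auto
    have prod: "(\<Prod>t = 1..s. of_bool ((i(?N := c)) (?\<rho> t) = k (T (\<sigma> t)))) =
        of_bool (c = k (T (\<sigma> s))) * (\<Prod>t = 1..s - 1. of_bool (i (\<tau> t) = k (T (\<sigma> t))) :: 'k)" for c k
    proof -
      have "(\<Prod>t = 1..s - 1. of_bool ((i(?N := c)) (?\<rho> t) = k (T (\<sigma> t)))) =
          (\<Prod>t = 1..s - 1. of_bool (i (\<tau> t) = k (T (\<sigma> t))) :: 'k)"
        using range ins(2) by (intro prod.cong refl) fastforce
      then show ?thesis
        unfolding ins(1) using ins(2) by simp
    qed
    have "(\<Prod>t = 1..s - 1. of_bool (i (\<tau> t) = k (T (\<sigma> t)))) *
        of_bool (j = l ?b) * partials ?L (X (k (T (\<sigma> s)))) (jet_base p) * ?M k =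
      (\<Sum>c\<in>UNIV. (\<Prod>t = 1..s. of_bool ((i(?N := c)) (?\<rho> t) = k (T (\<sigma> t)))) *
        (of_bool (j = l ?b) * partials ?L (X c) (jet_base p) * ?M k))" (is "?lhs k = _") for k
    proof -
      have "?lhs k = (\<Sum>c\<in>UNIV. if c = k (T (\<sigma> s)) then
          (\<Prod>t = 1..s - 1. of_bool (i (\<tau> t) = k (T (\<sigma> t)))) *
          (of_bool (j = l ?b) * partials ?L (X c) (jet_base p) * ?M k) else 0)"
        by (simp add: mult.assoc)
      also have "\<dots> = (\<Sum>c\<in>UNIV. (\<Prod>t = 1..s. of_bool ((i(?N := c)) (?\<rho> t) = k (T (\<sigma> t)))) *
          (of_bool (j = l ?b) * partials ?L (X c) (jet_base p) * ?M k))"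
        unfolding prod by (intro sum.cong refl) simp
      finally show ?thesis .
    qed
    then have "(\<Sum>k\<in>set (triples d lam mu) \<rightarrow>\<^sub>E UNIV. ?lhs k) =
        (\<Sum>c\<in>UNIV. \<Sum>k\<in>set (triples d lam mu) \<rightarrow>\<^sub>E UNIV.
          (\<Prod>t = 1..s. of_bool ((i(?N := c)) (?\<rho> t) = k (T (\<sigma> t)))) *
          (of_bool (j = l ?b) * partials ?L (X c) (jet_base p) * ?M k))"
      by (simp only:) (rule sum.swap)
    also have "\<dots> = (\<Sum>c\<in>UNIV. hatted_term i (X c) j c ?N p ?S)"
      unfolding P unfolding hatted_term_def s_def T_def
      by (intro sum.cong refl
          sum_lower_indices_monomial [OF t \<sigma>p [unfolded s_def] \<rho>inj [unfolded s_def]])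
    finally show ?thesis .
  qed
  have place_sum: "(\<Sum>\<tau>\<in>shuffles_at \<kappa> (s - 1). \<Sum>\<sigma>\<in>F. \<Sum>l\<in>?I \<rightarrow>\<^sub>E UNIV.
        hatted_term i (X c) j c ?N p (place ?I ?P (\<tau>(s := ?N)) \<sigma> l)) =
      (\<Sum>S\<in>{S \<in> labelled_partitions {1..?N}. support S \<in> {B. B \<subseteq> {1..?N} \<and> ?N \<in> B} \<and>
          block_sizes S = type_sizes d lam mu}. hatted_term i (X c) j c ?N p S)" for c
  proof (rule sum_placements [OF t F])
    show "inj_on (\<tau>(s := ?N)) {1..weight d lam mu}" if "\<tau> \<in> shuffles_at \<kappa> (s - 1)" for \<tau>
    proof -
      have s: "s - 1 \<le> \<kappa>" and perm: "\<tau> permutes {1..\<kappa>}"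
        using that by (auto simp: shuffles_at_def split: if_splits)
      have "\<tau> t \<in> {1..\<kappa>}" if "t \<in> {1..s - 1}" for t
        using that s permutes_in_image [OF perm, of t] by auto
      then show ?thesis
        unfolding s_def [symmetric] ins(1)
        by (intro inj_on_fun_upd_insert ins(2) inj_on_subset [OF permutes_inj [OF perm]]) fastforce+
    qed
    have "bij_betw (insert ?N) {B. B \<subseteq> {1..\<kappa>} \<and> card B = s - 1} {B. B \<subseteq> {1..?N} \<and> ?N \<in> B \<and> card B = s}"
    proof (rule bij_betw_byWitness [where f' = "\<lambda>B. B - {?N}"])
      show "insert ?N ` {B. B \<subseteq> {1..\<kappa>} \<and> card B = s - 1} \<subseteq> {B. B \<subseteq> {1..?N} \<and> ?N \<in> B \<and> card B = s}"
      proof (rule image_subsetI)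
        fix B assume "B \<in> {B. B \<subseteq> {1..\<kappa>} \<and> card B = s - 1}"
        then have B: "B \<subseteq> {1..\<kappa>}" "card B = s - 1" by auto
        then have "finite B" "?N \<notin> B" using finite_subset by fastforce+
        then show "insert ?N B \<in> {B. B \<subseteq> {1..?N} \<and> ?N \<in> B \<and> card B = s}"
          using B s1 by auto
      qed
      show "(\<lambda>B. B - {?N}) ` {B. B \<subseteq> {1..?N} \<and> ?N \<in> B \<and> card B = s} \<subseteq> {B. B \<subseteq> {1..\<kappa>} \<and> card B = s - 1}"
        by (auto simp: le_Suc_eq card_Diff_singleton)
    qed fastforce+
    then have "bij_betw (insert ?N \<circ> (\<lambda>\<tau>. \<tau> ` {1..s - 1})) (shuffles_at \<kappa> (s - 1))
        {B. B \<subseteq> {1..?N} \<and> ?N \<in> B \<and> card B = s}"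
      using shuffles_at_bij_subsets by (rule bij_betw_trans [rotated])
    moreover have "(\<lambda>\<tau>. (\<tau>(s := ?N)) ` {1..s}) = insert ?N \<circ> (\<lambda>\<tau>. \<tau> ` {1..s - 1})"
    proof
      fix \<tau> :: "nat \<Rightarrow> nat"
      show "(\<tau>(s := ?N)) ` {1..s} = (insert ?N \<circ> (\<lambda>\<tau>. \<tau> ` {1..s - 1})) \<tau>"
        unfolding ins(1) using ins(2) by auto
    qed
    ultimately show "bij_betw (\<lambda>\<tau>. (\<tau>(s := ?N)) ` {1..weight d lam mu}) (shuffles_at \<kappa> (s - 1))
        {B \<in> {B. B \<subseteq> {1..?N} \<and> ?N \<in> B}. card B = weight d lam mu}"
      unfolding s_def [symmetric] by (simp add: conj_assoc)
  qed auto
  have supp: "{S \<in> labelled_partitions {1..?N}. support S \<in> {B. B \<subseteq> {1..?N} \<and> ?N \<in> B} \<and> block_sizes S = type_sizes d lam mu} =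
      {S \<in> (labelled_partitions {1..?N} :: (nat set \<times> 'm) set set). ?N \<in> support S \<and> block_sizes S = type_sizes d lam mu}"
    by (auto simp: support_def dest: labelled_partitionsD(1))
  have "(\<Sum>\<tau>\<in>shuffles_at \<kappa> (s - 1). \<Sum>\<sigma>\<in>F. \<Sum>l\<in>?I \<rightarrow>\<^sub>E UNIV. \<Sum>c\<in>UNIV.
        hatted_term i (X c) j c ?N p (place ?I ?P (\<tau>(s := ?N)) \<sigma> l)) =
      (\<Sum>\<tau>\<in>shuffles_at \<kappa> (s - 1). \<Sum>\<sigma>\<in>F. \<Sum>c\<in>UNIV. \<Sum>l\<in>?I \<rightarrow>\<^sub>E UNIV.
        hatted_term i (X c) j c ?N p (place ?I ?P (\<tau>(s := ?N)) \<sigma> l))"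
    by (intro sum.cong refl sum.swap)
  also have "\<dots> = (\<Sum>\<tau>\<in>shuffles_at \<kappa> (s - 1). \<Sum>c\<in>UNIV. \<Sum>\<sigma>\<in>F. \<Sum>l\<in>?I \<rightarrow>\<^sub>E UNIV.
        hatted_term i (X c) j c ?N p (place ?I ?P (\<tau>(s := ?N)) \<sigma> l))"
    by (intro sum.cong refl sum.swap)
  also have "\<dots> = (\<Sum>c\<in>UNIV. \<Sum>\<tau>\<in>shuffles_at \<kappa> (s - 1). \<Sum>\<sigma>\<in>F. \<Sum>l\<in>?I \<rightarrow>\<^sub>E UNIV.
        hatted_term i (X c) j c ?N p (place ?I ?P (\<tau>(s := ?N)) \<sigma> l))"
    by (rule sum.swap)
  also have "\<dots> = (\<Sum>c\<in>UNIV. \<Sum>S\<in>{S \<in> labelled_partitions {1..?N}. ?N \<in> support S \<and>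
      block_sizes S = type_sizes d lam mu}. hatted_term i (X c) j c ?N p S)"
    unfolding place_sum supp ..
  finally show ?thesis
    unfolding sum_swap_inside_out by (rule trans [rotated]) (intro sum.cong refl summand)
qed

section \<open>Summation over all types\<close>

lemma sum_over_types:
  fixes G :: "('a set \<times> 'm) set \<Rightarrow> 'k::comm_monoid_add"
  assumes "finite A"
  shows "(\<Sum>(d, lam, mu)\<in>block_types \<kappa>. \<Sum>S\<in>{S \<in> A. block_sizes S = type_sizes d lam mu}. G S) =
    (\<Sum>S\<in>{S \<in> A. block_sizes S \<noteq> {#} \<and> set_mset (block_sizes S) \<subseteq> {1..\<kappa>} \<and>
        sum_mset (block_sizes S) \<le> \<kappa> + 1}. G S)"
proof -
  let ?Ms = "{M. M \<noteq> {#} \<and> set_mset M \<subseteq> {1..\<kappa>} \<and> sum_mset M \<le> \<kappa> + 1}"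
  let ?A = "{S \<in> A. block_sizes S \<in> ?Ms}"
  have fin: "finite ?Ms"
    using bij_betw_finite [OF type_sizes_bij] finite_block_types by blast
  have "(\<Sum>(d, lam, mu)\<in>block_types \<kappa>. \<Sum>S\<in>{S \<in> A. block_sizes S = type_sizes d lam mu}. G S) =
      (\<Sum>M\<in>?Ms. \<Sum>S\<in>{S \<in> A. block_sizes S = M}. G S)"
    by (subst sum.reindex_bij_betw [OF type_sizes_bij, symmetric]) (simp add: case_prod_unfold)
  also have "\<dots> = (\<Sum>M\<in>?Ms. \<Sum>S\<in>{S \<in> ?A. block_sizes S = M}. G S)"
    by (intro sum.cong refl) auto
  also have "\<dots> = (\<Sum>S\<in>?A. G S)"
    using assms fin by (intro sum.group) auto
  finally show ?thesis by simp
qed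

lemma set_mset_block_sizes:
  "finite S \<Longrightarrow> set_mset (block_sizes S) = (card \<circ> fst) ` S"
  by (simp add: block_sizes_def)

lemma block_sizes_le:
  assumes S: "S \<in> labelled_partitions {1..N}" and fin: "finite S"
  shows "block_sizes S \<noteq> {#} \<and> set_mset (block_sizes S) \<subseteq> {1..N} \<longleftrightarrow> S \<noteq> {}"
proof -
  have "card (fst x) \<in> {1..N}" if x: "x \<in> S" for x
  proof -
    have "fst x \<subseteq> {1..N}" "fst x \<noteq> {}" using labelled_partitionsD(1,2) [OF S x] .
    then have "finite (fst x)" "card (fst x) \<le> N"
      using finite_subset card_mono [of "{1..N}" "fst x"] by auto
    then show ?thesis using \<open>fst x \<noteq> {}\<close> by (simp add: Suc_le_eq card_gt_0_iff)
  qed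
  then show ?thesis
    using fin by (auto simp: set_mset_block_sizes simp flip: set_mset_eq_empty_iff)
qed

text \<open>Only the empty family has no type.\<close>

lemma sum_types_unrestricted:
  fixes G :: "(nat set \<times> 'm::finite) set \<Rightarrow> 'k::comm_ring_1"
  shows "(\<Sum>(d, lam, mu)\<in>block_types \<kappa>. \<Sum>S\<in>{S \<in> labelled_partitions {1..\<kappa>}. block_sizes S = type_sizes d lam mu}. G S) =
    (\<Sum>S\<in>labelled_partitions {1..\<kappa>} - {{}}. G S)"
proof -
  have "{S \<in> (labelled_partitions {1..\<kappa>} :: (nat set \<times> 'm) set set). block_sizes S \<noteq> {#} \<and>
      set_mset (block_sizes S) \<subseteq> {1..\<kappa>} \<and> sum_mset (block_sizes S) \<le> \<kappa> + 1} =
      labelled_partitions {1..\<kappa>} - {{}}"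
  proof -
    have "sum_mset (block_sizes S) \<le> \<kappa> + 1" if S: "S \<in> labelled_partitions {1..\<kappa>}" for S :: "(nat set \<times> 'm) set"
    proof -
      have "support S \<subseteq> {1..\<kappa>}" using labelled_partitionsD(1) [OF S] by (auto simp: support_def)
      then have "card (support S) \<le> \<kappa>" using card_mono [of "{1..\<kappa>}"] by fastforce
      then show ?thesis using card_support [OF S] by simp
    qed
    then show ?thesis
      using block_sizes_le labelled_partitions_finite [of "{1..\<kappa>}"] by blast
  qed
  then show ?thesis
    by (simp add: sum_over_types finite_labelled_partitions)
qed

text \<open>
  The restriction of the sizes \<open>\<lambda>\<close> to at most \<open>\<kappa>\<close> excludes precisely the family whose only block is
  \<open>{1..\<kappa> + 1}\<close>. It corresponds to \<open>A = {}\<close>, which is absent from the prolongation as well.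
\<close>

lemma sum_types_with_last_point:
  fixes G :: "(nat set \<times> 'm::finite) set \<Rightarrow> 'k::comm_ring_1"
  shows "(\<Sum>(d, lam, mu)\<in>block_types \<kappa>. \<Sum>S\<in>{S \<in> labelled_partitions {1..\<kappa> + 1}. \<kappa> + 1 \<in> support S \<and>
      block_sizes S = type_sizes d lam mu}. G S) =
    (\<Sum>S\<in>{S \<in> labelled_partitions {1..\<kappa> + 1}. \<kappa> + 1 \<in> support S \<and> (\<forall>x\<in>S. fst x \<noteq> {1..\<kappa> + 1})}. G S)"
proof -
  let ?A = "{S \<in> (labelled_partitions {1..\<kappa> + 1} :: (nat set \<times> 'm) set set). \<kappa> + 1 \<in> support S}"
  have fin: "finite ?A" by (simp add: finite_labelled_partitions)
  have iff: "block_sizes S \<noteq> {#} \<and> set_mset (block_sizes S) \<subseteq> {1..\<kappa>} \<and> sum_mset (block_sizes S) \<le> \<kappa> + 1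
      \<longleftrightarrow> (\<forall>x\<in>S. fst x \<noteq> {1..\<kappa> + 1})" if "S \<in> ?A" for S
  proof -
    from that have S: "S \<in> labelled_partitions {1..\<kappa> + 1}" "\<kappa> + 1 \<in> support S" by auto
    have finS: "finite S" using labelled_partitions_finite [OF _ S(1)] by simp
    have sub: "fst x \<subseteq> {1..\<kappa> + 1}" if "x \<in> S" for x using labelled_partitionsD(1) [OF S(1) that] .
    have "support S \<subseteq> {1..\<kappa> + 1}" using sub by (auto simp: support_def)
    then have "card (support S) \<le> \<kappa> + 1" using card_mono [of "{1..\<kappa> + 1}"] by fastforce
    then have 1: "sum_mset (block_sizes S) \<le> \<kappa> + 1" using card_support [OF S(1)] by simp
    have "S \<noteq> {}" using S(2) by (auto simp: support_def)
    then have 2: "block_sizes S \<noteq> {#}" "set_mset (block_sizes S) \<subseteq> {1..\<kappa> + 1}"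
      using block_sizes_le [OF S(1) finS] by auto
    have 3: "card (fst x) = \<kappa> + 1 \<longleftrightarrow> fst x = {1..\<kappa> + 1}" if "x \<in> S" for x
      using card_subset_eq [OF _ sub [OF that]] by auto
    have "set_mset (block_sizes S) \<subseteq> {1..\<kappa>} \<longleftrightarrow> (\<forall>x\<in>S. card (fst x) \<noteq> \<kappa> + 1)"
      using 2(2) unfolding set_mset_block_sizes [OF finS] by (fastforce simp: image_subset_iff)
    then show ?thesis using 1 2 3 by blast
  qed
  have "{S \<in> ?A. block_sizes S \<noteq> {#} \<and> set_mset (block_sizes S) \<subseteq> {1..\<kappa>} \<and> sum_mset (block_sizes S) \<le> \<kappa> + 1} =
      {S \<in> labelled_partitions {1..\<kappa> + 1}. \<kappa> + 1 \<in> support S \<and> (\<forall>x\<in>S. fst x \<noteq> {1..\<kappa> + 1})}"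
    using iff by blast
  then show ?thesis
    using sum_over_types [OF fin, of G \<kappa>] by (simp add: conj_assoc)
qed

text \<open>
  The set \<open>A\<close> is the complement of the block of \<open>\<kappa> + 1\<close>; it is nonempty because that block is not
  everything.
\<close>

lemma last_block_bij:
  fixes \<kappa> :: nat and j :: 'm
  shows "bij_betw (\<lambda>(A, S). insert (insert (\<kappa> + 1) ({1..\<kappa>} - A), j) S)
    (SIGMA A:Pow {1..\<kappa>} - {{}}. labelled_partitions A)
    {S \<in> labelled_partitions {1..\<kappa> + 1}. (\<exists>x\<in>S. \<kappa> + 1 \<in> fst x \<and> snd x = j) \<and> (\<forall>x\<in>S. fst x \<noteq> {1..\<kappa> + 1})}"
  (is "bij_betw ?f ?D ?R")
proof (rule bij_betw_imageI)
  let ?N = "\<kappa> + 1"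
  have old: "?N \<notin> fst x" if "A \<subseteq> {1..\<kappa>}" "S \<in> labelled_partitions A" "x \<in> S" for A and S :: "(nat set \<times> 'm) set" and x
    using labelled_partitionsD(1) [OF that(2,3)] that(1) by fastforce
  show "inj_on ?f ?D"
  proof (rule inj_onI)
    fix z z' assume z: "z \<in> ?D" "z' \<in> ?D" "?f z = ?f z'"
    obtain A S A' S' where zd: "z = (A, S)" "z' = (A', S')" by (metis surj_pair)
    let ?x = "(insert ?N ({1..\<kappa>} - A), j)" and ?x' = "(insert ?N ({1..\<kappa>} - A'), j)"
    have A: "A \<subseteq> {1..\<kappa>}" "A' \<subseteq> {1..\<kappa>}" "S \<in> labelled_partitions A" "S' \<in> labelled_partitions A'"
      and eq: "insert ?x S = insert ?x' S'"
      using z by (auto simp: zd)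
    have new: "?x \<notin> S" "?x' \<notin> S'" "?x \<notin> S'" using old [OF A(1,3)] old [OF A(2,4)] by fastforce+
    then have x: "?x = ?x'" using eq by blast
    then have "S = S'" using eq new by (metis insert_ident)
    moreover have "?N \<notin> {1..\<kappa>}" by simp
    then have "{1..\<kappa>} - A = {1..\<kappa>} - A'" using x by (metis Diff_iff insert_ident prod.inject)
    then have "A = A'" using A(1,2) by blast
    ultimately show "z = z'" by (simp add: zd)
  qed
  show "?f ` ?D = ?R"
  proof (intro equalityI subsetI)
    fix S' assume "S' \<in> ?f ` ?D"
    then obtain A S where A: "A \<subseteq> {1..\<kappa>}" "A \<noteq> {}" and S: "S \<in> labelled_partitions A"
      and S': "S' = insert (insert ?N ({1..\<kappa>} - A), j) S"
      by auto
    have sub: "fst x \<subseteq> A" if "x \<in> S" for x using labelled_partitionsD(1) [OF S that] .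
    have "S' \<in> labelled_partitions {1..?N}"
      unfolding S'
    proof (rule labelled_partitionsI)
      show "b \<subseteq> {1..?N} \<and> b \<noteq> {}" if "(b, l) \<in> insert (insert ?N ({1..\<kappa>} - A), j) S" for b l
        using that A(1) sub [of "(b, l)"] labelled_partitionsD(2) [OF S, of "(b, l)"] by fastforce
      show "fst x \<inter> fst y = {}" if "x \<in> insert (insert ?N ({1..\<kappa>} - A), j) S"
        "y \<in> insert (insert ?N ({1..\<kappa>} - A), j) S" "x \<noteq> y" for x y
      proof -
        have "(insert ?N ({1..\<kappa>} - A)) \<inter> fst z = {}" if "z \<in> S" for z
          using sub [OF that] old [OF A(1) S that] by blast
        then show ?thesis
          using that labelled_partitionsD(3) [OF S, of x y] by (metis Int_commute fst_conv insert_iff)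
      qed
    qed
    moreover have "insert ?N ({1..\<kappa>} - A) \<noteq> {1..?N}"
    proof -
      obtain a where "a \<in> A" using A(2) by blast
      then have "a \<in> {1..?N}" "a \<notin> insert ?N ({1..\<kappa>} - A)" using A(1) by fastforce+
      then show ?thesis by blast
    qed
    moreover have "fst x \<noteq> {1..?N}" if "x \<in> S" for x
      using old [OF A(1) S that] by auto
    ultimately show "S' \<in> ?R" by (auto simp: S')
  next
    fix S' assume "S' \<in> ?R"
    then obtain B where S': "S' \<in> labelled_partitions {1..?N}" and B: "(B, j) \<in> S'" "?N \<in> B" "B \<noteq> {1..?N}"
      by fastforce
    have Bsub: "B \<subseteq> {1..?N}" using labelled_partitionsD(1) [OF S' B(1)] by simp
    let ?A = "{1..?N} - B" and ?S = "S' - {(B, j)}"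
    have "?A \<in> Pow {1..\<kappa>} - {{}}"
      using B Bsub by (auto simp: le_Suc_eq)
    moreover have "?S \<in> labelled_partitions ?A"
    proof (rule labelled_partitionsI)
      show "b \<subseteq> ?A \<and> b \<noteq> {}" if "(b, l) \<in> ?S" for b l
        using that labelled_partitionsD(1,2) [OF S', of "(b, l)"] labelled_partitionsD(3) [OF S' _ B(1), of "(b, l)"]
        by auto
      show "fst x \<inter> fst y = {}" if "x \<in> ?S" "y \<in> ?S" "x \<noteq> y" for x y
        using that labelled_partitionsD(3) [OF S', of x y] by auto
    qed
    moreover have "insert ?N ({1..\<kappa>} - ?A) = B"
      using B Bsub by (auto simp: le_Suc_eq)
    then have "?f (?A, ?S) = S'" using B(1) by auto
    ultimately show "S' \<in> ?f ` ?D"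
      by (intro image_eqI [of _ _ "(?A, ?S)"]) auto
  qed
qed

lemma sum_hatted_terms:
  fixes i :: "nat \<Rightarrow> 'n::finite" and f :: "('k::real_normed_field, 'n, 'm::finite) base \<Rightarrow> 'k"
  shows "(\<Sum>S\<in>{S \<in> labelled_partitions {1..\<kappa> + 1}. \<kappa> + 1 \<in> support S \<and> (\<forall>x\<in>S. fst x \<noteq> {1..\<kappa> + 1})}.
      hatted_term i f j c (\<kappa> + 1) p S) =
    (\<Sum>A\<in>Pow {1..\<kappa>} - {{}}. faa_di_bruno i f A p *
       snd p (j, add_mset c (image_mset i (mset_set ({1..\<kappa>} - A)))))"
proof -
  let ?N = "\<kappa> + 1"
  let ?R = "{S \<in> (labelled_partitions {1..?N} :: (nat set \<times> 'm) set set).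
    (\<exists>x\<in>S. ?N \<in> fst x \<and> snd x = j) \<and> (\<forall>x\<in>S. fst x \<noteq> {1..?N})}"
  let ?g = "\<lambda>A S. insert (insert ?N ({1..\<kappa>} - A), j) (S :: (nat set \<times> 'm) set)"
  have "(\<Sum>S\<in>{S \<in> labelled_partitions {1..?N}. ?N \<in> support S \<and> (\<forall>x\<in>S. fst x \<noteq> {1..?N})}.
      hatted_term i f j c ?N p S) = (\<Sum>S\<in>?R. hatted_term i f j c ?N p S)"
  proof (rule sum.mono_neutral_right)
    show "finite {S \<in> (labelled_partitions {1..?N} :: (nat set \<times> 'm) set set). ?N \<in> support S \<and> (\<forall>x\<in>S. fst x \<noteq> {1..?N})}"
      by (simp add: finite_labelled_partitions)
  qed (auto simp: hatted_term_def support_def)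
  also have "\<dots> = (\<Sum>(A, S)\<in>(SIGMA A:Pow {1..\<kappa>} - {{}}. labelled_partitions A). hatted_term i f j c ?N p (?g A S))"
    by (subst sum.reindex_bij_betw [OF last_block_bij, symmetric]) (simp add: case_prod_unfold)
  also have "\<dots> = (\<Sum>A\<in>Pow {1..\<kappa>} - {{}}. \<Sum>S\<in>labelled_partitions A. hatted_term i f j c ?N p (?g A S))"
    by (subst sum.Sigma) (auto intro: finite_labelled_partitions finite_subset)
  also have "\<dots> = (\<Sum>A\<in>Pow {1..\<kappa>} - {{}}. \<Sum>S\<in>labelled_partitions A. jet_term i f A p S *
       snd p (j, add_mset c (image_mset i (mset_set ({1..\<kappa>} - A)))))"
  proof (intro sum.cong refl)
    fix A and S :: "(nat set \<times> 'm) set"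
    assume A: "A \<in> Pow {1..\<kappa>} - {{}}" and S: "S \<in> labelled_partitions A"
    let ?B = "insert ?N ({1..\<kappa>} - A)"
    have finA: "finite A" using A finite_subset by auto
    have finS: "finite S" using labelled_partitions_finite [OF finA S] .
    have sub: "fst x \<subseteq> A" if "x \<in> S" for x using labelled_partitionsD(1) [OF S that] .
    have old: "?N \<notin> fst x" if "x \<in> S" for x using sub [OF that] A by fastforce
    have new: "(?B, j) \<notin> S" using old by fastforce
    have supp: "{1..?N} - support (?g A S) = A - support S"
      using A sub by (fastforce simp: support_def le_Suc_eq)
    have "jet_var (i(?N := c)) x = jet_var i x" if "x \<in> S" for x
      unfolding jet_var_def using old [OF that] by (intro arg_cong2 [of _ _ _ _ Pair] refl image_mset_cong)
        (metis elem_mset_set empty_iff fun_upd_other mset_set.infinite set_mset_empty)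
    moreover have "jet_var (i(?N := c)) (?B, j) = (j, add_mset c (image_mset i (mset_set ({1..\<kappa>} - A))))"
    proof -
      have "image_mset (i(?N := c)) (mset_set ({1..\<kappa>} - A)) = image_mset i (mset_set ({1..\<kappa>} - A))"
        by (intro image_mset_cong) auto
      then show ?thesis by (simp add: jet_var_def)
    qed
    ultimately have prod: "(\<Prod>x\<in>?g A S. snd p (jet_var (i(?N := c)) x)) =
        snd p (j, add_mset c (image_mset i (mset_set ({1..\<kappa>} - A)))) * (\<Prod>x\<in>S. snd p (jet_var i x))"
      using finS new by simp
    have "y_derivs (?g A S) = (add_mset (Inr j) (y_derivs S) :: ('n + 'm) multiset)"
      by (subst y_derivs_insert [OF finS new]) simp
    then have M: "x_derivs i ({1..?N} - support (?g A S)) + y_derivs (?g A S) - {#Inr j#} =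
        x_derivs i (A - support S) + y_derivs S"
      unfolding supp by simp
    have "\<exists>x\<in>?g A S. ?N \<in> fst x \<and> snd x = j" by simp
    then show "hatted_term i f j c ?N p (?g A S) = jet_term i f A p S *
        snd p (j, add_mset c (image_mset i (mset_set ({1..\<kappa>} - A))))"
      unfolding hatted_term_def jet_term_def prod M by (simp only: of_bool_eq mult_1 mult_ac)
  qed
  finally show ?thesis
    by (simp add: faa_di_bruno_def sum_distrib_right)
qed

lemma sum_types_nested:
  fixes g h :: "_ \<Rightarrow> _ \<Rightarrow> _ \<Rightarrow> 'k::comm_monoid_add"
  assumes "\<And>d lam mu. (d, lam, mu) \<in> block_types \<kappa> \<Longrightarrow> h d lam mu = g d lam mu"
  shows "(\<Sum>d = 1..\<kappa> + 1. \<Sum>lam\<in>lam_tuples \<kappa> d. \<Sum>mu\<in>mu_tuples \<kappa> d lam. h d lam mu) =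
    (\<Sum>(d, lam, mu)\<in>block_types \<kappa>. g d lam mu)"
proof -
  have "(\<Sum>d = 1..\<kappa> + 1. \<Sum>lam\<in>lam_tuples \<kappa> d. \<Sum>mu\<in>mu_tuples \<kappa> d lam. h d lam mu) =
      (\<Sum>d = 1..\<kappa> + 1. \<Sum>lam\<in>lam_tuples \<kappa> d. \<Sum>mu\<in>mu_tuples \<kappa> d lam. g d lam mu)"
    by (intro sum.cong refl assms) (simp add: block_types_def)
  then show ?thesis
    unfolding block_types_def
    by (subst sum.Sigma [symmetric])
      (auto simp: finite_lam_tuples finite_mu_tuples sum.Sigma intro!: sum.cong finite_SigmaI)
qed

section \<open>The prolongation formula\<close>

theorem theorem5p12:
  fixes X :: "'n::finite \<Rightarrow> ('k::real_normed_field, 'n, 'm::finite) base \<Rightarrow> 'k"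
    and Y :: "'m \<Rightarrow> ('k, 'n, 'm) base \<Rightarrow> 'k"
    and U :: "('k, 'n, 'm) base set"
    and F :: "nat \<Rightarrow> (nat \<Rightarrow> nat) \<Rightarrow> (nat \<Rightarrow> nat) \<Rightarrow> (nat \<Rightarrow> nat) set"
    and i :: "nat \<Rightarrow> 'n" and j :: 'm and \<kappa> :: nat
    and x :: "'k^'n" and u :: "'m \<times> 'n multiset \<Rightarrow> 'k"
  assumes "open U"
    and "\<And>k. smooth_on U (X k)"
    and "\<And>l. smooth_on U (Y l)"
    and "\<kappa> \<ge> 1"
    and "\<And>d lam mu. d \<in> {1..\<kappa> + 1} \<Longrightarrow> lam \<in> lam_tuples \<kappa> d \<Longrightarrow> mu \<in> mu_tuples \<kappa> d lam \<Longrightarrow>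
           coset_representatives d lam mu (F d lam mu)"
    and "jet_base (x, u) \<in> U"
  shows "prolong_coeff X Y j i \<kappa> (x, u) =
    partials (map (\<lambda>t. Inl (i t)) [1..<\<kappa> + 1]) (Y j) (jet_base (x, u)) +
    (\<Sum>d = 1..\<kappa> + 1. \<Sum>lam \<in> lam_tuples \<kappa> d. \<Sum>mu \<in> mu_tuples \<kappa> d lam.
      let s = weight d lam mu; T = triple d lam mu in
      \<Sum>l \<in> set (blocks d mu) \<rightarrow>\<^sub>E (UNIV :: 'm set).
      \<Sum>k \<in> set (triples d lam mu) \<rightarrow>\<^sub>E (UNIV :: 'n set).
        ((\<Sum>\<sigma> \<in> F d lam mu. \<Sum>\<tau> \<in> shuffles_at \<kappa> s.
            (\<Prod>t = 1..s. of_bool (i (\<tau> t) = k (T (\<sigma> t)))) *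
            partials (map (\<lambda>t. Inl (i (\<tau> t))) [s + 1..<\<kappa> + 1] @
                      map (\<lambda>b. Inr (l b)) (blocks d mu))
              (Y j) (jet_base (x, u)))
         - (\<Sum>\<sigma> \<in> F d lam mu. \<Sum>\<tau> \<in> shuffles_at \<kappa> (s - 1).
            (\<Prod>t = 1..s - 1. of_bool (i (\<tau> t) = k (T (\<sigma> t)))) *
            of_bool (j = l (block_of (T (\<sigma> s)))) *
            partials (map (\<lambda>t. Inl (i (\<tau> t))) [s..<\<kappa> + 1] @
                      map (\<lambda>b. Inr (l b))
                        (filter (\<lambda>b. b \<noteq> block_of (T (\<sigma> s))) (blocks d mu)))
              (X (k (T (\<sigma> s)))) (jet_base (x, u))))
        * (\<Prod>e = 1..d. \<Prod>\<nu> = 1..mu e.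
             u (l (e, \<nu>), image_mset (\<lambda>\<gamma>. k (e, \<nu>, \<gamma>)) (mset_set {1..lam e}))))"
proof -
  let ?p = "(x, u)"
  have U: "open U" "jet_base ?p \<in> U" and X: "\<And>k. smooth_on U (X k)" and Y: "\<And>l. smooth_on U (Y l)"
    using assms by auto
  let ?YS = "\<lambda>d lam mu. \<Sum>S\<in>{S \<in> labelled_partitions {1..\<kappa>}. block_sizes S = type_sizes d lam mu}.
    jet_term i (Y j) {1..\<kappa>} ?p S"
  let ?XS = "\<lambda>c d lam mu. \<Sum>S\<in>{S \<in> labelled_partitions {1..\<kappa> + 1}. \<kappa> + 1 \<in> support S \<and>
    block_sizes S = type_sizes d lam mu}. hatted_term i (X c) j c (\<kappa> + 1) ?p S"
  have type_term: "(let s = weight d lam mu; T = triple d lam mu in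
      \<Sum>l \<in> set (blocks d mu) \<rightarrow>\<^sub>E (UNIV :: 'm set).
      \<Sum>k \<in> set (triples d lam mu) \<rightarrow>\<^sub>E (UNIV :: 'n set).
        ((\<Sum>\<sigma> \<in> F d lam mu. \<Sum>\<tau> \<in> shuffles_at \<kappa> s.
            (\<Prod>t = 1..s. of_bool (i (\<tau> t) = k (T (\<sigma> t)))) *
            partials (map (\<lambda>t. Inl (i (\<tau> t))) [s + 1..<\<kappa> + 1] @
                      map (\<lambda>b. Inr (l b)) (blocks d mu))
              (Y j) (jet_base (x, u)))
         - (\<Sum>\<sigma> \<in> F d lam mu. \<Sum>\<tau> \<in> shuffles_at \<kappa> (s - 1).
            (\<Prod>t = 1..s - 1. of_bool (i (\<tau> t) = k (T (\<sigma> t)))) *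
            of_bool (j = l (block_of (T (\<sigma> s)))) *
            partials (map (\<lambda>t. Inl (i (\<tau> t))) [s..<\<kappa> + 1] @
                      map (\<lambda>b. Inr (l b))
                        (filter (\<lambda>b. b \<noteq> block_of (T (\<sigma> s))) (blocks d mu)))
              (X (k (T (\<sigma> s)))) (jet_base (x, u))))
        * (\<Prod>e = 1..d. \<Prod>\<nu> = 1..mu e.
             u (l (e, \<nu>), image_mset (\<lambda>\<gamma>. k (e, \<nu>, \<gamma>)) (mset_set {1..lam e})))) =
      ?YS d lam mu - (\<Sum>c\<in>UNIV. ?XS c d lam mu)"
    if t: "(d, lam, mu) \<in> block_types \<kappa>" for d lam mu
  proof -
    have F: "coset_representatives d lam mu (F d lam mu)"
      using t assms(5) by (auto simp: block_types_def)
    show ?thesis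
      unfolding Let_def left_diff_distrib sum_subtractf
      using sum_type_jet_terms [OF U(1) Y U(2) t F, of i j] sum_type_hatted_terms [where X = X, OF U(1) X U(2) t F, of i j]
      by (simp only: snd_conv)
  qed
  have "(\<Sum>(d, lam, mu)\<in>block_types \<kappa>. ?YS d lam mu - (\<Sum>c\<in>UNIV. ?XS c d lam mu)) =
      (\<Sum>(d, lam, mu)\<in>block_types \<kappa>. ?YS d lam mu) - (\<Sum>c\<in>UNIV. \<Sum>(d, lam, mu)\<in>block_types \<kappa>. ?XS c d lam mu)"
    unfolding case_prod_unfold sum_subtractf by (subst sum.swap) rule
  also have "\<dots> = (\<Sum>S\<in>labelled_partitions {1..\<kappa>} - {{}}. jet_term i (Y j) {1..\<kappa>} ?p S) -
      (\<Sum>c\<in>UNIV. \<Sum>A\<in>Pow {1..\<kappa>} - {{}}. faa_di_bruno i (X c) A ?p *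
       snd ?p (j, add_mset c (image_mset i (mset_set ({1..\<kappa>} - A)))))"
    unfolding sum_types_unrestricted sum_types_with_last_point sum_hatted_terms ..
  finally have types_sum: "(\<Sum>(d, lam, mu)\<in>block_types \<kappa>. ?YS d lam mu - (\<Sum>c\<in>UNIV. ?XS c d lam mu)) = \<dots>" .
  have leading: "partials (map (\<lambda>t. Inl (i t)) [1..<\<kappa> + 1]) (Y j) (jet_base ?p) =
      jet_term i (Y j) {1..\<kappa>} ?p {}"
  proof -
    have "mset (map (\<lambda>t. Inl (i t)) [1..<\<kappa> + 1]) =
        x_derivs i ({1..\<kappa>} - support ({} :: (nat set \<times> 'm) set)) + (y_derivs ({} :: (nat set \<times> 'm) set) :: ('n + 'm) multiset)"
      using mset_map_upt [of "\<lambda>t. t" 1 \<kappa> i] by (simp add: support_def y_derivs_def del: upt_Suc)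
    then show ?thesis
      using partials_mset [OF U(1) Y U(2)] by (simp add: jet_term_def)
  qed
  have faa: "faa_di_bruno i (Y j) {1..\<kappa>} ?p = jet_term i (Y j) {1..\<kappa>} ?p {} +
      (\<Sum>S\<in>labelled_partitions {1..\<kappa>} - {{}}. jet_term i (Y j) {1..\<kappa>} ?p S)"
    unfolding faa_di_bruno_def
    by (rule sum.remove) (auto simp: finite_labelled_partitions intro: labelled_partitionsI)
  show ?thesis
    unfolding prolong_coeff_eq_faa_di_bruno [OF U(1) X Y U(2)] leading faa add_diff_eq [symmetric]
    by (rule arg_cong [OF sym [OF trans [OF sum_types_nested [OF type_term] types_sum]]])
qed

end
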